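(* Let $\Omega\subsetneq\mathbb{C}$ be a simply connected proper domain with Poincaré distance $\rho_\Omega$. Let $\psi:\Omega\to\mathbb{D}$ be a conformal map (a biholomorphism onto $\mathbb{D}$), and let $g:\Omega\to\Omega$ be a holomorphic self-map with no fixed point in $\Omega$. Define $\widetilde g=\psi\circ g\circ\psi^{-1}:\mathbb{D}\to\mathbb{D}$, and suppose that $\widetilde g$ is hyperbolic, with Denjoy--Wolff point $\tau\in\partial\mathbb{D}$ and angular multiplier $\alpha\in(0,1)$. Then the following conditions are equivalent: (i) $g$ has an extremal hyperbolic rate in $\Omega$, that is, for some (equivalently, every) $z,w\in\Omega$, $$\rho_\Omega\bigl(g^{\circ n}(z),w\bigr)=n\log\frac1\alpha+O(1),\qquad n\to\infty;$$ (ii) $\widetilde g$ has an extremal hyperbolic rate in $\mathbb{D}$; (iii) the Herglotz measure $\sigma$ associated with $\widetilde g$ satisfies $$\int_{\partial\mathbb{D}\setminus\{\tau\}}\log\frac{1}{|\zeta-\tau|}\,d\sigma(\zeta)<\infty.$$ In particular, the extremal hyperbolic rate is intrinsic to $\Omega$ and does not depend on the choice of the Riemann mapping $\psi$.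
   Context: $\mathbb{D}=\{z\in\mathbb{C}:|z|<1\}$. $g^{\circ n}$ denotes the $n$-th iterate. For a hyperbolic domain $\Omega$, $\lambda_\Omega$ is the density of the Poincaré metric of curvature $-1$ and $\rho_\Omega(z,w)=\inf_\gamma\int_\gamma\lambda_\Omega(\xi)\,|d\xi|$ over rectifiable curves $\gamma$ in $\Omega$ joining $z$ to $w$; for the disk, $\lambda_{\mathbb{D}}(z)=2/(1-|z|^2)$ and $\rho_{\mathbb{D}}(z,w)=2\tanh^{-1}\left|\frac{z-w}{1-\bar w z}\right|$. $O(1)$ denotes a quantity bounded independently of $n$ (the bound may depend on the map and on $z,w$). A holomorphic $G:\mathbb{D}\to\mathbb{D}$ with no fixed point in $\mathbb{D}$ has a unique Denjoy--Wolff point $\tau\in\partial\mathbb{D}$, with $G^{\circ n}(z)\to\tau$ for every $z\in\mathbb{D}$; the non-tangential limit $\alpha:=\angle\lim_{z\to\tau}G'(z)$ exists, equals $\liminf_{z\to\tau}\frac{1-|G(z)|}{1-|z|}$, and lies in $(0,1]$ (the angular multiplier). $G$ is hyperbolic if $\alpha\in(0,1)$. A hyperbolic $G$ has an extremal hyperbolic rate in $\mathbb{D}$ if for some (equivalently, every) $z,w\in\mathbb{D}$, $\rho_{\mathbb{D}}(G^{\circ n}(z),w)=n\log\frac1\alpha+O(1)$ as $n\to\infty$. The Herglotz measure associated with a hyperbolic $G$ is the finite positive Borel measure $\sigma$ on $\partial\mathbb{D}\setminus\{\tau\}$ for which there is $b\in\mathbb{R}$ with $$\frac{1+\overline{\tau}G(z)}{1-\overline{\tau}G(z)}=\frac{1}{\alpha}\,\frac{1+\overline{\tau}z}{1-\overline{\tau}z}+ib+\int_{\partial\mathbb{D}\setminus\{\tau\}}\frac{\zeta+z}{\zeta-z}\,d\sigma(\zeta),\qquad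 z\in\mathbb{D}.$$ *)

theory Defs
  imports "HOL-Complex_Analysis.Complex_Analysis" "HOL-Library.Landau_Symbols"
begin

abbreviation unit_disc :: "complex set" where
  "unit_disc \<equiv> ball 0 1"

text \<open>
  Density of the Poincare metric of curvature $-1$. It is the push-forward of the density
  $2/(1-|z|^2)$ under a holomorphic universal covering $p$ of \<open>\<Omega>\<close> by the unit disc. It is
  meaningful only if \<open>\<Omega>\<close> is a hyperbolic domain, in which case it depends neither on the covering
  nor on the preimage of \<open>w\<close>.
\<close>

definition poincare_density :: "complex set \<Rightarrow> complex \<Rightarrow> real" where
  "poincare_density \<Omega> w =
     (THE l. \<exists>p z. p holomorphic_on unit_disc \<and> covering_space unit_disc p \<Omega> \<and>
        z \<in> unit_disc \<and> p z = w \<and> l * cmod (deriv p z) = 2 / (1 - (cmod z)\<^sup>2))"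

definition rectifiable :: "(real \<Rightarrow> complex) \<Rightarrow> bool" where
  "rectifiable \<gamma> \<longleftrightarrow> path \<gamma> \<and>
     (\<exists>B. \<forall>\<D>. \<D> division_of {0..1} \<longrightarrow> (\<Sum>K\<in>\<D>. dist (\<gamma> (Inf K)) (\<gamma> (Sup K))) \<le> B)"

text \<open>
  The integral of \<open>u\<close> along \<open>\<gamma>\<close> with respect to arc length, as the limit of the sums
  $\sum_i u(\gamma(s_i))\,|\gamma(t_i)-\gamma(t_{i-1})|$ with $t_{i-1}\le s_i\le t_i$ as the mesh
  of the partition tends to $0$. The limit exists whenever \<open>\<gamma>\<close> is rectifiable and \<open>u\<close> is continuous
  on its image; no differentiability of \<open>\<gamma>\<close> is required.
\<close>

definition has_arclength_integral ::
    "(complex \<Rightarrow> real) \<Rightarrow> real \<Rightarrow> (real \<Rightarrow> complex) \<Rightarrow> bool" where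
  "has_arclength_integral u I \<gamma> \<longleftrightarrow>
     (\<forall>\<epsilon>>0. \<exists>\<delta>>0. \<forall>P. P tagged_division_of {0..1} \<and> (\<lambda>s. ball s \<delta>) fine P \<longrightarrow>
        \<bar>(\<Sum>(s, K)\<in>P. u (\<gamma> s) * dist (\<gamma> (Inf K)) (\<gamma> (Sup K))) - I\<bar> < \<epsilon>)"

definition poincare_dist :: "complex set \<Rightarrow> complex \<Rightarrow> complex \<Rightarrow> real" where
  "poincare_dist \<Omega> z w =
     Inf {L. \<exists>\<gamma>. rectifiable \<gamma> \<and> path_image \<gamma> \<subseteq> \<Omega> \<and> pathstart \<gamma> = z \<and> pathfinish \<gamma> = w \<and>
               has_arclength_integral (poincare_density \<Omega>) L \<gamma>}"

definition conformal_onto_disc :: "(complex \<Rightarrow> complex) \<Rightarrow> complex set \<Rightarrow> bool" where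
  "conformal_onto_disc \<psi> \<Omega> \<longleftrightarrow>
     \<psi> holomorphic_on \<Omega> \<and> bij_betw \<psi> \<Omega> unit_disc \<and> inv_into \<Omega> \<psi> holomorphic_on unit_disc"

definition conjugate_map ::
    "complex set \<Rightarrow> (complex \<Rightarrow> complex) \<Rightarrow> (complex \<Rightarrow> complex) \<Rightarrow> complex \<Rightarrow> complex" where
  "conjugate_map \<Omega> \<psi> g = \<psi> \<circ> g \<circ> inv_into \<Omega> \<psi>"

definition denjoy_wolff_point :: "(complex \<Rightarrow> complex) \<Rightarrow> complex \<Rightarrow> bool" where
  "denjoy_wolff_point G \<tau> \<longleftrightarrow>
     \<tau> \<in> sphere 0 1 \<and> (\<forall>z\<in>unit_disc. (\<lambda>n. (G ^^ n) z) \<longlonglongrightarrow> \<tau>)"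

text \<open>Non-tangential limits are limits within every Stolz region at \<open>\<tau>\<close>.\<close>

definition has_angular_limit ::
    "(complex \<Rightarrow> complex) \<Rightarrow> complex \<Rightarrow> complex \<Rightarrow> bool" where
  "has_angular_limit f l \<tau> \<longleftrightarrow>
     (\<forall>M>1. (f \<longlongrightarrow> l) (at \<tau> within {z \<in> unit_disc. cmod (z - \<tau>) < M * (1 - cmod z)}))"

text \<open>\<open>G\<close> is hyperbolic with Denjoy--Wolff point \<open>\<tau>\<close> and angular multiplier \<open>\<alpha>\<close>.\<close>

definition hyperbolic_self_map :: "(complex \<Rightarrow> complex) \<Rightarrow> complex \<Rightarrow> real \<Rightarrow> bool" where
  "hyperbolic_self_map G \<tau> \<alpha> \<longleftrightarrow>
     G holomorphic_on unit_disc \<and> G ` unit_disc \<subseteq> unit_disc \<and> (\<forall>z\<in>unit_disc. G z \<noteq> z) \<and>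
     denjoy_wolff_point G \<tau> \<and> has_angular_limit (deriv G) (of_real \<alpha>) \<tau> \<and> 0 < \<alpha> \<and> \<alpha> < 1"

definition hyperbolic_rate_at ::
    "complex set \<Rightarrow> (complex \<Rightarrow> complex) \<Rightarrow> real \<Rightarrow> complex \<Rightarrow> complex \<Rightarrow> bool" where
  "hyperbolic_rate_at \<Omega> g \<alpha> z w \<longleftrightarrow>
     (\<lambda>n. poincare_dist \<Omega> ((g ^^ n) z) w - real n * ln (1 / \<alpha>)) \<in> O(\<lambda>_. 1)"

definition extremal_hyperbolic_rate ::
    "complex set \<Rightarrow> (complex \<Rightarrow> complex) \<Rightarrow> real \<Rightarrow> bool" where
  "extremal_hyperbolic_rate \<Omega> g \<alpha> \<longleftrightarrow> (\<exists>z\<in>\<Omega>. \<exists>w\<in>\<Omega>. hyperbolic_rate_at \<Omega> g \<alpha> z w)"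

text \<open>\<open>\<sigma>\<close> lives on the punctured circle, so it carries no mass at \<open>\<tau>\<close>.\<close>

definition herglotz_measure ::
    "(complex \<Rightarrow> complex) \<Rightarrow> complex \<Rightarrow> real \<Rightarrow> complex measure \<Rightarrow> bool" where
  "herglotz_measure G \<tau> \<alpha> \<sigma> \<longleftrightarrow>
     finite_measure \<sigma> \<and> sets \<sigma> = sets (restrict_space borel (sphere 0 1 - {\<tau>})) \<and>
     (\<exists>b::real. \<forall>z\<in>unit_disc.
        (1 + cnj \<tau> * G z) / (1 - cnj \<tau> * G z) =
          of_real (1 / \<alpha>) * ((1 + cnj \<tau> * z) / (1 - cnj \<tau> * z)) + \<i> * of_real b +
          (\<integral>\<zeta>. (\<zeta> + z) / (\<zeta> - z) \<partial>\<sigma>))"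

end

theory Submission
  imports Defs
begin

text \<open>
  Every statement about rates reduces to one quantity: how fast a single orbit of the conjugated
  map \<open>G\<close> runs to the unit circle. Since \<open>\<Omega>\<close> is simply connected, its universal covering is the
  inverse of \<open>\<psi>\<close>, so its hyperbolic distance is \<open>2 artanh\<close> of the pseudo-hyperbolic
  distance of the \<open>\<psi>\<close>-images (\<open>poincare_dist_simply_connected\<close>). For a fixed
  second argument this equals \<open>- ln (1 - |b|\<^sup>2)\<close> up to a bounded error, and by Schwarz-Pick two
  orbits stay at bounded distance from each other. So the rate condition, for whichever base points
  and whichever Riemann map, says
  \<open>- ln (1 - |z\<^sub>n|\<^sup>2) = n ln (1/\<alpha>) + O(1)\<close> along the orbit \<open>z\<^sub>n\<close> of \<open>0\<close>
  (\<open>extremal_rate_iff_boundary_rate\<close>).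

  To compare this with the Herglotz measure, send \<open>\<tau>\<close> to infinity by
  \<open>w = (\<tau> + z) / (\<tau> - z)\<close> and write \<open>R\<^sub>n\<close> for the real part of \<open>w\<^sub>n\<close>, which is the Poisson kernel
  \<open>(1 - |z\<^sub>n|\<^sup>2) / |\<tau> - z\<^sub>n|\<^sup>2\<close>. The real part of the Herglotz representation reads
  \<open>R\<^bsub>n+1\<^esub> = R\<^sub>n (1/\<alpha> + I\<^sub>n)\<close>, where \<open>I\<^sub>n\<close> is the integral of
  \<open>|\<tau> - z\<^sub>n|\<^sup>2 / |\<zeta> - z\<^sub>n|\<^sup>2\<close> with respect to \<open>\<sigma>\<close>. Hence \<open>R\<^sub>n \<alpha>\<^sup>n\<close> increases, and it stays bounded
  exactly if the sum of the \<open>I\<^sub>n\<close> is finite (\<open>excess_bounded_iff\<close>). The orbit approaches \<open>\<tau>\<close>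
  non-tangentially, because the steps have bounded hyperbolic length while \<open>R\<^sub>n\<close> grows geometrically
  (\<open>orbit_nontangential\<close>); therefore boundedness of \<open>R\<^sub>n \<alpha>\<^sup>n\<close> is the extremal rate, and in that
  case \<open>|\<tau> - z\<^sub>n|\<close> is comparable to \<open>\<alpha>\<^sup>n\<close>.

  Up to constants, the integrand of \<open>I\<^sub>n\<close> is then \<open>y\<^sub>n / (1 + y\<^sub>n)\<close> with
  \<open>y\<^sub>n = c\<^sup>2 \<alpha>\<^bsup>2n\<^esup> / |\<zeta> - \<tau>|\<^sup>2\<close>. With \<open>q = \<alpha>\<^sup>2\<close> the difference \<open>ln (1 + y) - ln (1 + q y)\<close> is
  comparable to \<open>y / (1 + y)\<close>, so the sum over \<open>n\<close> telescopes to a multiple of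
  \<open>ln (1 + c\<^sup>2 / |\<zeta> - \<tau>|\<^sup>2)\<close>, which is \<open>2 ln (1 / |\<zeta> - \<tau>|)\<close> up to a bounded error
  (\<open>log_geometric_sum_bounds\<close>). Integrating over \<open>\<sigma>\<close> turns finiteness of the sum of the \<open>I\<^sub>n\<close>
  into the logarithmic integrability condition.

  Another Riemann map changes \<open>G\<close> by conjugation with an automorphism of the disc. Such an
  automorphism is a rotated Moebius map, smooth across the circle, so the chain rule carries the
  multiplier over once \<open>G\<close> itself is known to have the angular limit \<open>\<tau>\<close> at \<open>\<tau>\<close>; this last point is
  Julia's inequality (\<open>julia_denjoy_wolff\<close>).
\<close>

section \<open>Pseudo-hyperbolic distance and the Schwarz-Pick lemma\<close>

text \<open>
  Normalised so that \<open>2 artanh\<close> of it is the hyperbolic distance of curvature \<open>-1\<close>.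
\<close>

definition pseudo_dist :: "complex \<Rightarrow> complex \<Rightarrow> real" where
  "pseudo_dist a b = cmod (a - b) / cmod (1 - cnj a * b)"

lemma pseudo_dist_eq_Moebius: "pseudo_dist a b = cmod (Moebius_function 0 a b)"
  by (simp add: pseudo_dist_def Moebius_function_simple norm_divide norm_minus_commute)

lemma one_minus_cnj_mult_neq_0:
  assumes "cmod a \<le> 1" "cmod b < 1"
  shows "1 - cnj a * b \<noteq> 0"
proof
  assume "1 - cnj a * b = 0"
  then have "cnj a * b = 1" by simp
  then have "cmod a * cmod b = 1" by (metis complex_mod_cnj norm_mult norm_one)
  moreover have "cmod a * cmod b \<le> 1 * cmod b" using assms by (intro mult_right_mono) auto
  ultimately show False using assms by simp
qed

lemma norm_one_minus_cnj_mult_identity: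
  "(cmod (1 - cnj a * b))\<^sup>2 - (cmod (a - b))\<^sup>2 = (1 - (cmod a)\<^sup>2) * (1 - (cmod b)\<^sup>2)"
  unfolding cmod_power2 by (simp add: algebra_simps power2_eq_square)

lemma pseudo_dist_commute: "pseudo_dist a b = pseudo_dist b a"
proof -
  have "cnj (1 - cnj a * b) = 1 - cnj b * a" by simp
  then have "cmod (1 - cnj a * b) = cmod (1 - cnj b * a)" by (metis complex_mod_cnj)
  then show ?thesis by (simp add: pseudo_dist_def norm_minus_commute)
qed

lemma one_minus_pseudo_dist_squared:
  assumes "cmod a < 1" "cmod b < 1"
  shows "1 - (pseudo_dist a b)\<^sup>2 =
         (1 - (cmod a)\<^sup>2) * (1 - (cmod b)\<^sup>2) / (cmod (1 - cnj a * b))\<^sup>2"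
proof -
  have "1 - cnj a * b \<noteq> 0" using one_minus_cnj_mult_neq_0[of a b] assms by simp
  then show ?thesis
    unfolding norm_one_minus_cnj_mult_identity[symmetric] pseudo_dist_def
    by (simp add: power_divide diff_divide_distrib)
qed

lemma pseudo_dist_less_1: "cmod a < 1 \<Longrightarrow> cmod b < 1 \<Longrightarrow> pseudo_dist a b < 1"
  unfolding pseudo_dist_eq_Moebius by (rule Moebius_function_norm_lt_1)

lemma pseudo_dist_nonneg [simp]: "0 \<le> pseudo_dist a b"
  by (simp add: pseudo_dist_def)

text \<open>
  Moving \<open>a\<close> and \<open>f a\<close> to the origin by Moebius maps turns this into the Schwarz lemma.
\<close>

proposition Schwarz_Pick:
  assumes f: "f holomorphic_on unit_disc" "f ` unit_disc \<subseteq> unit_disc"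
    and ab: "a \<in> unit_disc" "b \<in> unit_disc"
  shows "pseudo_dist (f a) (f b) \<le> pseudo_dist a b"
proof -
  define h where "h = Moebius_function 0 (f a) \<circ> f \<circ> Moebius_function 0 (- a)"
  have a: "cmod a < 1" and b: "cmod b < 1" and fa: "cmod (f a) < 1"
    using f ab by (auto simp: image_subset_iff)
  have maps: "Moebius_function 0 (- a) ` unit_disc \<subseteq> unit_disc"
    using Moebius_function_norm_lt_1[of "-a"] a by auto
  have "h holomorphic_on unit_disc"
    unfolding h_def
    apply (rule holomorphic_on_compose_gen[OF _ _ maps])
     apply (rule Moebius_function_holomorphic, use a in simp)
    apply (rule holomorphic_on_compose_gen[OF f(1) _ f(2)])
    apply (rule Moebius_function_holomorphic[OF fa])
    done
  moreover have "h 0 = 0"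
    by (simp add: h_def Moebius_function_of_zero Moebius_function_eq_zero)
  moreover have "cmod (h z) < 1" if "cmod z < 1" for z
    unfolding h_def o_def
    using f maps that fa by (intro Moebius_function_norm_lt_1) (auto simp: image_subset_iff)
  moreover have "cmod (Moebius_function 0 a b) < 1"
    using a b by (rule Moebius_function_norm_lt_1)
  ultimately have "cmod (h (Moebius_function 0 a b)) \<le> cmod (Moebius_function 0 a b)"
    by (rule Schwarz_Lemma(1))
  moreover have "h (Moebius_function 0 a b) = Moebius_function 0 (f a) (f b)"
    using Moebius_function_compose[of "-a" a b] a b by (simp add: h_def)
  ultimately show ?thesis by (simp add: pseudo_dist_eq_Moebius)
qed

text \<open>
  Applying Schwarz-Pick to the map and to its left inverse shows that the pseudo-hyperbolic distance
  is preserved; the derivative identity is the infinitesimal form, obtained by letting the second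
  point tend to the first.
\<close>

lemma disc_automorphism_derivative:
  assumes f: "f holomorphic_on unit_disc" "f ` unit_disc \<subseteq> unit_disc"
    and h: "h holomorphic_on unit_disc" "h ` unit_disc \<subseteq> unit_disc"
    and inv: "\<And>z. z \<in> unit_disc \<Longrightarrow> h (f z) = z"
    and a: "a \<in> unit_disc"
  shows "cmod (deriv f a) * (1 - (cmod a)\<^sup>2) = 1 - (cmod (f a))\<^sup>2"
proof -
  have fD: "f b \<in> unit_disc" if "b \<in> unit_disc" for b
    using f(2) that by (simp add: image_subset_iff)
  have iso: "pseudo_dist (f a) (f b) = pseudo_dist a b" if "b \<in> unit_disc" for b
    using Schwarz_Pick[OF f a that] Schwarz_Pick[OF h fD[OF a] fD[OF that]] inv that a
    by (simp add: antisym)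
  define N where "N b = cmod (1 - cnj (f a) * f b) / cmod (1 - cnj a * b)" for b
  have der: "((\<lambda>b. (f b - f a) / (b - a)) \<longlongrightarrow> deriv f a) (at a)"
    using holomorphic_derivI[OF f(1) _ a] by (simp add: has_field_derivative_iff)
  have "\<forall>\<^sub>F b in at a. cmod ((f b - f a) / (b - a)) = N b"
  proof -
    have "\<forall>\<^sub>F b in at a. b \<in> unit_disc" "\<forall>\<^sub>F b in at a. b \<noteq> a"
      using eventually_at_in_open'[of unit_disc a] a by (auto simp: eventually_at_filter)
    then show ?thesis
    proof eventually_elim
      case (elim b)
      have "cmod (1 - cnj (f a) * f b) \<noteq> 0" "cmod (1 - cnj a * b) \<noteq> 0"
        using one_minus_cnj_mult_neq_0 fD[OF a] fD[OF elim(1)] elim a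
        by (metis less_imp_le mem_ball_0 norm_eq_zero)+
      then show ?case
        using iso[OF elim(1)] elim(2)
        by (simp add: pseudo_dist_def N_def norm_divide norm_minus_commute field_simps)
    qed
  qed
  moreover have "isCont f a"
    using f a holomorphic_on_imp_continuous_on continuous_on_eq_continuous_at by blast
  then have "isCont N a"
    unfolding N_def using one_minus_cnj_mult_neq_0[of a a] a by (intro continuous_intros) auto
  then have "(N \<longlongrightarrow> N a) (at a)" by (simp add: isCont_def)
  ultimately have "((\<lambda>b. cmod ((f b - f a) / (b - a))) \<longlongrightarrow> N a) (at a)"
    by (simp add: filterlim_cong)
  with tendsto_norm[OF der] have eq: "cmod (deriv f a) = N a"
    using tendsto_unique[OF trivial_limit_at] by blast
  have sq: "cmod (1 - cnj z * z) = 1 - (cmod z)\<^sup>2" if "cmod z < 1" for z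
  proof -
    have "1 - cnj z * z = of_real (1 - (cmod z)\<^sup>2)"
      by (simp add: complex_norm_square mult.commute del: of_real_power)
    moreover have "(cmod z)\<^sup>2 \<le> 1" using that by (simp add: power_le_one)
    ultimately show ?thesis by (metis abs_of_nonneg diff_ge_0_iff_ge norm_of_real)
  qed
  have "(cmod a)\<^sup>2 < 1" using a by (simp add: abs_square_less_1)
  then show ?thesis
    using eq sq[of a] sq[of "f a"] a fD[OF a] by (simp add: N_def)
qed

section \<open>The Poincare density of a simply connected domain\<close>

lemma conformal_onto_discI:
  assumes "\<psi> holomorphic_on \<Omega>" "\<psi> ` \<Omega> \<subseteq> unit_disc"
    and "p holomorphic_on unit_disc" "p ` unit_disc \<subseteq> \<Omega>"
    and p\<psi>: "\<And>w. w \<in> \<Omega> \<Longrightarrow> p (\<psi> w) = w" and \<psi>p: "\<And>u. u \<in> unit_disc \<Longrightarrow> \<psi> (p u) = u"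
  shows "conformal_onto_disc \<psi> \<Omega>"
proof -
  have bij: "bij_betw \<psi> \<Omega> unit_disc"
    using assms by (intro bij_betw_byWitness[where f' = p]) auto
  have "inv_into \<Omega> \<psi> u = p u" if "u \<in> unit_disc" for u
    using assms that bij by (intro inv_into_f_eq) (auto simp: bij_betw_def)
  with assms(3) have "inv_into \<Omega> \<psi> holomorphic_on unit_disc"
    by (metis (no_types, lifting) holomorphic_transform)
  with bij assms(1) show ?thesis by (simp add: conformal_onto_disc_def)
qed

lemma conformal_onto_discD:
  assumes "conformal_onto_disc \<psi> \<Omega>"
  shows "\<psi> holomorphic_on \<Omega>" "inv_into \<Omega> \<psi> holomorphic_on unit_disc"
    and "\<And>w. w \<in> \<Omega> \<Longrightarrow> \<psi> w \<in> unit_disc" "\<And>u. u \<in> unit_disc \<Longrightarrow> inv_into \<Omega> \<psi> u \<in> \<Omega>"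
    and "\<And>w. w \<in> \<Omega> \<Longrightarrow> inv_into \<Omega> \<psi> (\<psi> w) = w"
    and "\<And>u. u \<in> unit_disc \<Longrightarrow> \<psi> (inv_into \<Omega> \<psi> u) = u"
proof -
  have b: "bij_betw \<psi> \<Omega> unit_disc" using assms by (simp add: conformal_onto_disc_def)
  show "\<And>w. w \<in> \<Omega> \<Longrightarrow> \<psi> w \<in> unit_disc" using b by (rule bij_betwE[THEN bspec])
  show "\<And>u. u \<in> unit_disc \<Longrightarrow> inv_into \<Omega> \<psi> u \<in> \<Omega>"
    using b by (metis bij_betw_imp_surj_on inv_into_into)
  show "\<And>w. w \<in> \<Omega> \<Longrightarrow> inv_into \<Omega> \<psi> (\<psi> w) = w"
    using b by (meson bij_betw_inv_into_left)
  show "\<And>u. u \<in> unit_disc \<Longrightarrow> \<psi> (inv_into \<Omega> \<psi> u) = u"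
    using b by (meson bij_betw_inv_into_right)
qed (use assms in \<open>auto simp: conformal_onto_disc_def\<close>)

lemma conformal_onto_disc_id: "conformal_onto_disc id unit_disc"
  by (rule conformal_onto_discI[where p = id]) (auto simp: holomorphic_on_id)

lemma conformal_onto_disc_Moebius:
  assumes \<psi>: "conformal_onto_disc \<psi> \<Omega>" and a: "a \<in> unit_disc"
  shows "conformal_onto_disc (Moebius_function 0 a \<circ> \<psi>) \<Omega>"
proof (rule conformal_onto_discI[where p = "inv_into \<Omega> \<psi> \<circ> Moebius_function 0 (-a)"])
  note D = conformal_onto_discD[OF \<psi>]
  have M: "Moebius_function 0 b u \<in> unit_disc" if "b \<in> unit_disc" "u \<in> unit_disc" for b u
    using Moebius_function_norm_lt_1 that by simp
  have H: "Moebius_function 0 b holomorphic_on unit_disc" if "b \<in> unit_disc" for b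
    using Moebius_function_holomorphic that by simp
  have a': "- a \<in> unit_disc" using a by simp
  show "Moebius_function 0 a \<circ> \<psi> holomorphic_on \<Omega>"
    by (rule holomorphic_on_compose_gen[OF D(1) H[OF a]]) (use D(3) in blast)
  show "(Moebius_function 0 a \<circ> \<psi>) ` \<Omega> \<subseteq> unit_disc"
    using M[OF a D(3)] by (simp add: image_subset_iff)
  show "inv_into \<Omega> \<psi> \<circ> Moebius_function 0 (-a) holomorphic_on unit_disc"
    by (rule holomorphic_on_compose_gen[OF H[OF a'] D(2)]) (use M[OF a'] in blast)
  show "(inv_into \<Omega> \<psi> \<circ> Moebius_function 0 (-a)) ` unit_disc \<subseteq> \<Omega>"
    using D(4)[OF M[OF a']] by (simp add: image_subset_iff)
  show "(inv_into \<Omega> \<psi> \<circ> Moebius_function 0 (-a)) ((Moebius_function 0 a \<circ> \<psi>) w) = w"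
    if "w \<in> \<Omega>" for w
    using Moebius_function_compose[of "-a" a "\<psi> w"] D(3)[OF that] D(5)[OF that] a by simp
  show "(Moebius_function 0 a \<circ> \<psi>) ((inv_into \<Omega> \<psi> \<circ> Moebius_function 0 (-a)) u) = u"
    if "u \<in> unit_disc" for u
    using Moebius_function_compose[of a "-a" u] D(6)[OF M[OF a' that]] a that by simp
qed

lemma conformal_onto_disc_deriv_inv:
  assumes \<psi>: "conformal_onto_disc \<psi> \<Omega>" and "open \<Omega>" and u: "u \<in> unit_disc"
  shows "deriv \<psi> (inv_into \<Omega> \<psi> u) * deriv (inv_into \<Omega> \<psi>) u = 1"
proof -
  note D = conformal_onto_discD[OF \<psi>]
  have "((\<psi> \<circ> inv_into \<Omega> \<psi>) has_field_derivative
          deriv \<psi> (inv_into \<Omega> \<psi> u) * deriv (inv_into \<Omega> \<psi>) u) (at u)"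
    by (intro DERIV_chain holomorphic_derivI[OF D(1)] holomorphic_derivI[OF D(2)])
       (use D u \<open>open \<Omega>\<close> in auto)
  then have "((\<lambda>u. u) has_field_derivative
          deriv \<psi> (inv_into \<Omega> \<psi> u) * deriv (inv_into \<Omega> \<psi>) u) (at u)"
    by (rule has_field_derivative_transform_within_open[where S = unit_disc]) (use D(6) u in auto)
  then show ?thesis using DERIV_unique DERIV_ident by metis
qed

text \<open>
  Simple connectivity lets the identity of \<open>\<Omega>\<close> be lifted through \<open>p\<close> to a section \<open>s\<close>; then \<open>s \<circ> p\<close>
  and the identity of the disc are two lifts of \<open>p\<close> that agree at \<open>0\<close>, so they coincide and \<open>p\<close> is
  injective.
\<close>

lemma holomorphic_covering_inverse:
  assumes cov: "covering_space unit_disc p \<Omega>" and holp: "p holomorphic_on unit_disc"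
    and \<Omega>: "open \<Omega>" "simply_connected \<Omega>"
  obtains q where "q holomorphic_on \<Omega>" "q ` \<Omega> \<subseteq> unit_disc"
    "\<And>z. z \<in> unit_disc \<Longrightarrow> q (p z) = z" "\<And>w. w \<in> \<Omega> \<Longrightarrow> p (q w) = w"
proof -
  have surj: "p ` unit_disc = \<Omega>" using covering_space_imp_surjective[OF cov] .
  have contp: "continuous_on unit_disc p" using holp holomorphic_on_imp_continuous_on by blast
  have 0: "p 0 \<in> \<Omega>" using surj by force
  obtain s where s: "continuous_on \<Omega> s" "s \<in> \<Omega> \<rightarrow> unit_disc" "s (p 0) = 0"
      "\<And>y. y \<in> \<Omega> \<Longrightarrow> p (s y) = id y"
  proof (rule covering_space_lift_strong[OF cov, of 0 "p 0" \<Omega> id])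
    show "locally path_connected \<Omega>" using \<Omega>(1) by (rule open_imp_locally_path_connected)
  qed (use 0 \<Omega>(2) in auto)
  have sp: "s (p z) = z" if "z \<in> unit_disc" for z
  proof -
    have "(s \<circ> p) z = id z"
    proof (rule covering_space_lift_unique[OF cov, of "s \<circ> p" 0 id unit_disc p])
      show "continuous_on unit_disc (s \<circ> p)"
        using contp s(1) surj continuous_on_compose by blast
    qed (use s surj contp that in \<open>auto intro: continuous_on_id\<close>)
    then show ?thesis by simp
  qed
  then have inj: "inj_on p unit_disc" by (metis inj_onI)
  obtain q where q: "q holomorphic_on (p ` unit_disc)" "\<And>z. z \<in> unit_disc \<Longrightarrow> q (p z) = z"
    by (rule holomorphic_has_inverse[OF holp open_ball inj]) blast
  show ?thesis
    by (rule that[of q]) (use q surj in auto)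
qed

text \<open>
  Every holomorphic covering \<open>p\<close> by the disc is biholomorphic here, so \<open>\<psi> \<circ> p\<close> is an automorphism of
  the disc. The derivative identity for automorphisms shows that all coverings define the same
  density, namely the one computed from the inverse of \<open>\<psi>\<close>.
\<close>

proposition poincare_density_simply_connected:
  assumes \<Omega>: "open \<Omega>" "simply_connected \<Omega>" and \<psi>: "conformal_onto_disc \<psi> \<Omega>" and w: "w \<in> \<Omega>"
  shows "poincare_density \<Omega> w = 2 * cmod (deriv \<psi> w) / (1 - (cmod (\<psi> w))\<^sup>2)"
  unfolding poincare_density_def
proof (rule the_equality)
  note D = conformal_onto_discD[OF \<psi>]
  let ?l = "2 * cmod (deriv \<psi> w) / (1 - (cmod (\<psi> w))\<^sup>2)"
  let ?p = "inv_into \<Omega> \<psi>"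
  have \<psi>w: "\<psi> w \<in> unit_disc" using D(3)[OF w] .
  have "homeomorphism unit_disc \<Omega> ?p \<psi>"
    unfolding homeomorphism_def
    using D holomorphic_on_imp_continuous_on by (auto simp: image_iff) (metis D(3,5) mem_ball_0)+
  then have "covering_space unit_disc ?p \<Omega>" by (rule homeomorphism_imp_covering_space)
  moreover have "cmod (deriv \<psi> w) * cmod (deriv ?p (\<psi> w)) = 1"
    using conformal_onto_disc_deriv_inv[OF \<psi> \<Omega>(1) \<psi>w] D(5)[OF w] by (metis norm_mult norm_one)
  ultimately show "\<exists>p z. p holomorphic_on unit_disc \<and> covering_space unit_disc p \<Omega> \<and>
        z \<in> unit_disc \<and> p z = w \<and> ?l * cmod (deriv p z) = 2 / (1 - (cmod z)\<^sup>2)"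
    using D w \<psi>w by (intro exI[of _ ?p] exI[of _ "\<psi> w"]) (auto simp: field_simps)
  fix l
  assume "\<exists>p z. p holomorphic_on unit_disc \<and> covering_space unit_disc p \<Omega> \<and>
        z \<in> unit_disc \<and> p z = w \<and> l * cmod (deriv p z) = 2 / (1 - (cmod z)\<^sup>2)"
  then obtain p z where p: "p holomorphic_on unit_disc" "covering_space unit_disc p \<Omega>"
    and z: "z \<in> unit_disc" "p z = w" and l: "l * cmod (deriv p z) = 2 / (1 - (cmod z)\<^sup>2)"
    by blast
  obtain q where q: "q holomorphic_on \<Omega>" "q ` \<Omega> \<subseteq> unit_disc"
    "\<And>z. z \<in> unit_disc \<Longrightarrow> q (p z) = z" "\<And>w. w \<in> \<Omega> \<Longrightarrow> p (q w) = w"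
    using holomorphic_covering_inverse[OF p(2,1) \<Omega>] by metis
  have p\<Omega>: "p u \<in> \<Omega>" if "u \<in> unit_disc" for u
    using covering_space_imp_surjective[OF p(2)] that by blast
  have "cmod (deriv (\<psi> \<circ> p) z) * (1 - (cmod z)\<^sup>2) = 1 - (cmod ((\<psi> \<circ> p) z))\<^sup>2"
  proof (rule disc_automorphism_derivative[of _ "q \<circ> inv_into \<Omega> \<psi>"])
    show "\<psi> \<circ> p holomorphic_on unit_disc"
      by (rule holomorphic_on_compose_gen[OF p(1) D(1)]) (use p\<Omega> in blast)
    show "q \<circ> ?p holomorphic_on unit_disc"
      by (rule holomorphic_on_compose_gen[OF D(2) q(1)]) (use D(4) in blast)
    show "(\<psi> \<circ> p) ` unit_disc \<subseteq> unit_disc" using D(3) p\<Omega> by force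
    show "(q \<circ> ?p) ` unit_disc \<subseteq> unit_disc" using D(4) q(2) by force
    show "\<And>u. u \<in> unit_disc \<Longrightarrow> (q \<circ> ?p) ((\<psi> \<circ> p) u) = u"
      using D(5) p\<Omega> q(3) by simp
  qed (rule z)
  moreover have "deriv (\<psi> \<circ> p) z = deriv \<psi> w * deriv p z"
    using holomorphic_derivI[OF D(1) \<Omega>(1) w] holomorphic_derivI[OF p(1) _ z(1)] z(2)
    by (metis DERIV_chain DERIV_imp_deriv open_ball)
  ultimately have *: "cmod (deriv \<psi> w) * cmod (deriv p z) * (1 - (cmod z)\<^sup>2) = 1 - (cmod (\<psi> w))\<^sup>2"
    using z by (simp add: norm_mult)
  have pos: "1 - (cmod z)\<^sup>2 > 0" "1 - (cmod (\<psi> w))\<^sup>2 > 0"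
    using z \<psi>w by (auto simp: abs_square_less_1)
  with * have nz: "cmod (deriv p z) \<noteq> 0" "cmod (deriv \<psi> w) \<noteq> 0" by auto
  have "?l = 2 / (1 - (cmod z)\<^sup>2) / cmod (deriv p z)"
    unfolding *[symmetric] using nz pos by simp
  then show "l = ?l"
    unfolding l[symmetric] using nz by simp
qed

section \<open>The Poincare distance of a simply connected domain\<close>

lemma tagged_division_interval:
  assumes "P tagged_division_of {0..1::real}" "(s, K) \<in> P"
  obtains a b where "K = {a..b}" "a \<le> s" "s \<le> b" "0 \<le> a" "b \<le> 1" "Inf K = a" "Sup K = b"
proof -
  obtain a b where K: "K = cbox a b" using tagged_division_ofD(4)[OF assms] by blast
  have "s \<in> K" "K \<subseteq> {0..1}" using tagged_division_ofD(2,3)[OF assms] by auto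
  then show ?thesis using K that[of a b] by (auto simp: cInf_atLeastAtMost cSup_atLeastAtMost)
qed

text \<open>
  The function \<open>2 artanh |\<psi>|\<close>, which is the hyperbolic distance to the zero of \<open>\<psi>\<close> if \<open>\<psi>\<close> is a
  Riemann map, may fail to be differentiable at that zero. A local Lipschitz bound whose constant
  exceeds the density by \<open>\<epsilon>\<close> holds everywhere, and it suffices for estimating lengths from below.
\<close>

lemma norm_hyperbolic_radius_locally_Lipschitz:
  fixes \<psi> :: "complex \<Rightarrow> complex"
  assumes \<psi>: "\<psi> holomorphic_on \<Omega>" "open \<Omega>" "w \<in> \<Omega>" "cmod (\<psi> w) < 1" and "\<epsilon> > 0"
  obtains \<eta> where "\<eta> > 0" "\<And>x y. x \<in> ball w \<eta> \<Longrightarrow> y \<in> ball w \<eta> \<Longrightarrow>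
     \<bar>2 * artanh (cmod (\<psi> x)) - 2 * artanh (cmod (\<psi> y))\<bar>
       \<le> (2 * cmod (deriv \<psi> w) / (1 - (cmod (\<psi> w))\<^sup>2) + \<epsilon>) * dist x y"
proof -
  define r d where "r = cmod (\<psi> w)" and "d = cmod (deriv \<psi> w)"
  have r: "0 \<le> r" "r < 1" using \<psi> by (auto simp: r_def)
  then have "r\<^sup>2 < 1" by (simp add: abs_square_less_1)
  \<comment> \<open>Near \<open>w\<close>, \<open>\<psi>\<close> has Lipschitz constant \<open>d + e\<close>, and on \<open>[0, r + e]\<close> the function \<open>2 artanh\<close> has Lipschitz
    constant \<open>2 / (1 - (r + e)\<^sup>2)\<close>; for small \<open>e\<close> the product exceeds the density by less than \<open>\<epsilon>\<close>.\<close>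
  then have "((\<lambda>e. 2 / (1 - (r + e)\<^sup>2) * (d + e)) \<longlongrightarrow> 2 / (1 - (r + 0)\<^sup>2) * (d + 0)) (at_right 0)"
    by (intro tendsto_intros) auto
  moreover have "2 / (1 - (r + 0)\<^sup>2) * (d + 0) < 2 * d / (1 - r\<^sup>2) + \<epsilon>" using \<open>\<epsilon> > 0\<close> by simp
  ultimately have "\<forall>\<^sub>F e in at_right 0. 2 / (1 - (r + e)\<^sup>2) * (d + e) < 2 * d / (1 - r\<^sup>2) + \<epsilon>"
    by (rule order_tendstoD)
  moreover have "\<forall>\<^sub>F e in at_right 0. e < 1 - r" "\<forall>\<^sub>F e in at_right (0::real). 0 < e"
    using r by (auto simp: eventually_at_right_field intro: exI[of _ "1-r"] exI[of _ 1])
  ultimately have "\<forall>\<^sub>F e in at_right 0. 2 / (1 - (r + e)\<^sup>2) * (d + e) < 2 * d / (1 - r\<^sup>2) + \<epsilon> \<and> e < 1 - r \<and> 0 < e"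
    by eventually_elim auto
  then obtain e where e: "2 / (1 - (r + e)\<^sup>2) * (d + e) < 2 * d / (1 - r\<^sup>2) + \<epsilon>" "e < 1 - r" "0 < e"
    using eventually_happens trivial_limit_at_right_real by blast
  have "isCont \<psi> w" "isCont (deriv \<psi>) w"
    using \<psi> holomorphic_on_imp_continuous_on holomorphic_deriv continuous_on_eq_continuous_at by blast+
  then have "\<forall>\<^sub>F x in nhds w. dist (\<psi> x) (\<psi> w) < e" "\<forall>\<^sub>F x in nhds w. dist (deriv \<psi> x) (deriv \<psi> w) < e"
    using e(3) by (auto simp: isCont_def tendsto_at_iff_tendsto_nhds tendstoD)
  moreover have "\<forall>\<^sub>F x in nhds w. x \<in> \<Omega>" using \<psi> eventually_nhds by blast
  ultimately have "\<forall>\<^sub>F x in nhds w. dist (\<psi> x) (\<psi> w) < e \<and> dist (deriv \<psi> x) (deriv \<psi> w) < e \<and> x \<in> \<Omega>"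
    by eventually_elim auto
  then obtain \<eta> where \<eta>: "\<eta> > 0" and
    near: "\<And>x. x \<in> ball w \<eta> \<Longrightarrow> dist (\<psi> x) (\<psi> w) < e \<and> dist (deriv \<psi> x) (deriv \<psi> w) < e \<and> x \<in> \<Omega>"
    unfolding eventually_nhds_metric by (metis dist_commute mem_ball)
  have small: "cmod (\<psi> x) \<le> r + e" and dsmall: "cmod (deriv \<psi> x) \<le> d + e" if "x \<in> ball w \<eta>" for x
  proof -
    have "cmod (\<psi> x - \<psi> w) < e" "cmod (deriv \<psi> x - deriv \<psi> w) < e"
      using near[OF that] by (auto simp: dist_norm)
    then show "cmod (\<psi> x) \<le> r + e" "cmod (deriv \<psi> x) \<le> d + e"
      using norm_triangle_sub[of "\<psi> x" "\<psi> w"] norm_triangle_sub[of "deriv \<psi> x" "deriv \<psi> w"]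
      by (auto simp: r_def d_def)
  qed
  have re: "r + e < 1" "0 \<le> r + e" using e r by auto
  then have sq: "(r + e)\<^sup>2 < 1" by (simp add: abs_square_less_1)
  have art: "\<bar>artanh s - artanh t\<bar> \<le> 1 / (1 - (r + e)\<^sup>2) * \<bar>s - t\<bar>" if "s \<in> {0..r+e}" "t \<in> {0..r+e}" for s t :: real
  proof -
    have "norm (artanh s - artanh t) \<le> 1 / (1 - (r + e)\<^sup>2) * norm (s - t)"
    proof (rule field_differentiable_bound[of "{0..r+e}" artanh "\<lambda>x. 1 / (1 - x\<^sup>2)"])
      fix x :: real assume x: "x \<in> {0..r+e}"
      then show "(artanh has_real_derivative 1 / (1 - x\<^sup>2)) (at x within {0..r+e})"
        using re by (intro artanh_real_has_field_derivative) auto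
      have "x\<^sup>2 \<le> (r+e)\<^sup>2" using x by (intro power_mono) auto
      then show "norm (1 / (1 - x\<^sup>2)) \<le> 1 / (1 - (r + e)\<^sup>2)"
        using sq by (simp add: frac_le)
    qed (use that in auto)
    then show ?thesis by simp
  qed
  show ?thesis
  proof (rule that[OF \<eta>])
    fix x y assume xy: "x \<in> ball w \<eta>" "y \<in> ball w \<eta>"
    have "cmod (\<psi> x - \<psi> y) \<le> (d + e) * cmod (x - y)"
    proof (rule field_differentiable_bound[of "ball w \<eta>" \<psi> "deriv \<psi>"])
      fix z assume "z \<in> ball w \<eta>"
      then show "(\<psi> has_field_derivative deriv \<psi> z) (at z within ball w \<eta>)" "cmod (deriv \<psi> z) \<le> d + e"
        using near[of z] dsmall[of z] holomorphic_derivI[OF \<psi>(1,2)] by auto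
    qed (use xy in auto)
    then have le: "\<bar>cmod (\<psi> x) - cmod (\<psi> y)\<bar> \<le> (d + e) * dist x y"
      using norm_triangle_ineq3[of "\<psi> x" "\<psi> y"] by (simp add: dist_norm)
    have "\<bar>2 * artanh (cmod (\<psi> x)) - 2 * artanh (cmod (\<psi> y))\<bar> = 2 * \<bar>artanh (cmod (\<psi> x)) - artanh (cmod (\<psi> y))\<bar>"
      unfolding right_diff_distrib[symmetric] abs_mult by simp
    also have "\<dots> \<le> 2 * (1 / (1 - (r + e)\<^sup>2) * \<bar>cmod (\<psi> x) - cmod (\<psi> y)\<bar>)"
      using art[of "cmod (\<psi> x)" "cmod (\<psi> y)"] small xy by simp
    also have "\<dots> \<le> 2 * (1 / (1 - (r + e)\<^sup>2) * ((d + e) * dist x y))"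
      using le sq by (intro mult_left_mono) auto
    also have "\<dots> = (2 / (1 - (r + e)\<^sup>2) * (d + e)) * dist x y" by simp
    also have "\<dots> \<le> (2 * d / (1 - r\<^sup>2) + \<epsilon>) * dist x y"
      using e by (intro mult_right_mono) auto
    finally show "\<bar>2 * artanh (cmod (\<psi> x)) - 2 * artanh (cmod (\<psi> y))\<bar>
       \<le> (2 * cmod (deriv \<psi> w) / (1 - (cmod (\<psi> w))\<^sup>2) + \<epsilon>) * dist x y"
      by (simp add: r_def d_def)
  qed
qed

text \<open>
  Rectifiability is phrased with divisions, arc-length integrals with tagged divisions. Forgetting the
  tags does not change the sum, because degenerate intervals contribute nothing to it.
\<close>

lemma rectifiable_tagged_bound:
  assumes "rectifiable \<gamma>"
  shows "\<exists>B. \<forall>P. P tagged_division_of {0..1} \<longrightarrow>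
     (\<Sum>(s, K)\<in>P. dist (\<gamma> (Inf K)) (\<gamma> (Sup K))) \<le> B"
proof -
  obtain B where B: "\<And>\<D>. \<D> division_of {0..1} \<Longrightarrow> (\<Sum>K\<in>\<D>. dist (\<gamma> (Inf K)) (\<gamma> (Sup K))) \<le> B"
    using assms unfolding rectifiable_def by blast
  show ?thesis
  proof (intro exI[of _ B] allI impI)
    fix P assume P: "P tagged_division_of {0..1::real}"
    let ?d = "\<lambda>K::real set. if K = {} then 0 else dist (\<gamma> (Inf K)) (\<gamma> (Sup K))"
    have ne: "K \<noteq> {}" if "(s, K) \<in> P" for s K
      using tagged_division_ofD(2)[OF P that] by blast
    then have ne': "K \<noteq> {}" if "K \<in> snd ` P" for K using that by force
    have "(\<Sum>(s, K)\<in>P. dist (\<gamma> (Inf K)) (\<gamma> (Sup K))) = (\<Sum>(s, K)\<in>P. ?d K)"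
    proof (intro sum.cong refl)
      fix x assume "x \<in> P"
      then show "(case x of (s, K) \<Rightarrow> dist (\<gamma> (Inf K)) (\<gamma> (Sup K))) = (case x of (s, K) \<Rightarrow> ?d K)"
        using ne[of "fst x" "snd x"] by (cases x) simp
    qed
    also have "\<dots> = (\<Sum>K\<in>snd ` P. ?d K)"
    proof (rule sum.over_tagged_division_lemma[OF P])
      fix u v :: real assume "box u v = {}"
      then have "v \<le> u" by simp
      then show "?d (cbox u v) = 0" by (cases "u = v") auto
    qed
    also have "\<dots> = (\<Sum>K\<in>snd ` P. dist (\<gamma> (Inf K)) (\<gamma> (Sup K)))"
      using ne' by (intro sum.cong refl) simp
    also have "\<dots> \<le> B" by (rule B[OF division_of_tagged_division[OF P]])
    finally show "(\<Sum>(s, K)\<in>P. dist (\<gamma> (Inf K)) (\<gamma> (Sup K))) \<le> B" .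
  qed
qed

text \<open>
  Around each point of the curve the local Lipschitz bound provides a gauge. On a tagged division
  fine for this gauge, the increments of \<open>2 artanh |\<psi>|\<close> telescope and each of them is bounded by the
  corresponding term of the arc-length sum, up to an error \<open>\<epsilon>\<close> times the chord length.
  Rectifiability keeps the total error small.
\<close>

lemma hyperbolic_length_lower_bound:
  assumes \<Omega>: "open \<Omega>" "simply_connected \<Omega>" and \<psi>: "conformal_onto_disc \<psi> \<Omega>"
    and \<gamma>: "rectifiable \<gamma>" "path_image \<gamma> \<subseteq> \<Omega>" and L: "has_arclength_integral (poincare_density \<Omega>) L \<gamma>"
  shows "2 * artanh (cmod (\<psi> (pathfinish \<gamma>))) - 2 * artanh (cmod (\<psi> (pathstart \<gamma>))) \<le> L"
proof -
  note D = conformal_onto_discD[OF \<psi>]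
  define H where "H t = 2 * artanh (cmod (\<psi> (\<gamma> t)))" for t
  define lam where "lam = poincare_density \<Omega>"
  from rectifiable_tagged_bound[OF \<gamma>(1)]
  obtain B where B: "\<forall>P. P tagged_division_of {0..1} \<longrightarrow>
     (\<Sum>(s, K)\<in>P. dist (\<gamma> (Inf K)) (\<gamma> (Sup K))) \<le> B"
    by (rule exE)
  have in\<Omega>: "\<gamma> t \<in> \<Omega>" if "t \<in> {0..1}" for t using \<gamma>(2) that by (auto simp: path_image_def)
  have cont: "continuous_on {0..1} \<gamma>" using \<gamma>(1) by (auto simp: rectifiable_def path_def)
  have main: "H 1 - H 0 \<le> L + \<epsilon> + \<epsilon> * B" if "\<epsilon> > 0" for \<epsilon>
  proof -
    have "\<exists>\<eta>>0. \<forall>x\<in>ball (\<gamma> t) \<eta>. \<forall>y\<in>ball (\<gamma> t) \<eta>.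
       \<bar>2 * artanh (cmod (\<psi> x)) - 2 * artanh (cmod (\<psi> y))\<bar> \<le> (lam (\<gamma> t) + \<epsilon>) * dist x y"
      if t: "t \<in> {0..1}" for t
    proof -
      have "cmod (\<psi> (\<gamma> t)) < 1" using D(3)[OF in\<Omega>[OF t]] by simp
      then show ?thesis
        unfolding lam_def poincare_density_simply_connected[OF \<Omega> \<psi> in\<Omega>[OF t]]
        by (rule norm_hyperbolic_radius_locally_Lipschitz[OF D(1) \<Omega>(1) in\<Omega>[OF t] _ \<open>\<epsilon> > 0\<close>])
           (intro exI conjI ballI, assumption+)
    qed
    then have "\<forall>t\<in>{0..1}. \<exists>\<eta>. \<eta> > 0 \<and> (\<forall>x\<in>ball (\<gamma> t) \<eta>. \<forall>y\<in>ball (\<gamma> t) \<eta>.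
       \<bar>2 * artanh (cmod (\<psi> x)) - 2 * artanh (cmod (\<psi> y))\<bar> \<le> (lam (\<gamma> t) + \<epsilon>) * dist x y)"
      by blast
    from bchoice[OF this] obtain \<eta> where \<eta>: "\<And>t. t \<in> {0..1} \<Longrightarrow> \<eta> t > 0"
      "\<And>t x y. \<lbrakk>t \<in> {0..1}; x\<in>ball (\<gamma> t) (\<eta> t); y\<in>ball (\<gamma> t) (\<eta> t)\<rbrakk> \<Longrightarrow>
       \<bar>2 * artanh (cmod (\<psi> x)) - 2 * artanh (cmod (\<psi> y))\<bar> \<le> (lam (\<gamma> t) + \<epsilon>) * dist x y"
      by blast
    have "\<exists>\<theta>>0. \<forall>s\<in>{0..1}. dist s t < \<theta> \<longrightarrow> \<gamma> s \<in> ball (\<gamma> t) (\<eta> t)" if t: "t \<in> {0..1}" for t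
    proof -
      obtain \<theta> where "\<theta> > 0" "\<forall>s\<in>{0..1}. dist s t < \<theta> \<longrightarrow> dist (\<gamma> s) (\<gamma> t) < \<eta> t"
        using cont t \<eta>(1)[OF t] unfolding continuous_on_iff by blast
      then show ?thesis by (auto simp: dist_commute)
    qed
    then have "\<forall>t\<in>{0..1}. \<exists>\<theta>. \<theta> > 0 \<and> (\<forall>s\<in>{0..1}. dist s t < \<theta> \<longrightarrow> \<gamma> s \<in> ball (\<gamma> t) (\<eta> t))"
      by blast
    from bchoice[OF this] obtain \<theta> where \<theta>: "\<And>t. t \<in> {0..1} \<Longrightarrow> \<theta> t > 0"
      "\<And>t s. \<lbrakk>t \<in> {0..1}; s \<in> {0..1}; dist s t < \<theta> t\<rbrakk> \<Longrightarrow> \<gamma> s \<in> ball (\<gamma> t) (\<eta> t)"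
      by blast
    from L[folded lam_def, unfolded has_arclength_integral_def, rule_format, OF \<open>\<epsilon> > 0\<close>]
    obtain \<delta> where \<delta>: "\<delta> > 0" "\<forall>P. P tagged_division_of {0..1} \<and> (\<lambda>s. ball s \<delta>) fine P \<longrightarrow>
        \<bar>(\<Sum>(s, K)\<in>P. lam (\<gamma> s) * dist (\<gamma> (Inf K)) (\<gamma> (Sup K))) - L\<bar> < \<epsilon>"
      by (elim exE conjE) (rule that)
    \<comment> \<open>Outside \<open>{0..1}\<close>, where \<open>\<theta>\<close> is meaningless, the radius only has to be positive.\<close>
    have "gauge (\<lambda>t. ball t (if t \<in> {0..1} then min \<delta> (\<theta> t) else \<delta>))"
      using \<delta>(1) \<theta>(1) by (intro gauge_ball_dependent) auto
    then obtain P where P: "P tagged_division_of {0..1}"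
      and fine: "(\<lambda>t. ball t (if t \<in> {0..1} then min \<delta> (\<theta> t) else \<delta>)) fine P"
      by (rule fine_division_exists_real)
    have fineK: "K \<subseteq> ball s (if s \<in> {0..1} then min \<delta> (\<theta> s) else \<delta>)" if "(s, K) \<in> P" for s K
      using fineD[OF fine that] .
    have fine\<delta>: "(\<lambda>s. ball s \<delta>) fine P"
    proof (rule fineI)
      fix s K assume "(s, K) \<in> P"
      then have "K \<subseteq> ball s (if s \<in> {0..1} then min \<delta> (\<theta> s) else \<delta>)" by (rule fineK)
      also have "\<dots> \<subseteq> ball s \<delta>" by (intro subset_ball) simp
      finally show "K \<subseteq> ball s \<delta>" .
    qed
    have "H 1 - H 0 = (\<Sum>(s, K)\<in>P. H (Sup K) - H (Inf K))"
      using additive_tagged_division_1[OF _ P, of H] by simp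
    also have "\<dots> \<le> (\<Sum>(s, K)\<in>P. (lam (\<gamma> s) + \<epsilon>) * dist (\<gamma> (Inf K)) (\<gamma> (Sup K)))"
    proof (rule sum_mono, clarify)
      fix s K assume sK: "(s, K) \<in> P"
      obtain a b where K: "K = {a..b}" "a \<le> s" "s \<le> b" "0 \<le> a" "b \<le> 1" "Inf K = a" "Sup K = b"
        using tagged_division_interval[OF P sK] .
      have s: "s \<in> {0..1}" using K by auto
      have "ball s (if s \<in> {0..1} then min \<delta> (\<theta> s) else \<delta>) \<subseteq> ball s (\<theta> s)"
        using s by (intro subset_ball) simp
      with fineK[OF sK] have "K \<subseteq> ball s (\<theta> s)" by blast
      moreover have "a \<in> K" "b \<in> K" using K by auto
      ultimately have "a \<in> ball s (\<theta> s)" "b \<in> ball s (\<theta> s)" by blast+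
      then have "dist a s < \<theta> s" "dist b s < \<theta> s" by (simp_all add: dist_commute)
      then have "\<gamma> a \<in> ball (\<gamma> s) (\<eta> s)" "\<gamma> b \<in> ball (\<gamma> s) (\<eta> s)" using \<theta>(2)[OF s] K by auto
      from \<eta>(2)[OF s this(2,1)]
      show "H (Sup K) - H (Inf K) \<le> (lam (\<gamma> s) + \<epsilon>) * dist (\<gamma> (Inf K)) (\<gamma> (Sup K))"
        using K by (simp add: H_def dist_commute)
    qed
    also have "\<dots> = (\<Sum>(s, K)\<in>P. lam (\<gamma> s) * dist (\<gamma> (Inf K)) (\<gamma> (Sup K)))
                  + \<epsilon> * (\<Sum>(s, K)\<in>P. dist (\<gamma> (Inf K)) (\<gamma> (Sup K)))"
      by (simp add: sum_distrib_left sum.distrib[symmetric] case_prod_unfold algebra_simps)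
    also have "\<dots> \<le> (L + \<epsilon>) + \<epsilon> * B"
      using \<delta>(2)[rule_format, OF conjI[OF P fine\<delta>]] B[rule_format, OF P] \<open>\<epsilon> > 0\<close> by (intro add_mono mult_left_mono) auto
    finally show ?thesis .
  qed
  have "((\<lambda>\<epsilon>. L + \<epsilon> + \<epsilon> * B) \<longlongrightarrow> L + 0 + 0 * B) (at_right 0)"
    by (intro tendsto_intros)
  moreover have "\<forall>\<^sub>F \<epsilon> in at_right 0. H 1 - H 0 \<le> L + \<epsilon> + \<epsilon> * B"
    using main by (auto simp: eventually_at_right_field intro: exI[of _ 1])
  ultimately have "H 1 - H 0 \<le> L + 0 + 0 * B"
    by (rule tendsto_lowerbound) auto
  then show ?thesis by (simp add: H_def pathstart_def pathfinish_def)
qed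

text \<open>
  Uniform continuity of the derivative makes the linearization error uniform in the tag \<open>s\<close>, which
  the fixed mesh \<open>\<delta>\<close> in the definition of the arc-length integral requires.
\<close>

lemma C1_curve_linearization:
  fixes f :: "real \<Rightarrow> 'a::real_normed_vector"
  assumes der: "\<And>t. t \<in> {0..1} \<Longrightarrow> (f has_vector_derivative f' t) (at t within {0..1})"
    and cont: "continuous_on {0..1} f'" and "\<epsilon> > 0"
  obtains \<delta> where "\<delta> > 0"
    "\<And>a b s. \<lbrakk>0 \<le> a; a \<le> s; s \<le> b; b \<le> 1; {a..b} \<subseteq> ball s \<delta>\<rbrakk>
       \<Longrightarrow> norm (f b - f a - (b - a) *\<^sub>R f' s) \<le> \<epsilon> * (b - a)"
proof -
  have "uniformly_continuous_on {0..1} f'"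
    using cont by (intro compact_uniformly_continuous) auto
  then obtain \<delta> where \<delta>: "\<delta> > 0" "\<And>s t. \<lbrakk>s \<in> {0..1}; t \<in> {0..1}; dist t s < \<delta>\<rbrakk> \<Longrightarrow> dist (f' t) (f' s) < \<epsilon>"
    using \<open>\<epsilon> > 0\<close> unfolding uniformly_continuous_on_def by metis
  show ?thesis
  proof (rule that[OF \<delta>(1)])
    fix a b s :: real assume *: "0 \<le> a" "a \<le> s" "s \<le> b" "b \<le> 1" "{a..b} \<subseteq> ball s \<delta>"
    have "norm (f b - f a - (b - a) *\<^sub>R f' s) \<le> norm (b - a) * \<epsilon>"
    proof (rule vector_differentiable_bound_linearization)
      fix x assume x: "x \<in> {a..b}"
      show "(f has_vector_derivative f' x) (at x within {a..b})"
        using der[of x] x * by (intro has_vector_derivative_within_subset[OF der]) auto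
      have "x \<in> ball s \<delta>" using x * by blast
      then have "dist (f' x) (f' s) < \<epsilon>" using \<delta>(2)[of s x] x * by (auto simp: dist_commute)
      then show "norm (f' x - f' s) \<le> \<epsilon>" by (simp add: dist_norm)
    qed (use * in \<open>auto simp: closed_segment_eq_real_ivl\<close>)
    then show "norm (f b - f a - (b - a) *\<^sub>R f' s) \<le> \<epsilon> * (b - a)" using * by (simp add: mult.commute)
  qed
qed

lemma C1_curve_rectifiable:
  assumes der: "\<And>t. t \<in> {0..1} \<Longrightarrow> (\<gamma> has_vector_derivative \<gamma>' t) (at t within {0..1})"
    and cont: "continuous_on {0..1} \<gamma>'"
  shows "rectifiable \<gamma>"
proof -
  have "path \<gamma>" unfolding path_def
    using der has_vector_derivative_continuous continuous_on_eq_continuous_within by blast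
  have "bounded (\<gamma>' ` {0..1})"
    using cont by (intro compact_imp_bounded compact_continuous_image) auto
  then obtain C where C: "\<And>t. t \<in> {0..1} \<Longrightarrow> norm (\<gamma>' t) \<le> C"
    unfolding bounded_iff by blast
  have Lip: "dist (\<gamma> a) (\<gamma> b) \<le> C * (b - a)" if "0 \<le> a" "a \<le> b" "b \<le> 1" for a b
  proof -
    have "norm (\<gamma> b - \<gamma> a) \<le> C * norm (b - a)"
    proof (rule differentiable_bound[of "{0..1}"])
      fix t :: real assume t: "t \<in> {0..1}"
      show "(\<gamma> has_derivative (\<lambda>h. h *\<^sub>R \<gamma>' t)) (at t within {0..1})"
        using der[OF t] by (simp add: has_vector_derivative_def)
      show "onorm (\<lambda>h. h *\<^sub>R \<gamma>' t) \<le> C"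
        using C[OF t] by (intro onorm_le) (simp add: mult.commute[of C] mult_left_mono)
    qed (use that in auto)
    then show ?thesis using that by (simp add: dist_norm norm_minus_commute)
  qed
  have "(\<Sum>K\<in>\<D>. dist (\<gamma> (Inf K)) (\<gamma> (Sup K))) \<le> C" if \<D>: "\<D> division_of {0..1}" for \<D>
  proof -
    have "(\<Sum>K\<in>\<D>. dist (\<gamma> (Inf K)) (\<gamma> (Sup K))) \<le> (\<Sum>K\<in>\<D>. C * measure lborel K)"
    proof (rule sum_mono)
      fix K assume K: "K \<in> \<D>"
      obtain a b where "K = cbox a b" using division_ofD(4)[OF \<D> K] by blast
      moreover have "K \<subseteq> {0..1}" "K \<noteq> {}" using division_ofD(2,3)[OF \<D> K] by auto
      ultimately show "dist (\<gamma> (Inf K)) (\<gamma> (Sup K)) \<le> C * measure lborel K"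
        using Lip[of a b] by auto
    qed
    also have "\<dots> = C * (\<Sum>K\<in>\<D>. measure lborel K)" by (simp add: sum_distrib_left)
    also have "(\<Sum>K\<in>\<D>. measure lborel K) = measure lborel (cbox (0::real) 1)"
      using \<D> by (intro additive_content_division) simp
    finally show ?thesis by simp
  qed
  with \<open>path \<gamma>\<close> show ?thesis unfolding rectifiable_def by blast
qed

text \<open>
  Both the chord \<open>\<gamma> b - \<gamma> a\<close> and the increment \<open>F b - F a\<close> are linear in \<open>b - a\<close> up to a uniform error
  \<open>e (b - a)\<close>, and the linear parts match. A primitive \<open>F\<close> in place of an integral makes the sums of
  increments telescope.
\<close>

lemma has_arclength_integral_C1:
  assumes der: "\<And>t. t \<in> {0..1} \<Longrightarrow> (\<gamma> has_vector_derivative \<gamma>' t) (at t within {0..1})"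
    and cont: "continuous_on {0..1} \<gamma>'"
    and u: "continuous_on {0..1} (\<lambda>t. u (\<gamma> t))" "\<And>t. t \<in> {0..1} \<Longrightarrow> 0 \<le> u (\<gamma> t)"
    and F: "\<And>t. t \<in> {0..1} \<Longrightarrow> (F has_real_derivative u (\<gamma> t) * norm (\<gamma>' t)) (at t within {0..1})"
  shows "has_arclength_integral u (F 1 - F 0) \<gamma>"
  unfolding has_arclength_integral_def
proof (intro allI impI)
  fix \<epsilon> :: real assume "\<epsilon> > 0"
  have "bounded ((\<lambda>t. u (\<gamma> t)) ` {0..1})"
    using u(1) by (intro compact_imp_bounded compact_continuous_image) auto
  then obtain C where C: "\<And>t. t \<in> {0..1} \<Longrightarrow> \<bar>u (\<gamma> t)\<bar> \<le> C"
    unfolding bounded_iff real_norm_def by blast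
  have "C \<ge> 0" using C[of 0] u(2)[of 0] by simp
  \<comment> \<open>The chords contribute the error \<open>C e\<close>, the increments of \<open>F\<close> the error \<open>e\<close>.\<close>
  define e where "e = \<epsilon> / (2 * (C + 1))"
  have "C + 1 > 0" using \<open>C \<ge> 0\<close> by simp
  then have "(C + 1) * e = \<epsilon> / 2" by (simp add: e_def divide_simps)
  with \<open>C + 1 > 0\<close> \<open>\<epsilon> > 0\<close> have e: "e > 0" "(C + 1) * e < \<epsilon>" by (auto simp: e_def)
  obtain \<delta>1 where \<delta>1: "\<delta>1 > 0" "\<And>a b s. \<lbrakk>0 \<le> a; a \<le> s; s \<le> b; b \<le> 1; {a..b} \<subseteq> ball s \<delta>1\<rbrakk>
       \<Longrightarrow> norm (\<gamma> b - \<gamma> a - (b - a) *\<^sub>R \<gamma>' s) \<le> e * (b - a)"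
    using C1_curve_linearization[OF der cont e(1)] by blast
  have F': "(F has_vector_derivative u (\<gamma> t) * norm (\<gamma>' t)) (at t within {0..1})" if "t \<in> {0..1}" for t
    using F[OF that] by (simp add: has_real_derivative_iff_has_vector_derivative)
  have contF': "continuous_on {0..1} (\<lambda>t. u (\<gamma> t) * norm (\<gamma>' t))"
    by (intro continuous_intros cont u(1))
  obtain \<delta>2 where \<delta>2: "\<delta>2 > 0" "\<And>a b s. \<lbrakk>0 \<le> a; a \<le> s; s \<le> b; b \<le> 1; {a..b} \<subseteq> ball s \<delta>2\<rbrakk>
       \<Longrightarrow> norm (F b - F a - (b - a) *\<^sub>R (u (\<gamma> s) * norm (\<gamma>' s))) \<le> e * (b - a)"
    using C1_curve_linearization[OF F' contF' e(1)] by blast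
  show "\<exists>\<delta>>0. \<forall>P. P tagged_division_of {0..1} \<and> (\<lambda>s. ball s \<delta>) fine P \<longrightarrow>
        \<bar>(\<Sum>(s, K)\<in>P. u (\<gamma> s) * dist (\<gamma> (Inf K)) (\<gamma> (Sup K))) - (F 1 - F 0)\<bar> < \<epsilon>"
  proof (intro exI conjI allI impI)
    show "min \<delta>1 \<delta>2 > 0" using \<delta>1 \<delta>2 by simp
    fix P :: "(real \<times> real set) set" assume "P tagged_division_of {0..1} \<and> (\<lambda>s. ball s (min \<delta>1 \<delta>2)) fine P"
    then have P: "P tagged_division_of {0..1}" and fine: "(\<lambda>s. ball s (min \<delta>1 \<delta>2)) fine P" by auto
    let ?D = "\<lambda>(s, K). u (\<gamma> s) * dist (\<gamma> (Inf K)) (\<gamma> (Sup K)) - (F (Sup K) - F (Inf K))"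
    have "\<bar>(\<Sum>(s, K)\<in>P. u (\<gamma> s) * dist (\<gamma> (Inf K)) (\<gamma> (Sup K))) - (F 1 - F 0)\<bar> = \<bar>\<Sum>x\<in>P. ?D x\<bar>"
    proof -
      have "(\<Sum>(s, K)\<in>P. F (Sup K) - F (Inf K)) = F 1 - F 0"
        using additive_tagged_division_1[OF _ P, of F] by simp
      moreover have "(\<Sum>x\<in>P. ?D x) = (\<Sum>(s, K)\<in>P. u (\<gamma> s) * dist (\<gamma> (Inf K)) (\<gamma> (Sup K)))
          - (\<Sum>(s, K)\<in>P. F (Sup K) - F (Inf K))"
        unfolding case_prod_unfold by (rule sum_subtractf)
      ultimately show ?thesis by simp
    qed
    also have "\<dots> \<le> (\<Sum>(s, K)\<in>P. (C + 1) * e * (Sup K - Inf K))"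
    proof (rule sum_abs[THEN order_trans], rule sum_mono)
      fix x assume "x \<in> P"
      moreover obtain s K where x: "x = (s, K)" by (cases x)
      ultimately have sK: "(s, K) \<in> P" by simp
      obtain a b where K: "K = {a..b}" "a \<le> s" "s \<le> b" "0 \<le> a" "b \<le> 1" "Inf K = a" "Sup K = b"
        using tagged_division_interval[OF P sK] .
      have "K \<subseteq> ball s \<delta>1" "K \<subseteq> ball s \<delta>2" using fineD[OF fine sK] by auto
      then have 1: "norm (\<gamma> b - \<gamma> a - (b - a) *\<^sub>R \<gamma>' s) \<le> e * (b - a)"
        and 2: "\<bar>F b - F a - (b - a) * (u (\<gamma> s) * norm (\<gamma>' s))\<bar> \<le> e * (b - a)"
        using \<delta>1(2)[of a s b] \<delta>2(2)[of a s b] K by auto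
      have s: "s \<in> {0..1}" using K by auto
      have "\<bar>norm (\<gamma> b - \<gamma> a) - (b - a) * norm (\<gamma>' s)\<bar> \<le> e * (b - a)"
        using norm_triangle_ineq3[of "\<gamma> b - \<gamma> a" "(b - a) *\<^sub>R \<gamma>' s"] 1 K by simp
      then have "u (\<gamma> s) * \<bar>norm (\<gamma> b - \<gamma> a) - (b - a) * norm (\<gamma>' s)\<bar> \<le> C * (e * (b - a))"
        using C[OF s] u(2)[OF s] by (intro mult_mono) auto
      then have 3: "\<bar>u (\<gamma> s) * norm (\<gamma> b - \<gamma> a) - u (\<gamma> s) * ((b - a) * norm (\<gamma>' s))\<bar> \<le> C * (e * (b - a))"
        using u(2)[OF s] by (simp add: abs_mult right_diff_distrib[symmetric])
      have "\<bar>u (\<gamma> s) * norm (\<gamma> b - \<gamma> a) - (F b - F a)\<bar> \<le> C * (e * (b - a)) + e * (b - a)"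
        using 2 3 by (simp add: mult.left_commute abs_le_iff)
      then show "\<bar>?D x\<bar> \<le> (case x of (s, K) \<Rightarrow> (C + 1) * e * (Sup K - Inf K))"
        using K x by (simp add: dist_norm norm_minus_commute algebra_simps)
    qed
    also have "\<dots> = (C + 1) * e * (\<Sum>(s, K)\<in>P. Sup K - Inf K)"
      by (simp add: sum_distrib_left case_prod_unfold)
    also have "(\<Sum>(s, K)\<in>P. Sup K - Inf K) = (1::real)"
      using additive_tagged_division_1[OF _ P, of "\<lambda>x. x"] by simp
    finally show "\<bar>(\<Sum>(s, K)\<in>P. u (\<gamma> s) * dist (\<gamma> (Inf K)) (\<gamma> (Sup K))) - (F 1 - F 0)\<bar> < \<epsilon>"
      using e by simp
  qed
qed

text \<open>
  The radius from \<open>0\<close> to \<open>\<psi> w\<close>, pulled back by \<open>\<psi>\<close>, attains the lower bound for lengths.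
\<close>

lemma poincare_dist_simply_connected_centre:
  assumes \<Omega>: "open \<Omega>" "simply_connected \<Omega>" and \<psi>: "conformal_onto_disc \<psi> \<Omega>"
    and zw: "z \<in> \<Omega>" "w \<in> \<Omega>" and centre: "\<psi> z = 0"
  shows "poincare_dist \<Omega> z w = 2 * artanh (cmod (\<psi> w))"
proof -
  note D = conformal_onto_discD[OF \<psi>]
  define p v where "p = inv_into \<Omega> \<psi>" and "v = \<psi> w"
  have v: "cmod v < 1" using D(3)[OF zw(2)] by (simp add: v_def)
  have tv: "cmod (of_real t * v) < 1" if "t \<in> {0..1}" for t
    using that v mult_left_le_one_le[of "cmod v" t] by (simp add: norm_mult)
  define \<gamma> where "\<gamma> t = p (of_real t * v)" for t
  define \<gamma>' where "\<gamma>' t = v * deriv p (of_real t * v)" for t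
  define F where "F t = 2 * artanh (t * cmod v)" for t
  have der: "(\<gamma> has_vector_derivative \<gamma>' t) (at t within {0..1})" if t: "t \<in> {0..1}" for t
  proof -
    have l: "((\<lambda>t. of_real t * v) has_vector_derivative v) (at t within {0..1})"
      by (auto intro!: derivative_eq_intros simp: scaleR_conv_of_real)
    have "(p has_field_derivative deriv p (of_real t * v)) (at (of_real t * v))"
      using holomorphic_derivI[OF D(2), of "of_real t * v"] tv[OF t] by (simp add: p_def)
    then have "(p has_field_derivative deriv p (of_real t * v)) (at (of_real t * v) within (\<lambda>t. of_real t * v) ` {0..1})"
      by (rule has_field_derivative_at_within)
    from field_vector_diff_chain_within[OF l this] show ?thesis
      by (simp add: \<gamma>_def[abs_def] \<gamma>'_def o_def)
  qed
  have "continuous_on unit_disc (deriv p)"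
    using D(2) holomorphic_deriv holomorphic_on_imp_continuous_on by (simp add: p_def)
  then have contp': "continuous_on {0..1} (\<lambda>t. deriv p (of_real t * v))"
    by (rule continuous_on_compose2) (use tv in \<open>auto intro!: continuous_intros\<close>)
  then have cont: "continuous_on {0..1} \<gamma>'"
    unfolding \<gamma>'_def[abs_def] by (intro continuous_intros)
  have dens: "poincare_density \<Omega> (\<gamma> t) * cmod (deriv p (of_real t * v)) = 2 / (1 - (t * cmod v)\<^sup>2)"
    and in\<Omega>: "\<gamma> t \<in> \<Omega>" and nz: "deriv p (of_real t * v) \<noteq> 0" and pos: "(t * cmod v)\<^sup>2 < 1"
    if t: "t \<in> {0..1}" for t
  proof -
    have u: "of_real t * v \<in> unit_disc" using tv[OF t] by simp
    show in\<Omega>: "\<gamma> t \<in> \<Omega>" using D(4)[OF u] by (simp add: \<gamma>_def p_def)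
    have eq: "cmod (deriv \<psi> (\<gamma> t)) * cmod (deriv p (of_real t * v)) = 1"
      using conformal_onto_disc_deriv_inv[OF \<psi> \<Omega>(1) u] unfolding \<gamma>_def p_def
      by (metis norm_mult norm_one)
    then show "deriv p (of_real t * v) \<noteq> 0" by auto
    show "(t * cmod v)\<^sup>2 < 1" using u t by (simp add: norm_mult abs_square_less_1)
    have "\<psi> (\<gamma> t) = of_real t * v" using D(6)[OF u] by (simp add: \<gamma>_def p_def)
    then have "cmod (\<psi> (\<gamma> t)) = t * cmod v" using t by (simp add: norm_mult)
    then show "poincare_density \<Omega> (\<gamma> t) * cmod (deriv p (of_real t * v)) = 2 / (1 - (t * cmod v)\<^sup>2)"
      unfolding poincare_density_simply_connected[OF \<Omega> \<psi> in\<Omega>] using eq by simp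
  qed
  have dens': "poincare_density \<Omega> (\<gamma> t) = 2 / (1 - (t * cmod v)\<^sup>2) / cmod (deriv p (of_real t * v))"
    if "t \<in> {0..1}" for t
    unfolding dens[OF that, symmetric] using nz[OF that] by simp
  have F: "(F has_real_derivative poincare_density \<Omega> (\<gamma> t) * norm (\<gamma>' t)) (at t within {0..1})"
    if t: "t \<in> {0..1}" for t
  proof -
    have "poincare_density \<Omega> (\<gamma> t) * norm (\<gamma>' t) = 2 / (1 - (t * cmod v)\<^sup>2) * cmod v"
      unfolding dens[OF t, symmetric] by (simp add: \<gamma>'_def norm_mult)
    moreover have "(F has_real_derivative 2 / (1 - (t * cmod v)\<^sup>2) * cmod v) (at t within {0..1})"
    proof -
      have "\<bar>t * cmod v\<bar> < 1" using tv[OF t] by (simp add: norm_mult abs_mult)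
      then have "((\<lambda>t. artanh (t * cmod v)) has_real_derivative 1 / (1 - (t * cmod v)\<^sup>2) * cmod v)
          (at t within {0..1})"
        by (intro DERIV_chain2[OF artanh_real_has_field_derivative]) (auto intro!: derivative_eq_intros)
      from DERIV_cmult[OF this, of 2] show ?thesis by (simp add: F_def[abs_def])
    qed
    ultimately show ?thesis by simp
  qed
  have contu: "continuous_on {0..1} (\<lambda>t. poincare_density \<Omega> (\<gamma> t))"
  proof -
    have "continuous_on {0..1} (\<lambda>t. 2 / (1 - (t * cmod v)\<^sup>2) / cmod (deriv p (of_real t * v)))"
      using nz pos contp' by (intro continuous_intros) force+
    then show ?thesis by (rule continuous_on_eq) (use dens' in simp)
  qed
  have nonneg: "0 \<le> poincare_density \<Omega> (\<gamma> t)" if "t \<in> {0..1}" for t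
    unfolding dens'[OF that] using pos[OF that] by simp
  have ends: "pathstart \<gamma> = z" "pathfinish \<gamma> = w"
    using D(5)[OF zw(1)] D(5)[OF zw(2)] centre
    by (auto simp: pathstart_def pathfinish_def \<gamma>_def p_def v_def)
  have L: "has_arclength_integral (poincare_density \<Omega>) (2 * artanh (cmod (\<psi> w))) \<gamma>"
    using has_arclength_integral_C1[OF der cont contu nonneg F] by (simp add: F_def v_def)
  show ?thesis
    unfolding poincare_dist_def
  proof (rule cInf_eq_minimum)
    show "2 * artanh (cmod (\<psi> w)) \<in> {L. \<exists>\<gamma>. rectifiable \<gamma> \<and> path_image \<gamma> \<subseteq> \<Omega> \<and> pathstart \<gamma> = z \<and>
            pathfinish \<gamma> = w \<and> has_arclength_integral (poincare_density \<Omega>) L \<gamma>}"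
      using C1_curve_rectifiable[OF der cont] in\<Omega> ends L
      by (intro CollectI exI[of _ \<gamma>]) (auto simp: path_image_def)
    fix L assume "L \<in> {L. \<exists>\<gamma>. rectifiable \<gamma> \<and> path_image \<gamma> \<subseteq> \<Omega> \<and> pathstart \<gamma> = z \<and>
            pathfinish \<gamma> = w \<and> has_arclength_integral (poincare_density \<Omega>) L \<gamma>}"
    then obtain \<beta> where "rectifiable \<beta>" "path_image \<beta> \<subseteq> \<Omega>" "pathstart \<beta> = z" "pathfinish \<beta> = w"
      "has_arclength_integral (poincare_density \<Omega>) L \<beta>" by blast
    then show "2 * artanh (cmod (\<psi> w)) \<le> L"
      using hyperbolic_length_lower_bound[OF \<Omega> \<psi>, of \<beta> L] centre by simp
  qed
qed

proposition poincare_dist_simply_connected: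
  assumes \<Omega>: "open \<Omega>" "simply_connected \<Omega>" and \<psi>: "conformal_onto_disc \<psi> \<Omega>"
    and zw: "z \<in> \<Omega>" "w \<in> \<Omega>"
  shows "poincare_dist \<Omega> z w = 2 * artanh (pseudo_dist (\<psi> z) (\<psi> w))"
  using poincare_dist_simply_connected_centre[OF \<Omega> conformal_onto_disc_Moebius[OF \<psi>] zw]
    conformal_onto_discD(3)[OF \<psi> zw(1)]
  by (simp add: pseudo_dist_eq_Moebius Moebius_function_eq_zero)

section \<open>Orbits and the Herglotz measure\<close>

definition poisson_kernel :: "complex \<Rightarrow> complex \<Rightarrow> real" where
  "poisson_kernel \<zeta> z = (1 - (cmod z)\<^sup>2) / (cmod (\<zeta> - z))\<^sup>2"

lemma Re_herglotz_kernel: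
  assumes "cmod \<zeta> = 1"
  shows "Re ((\<zeta> + z) / (\<zeta> - z)) = poisson_kernel \<zeta> z"
proof -
  have "Re ((\<zeta> + z) / (\<zeta> - z)) = Re ((\<zeta> + z) * cnj (\<zeta> - z)) / (cmod (\<zeta> - z))\<^sup>2"
    by (metis complex_div_cnj Re_divide_of_real of_real_power)
  also have "Re ((\<zeta> + z) * cnj (\<zeta> - z)) = (cmod \<zeta>)\<^sup>2 - (cmod z)\<^sup>2"
    unfolding cmod_power2 by (simp add: algebra_simps power2_eq_square)
  finally show ?thesis using assms by (simp add: poisson_kernel_def)
qed

lemma cayley_eq_herglotz_kernel:
  assumes "cmod \<tau> = 1"
  shows "(1 + cnj \<tau> * z) / (1 - cnj \<tau> * z) = (\<tau> + z) / (\<tau> - z)"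
proof -
  have "\<tau> * cnj \<tau> = 1" using complex_norm_square[of \<tau>] assms by simp
  then have "\<tau> + z = \<tau> * (1 + cnj \<tau> * z)" "\<tau> - z = \<tau> * (1 - cnj \<tau> * z)"
    by (simp_all add: distrib_left right_diff_distrib flip: mult.assoc)
  then show ?thesis using assms by auto
qed

lemma one_minus_norm_le_dist_circle:
  assumes "cmod \<zeta> = 1" shows "1 - cmod z \<le> cmod (\<zeta> - z)"
  using norm_triangle_ineq2[of \<zeta> z] assms by simp

text \<open>
  Both bounds are \<open>ln x \<le> x - 1\<close>, applied to \<open>x = (1 + q y) / (1 + y)\<close> and to its reciprocal.
\<close>

lemma log_difference_bounds:
  fixes q y :: real
  assumes "0 < q" "q < 1" "0 \<le> y"
  shows "(1 - q) * (y / (1 + y)) \<le> ln (1 + y) - ln (1 + q * y)"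
    and "ln (1 + y) - ln (1 + q * y) \<le> (1 - q) / q * (y / (1 + y))"
proof -
  have pos: "1 + y > 0" "1 + q * y > 0" using assms by (auto intro: add_pos_nonneg)
  have "ln ((1 + q * y) / (1 + y)) \<le> (1 + q * y) / (1 + y) - 1"
    using pos by (intro ln_le_minus_one) auto
  also have "\<dots> = - ((1 - q) * (y / (1 + y)))" using pos by (simp add: field_simps)
  finally show "(1 - q) * (y / (1 + y)) \<le> ln (1 + y) - ln (1 + q * y)"
    using pos by (simp add: ln_div)
  have "ln ((1 + y) / (1 + q * y)) \<le> (1 + y) / (1 + q * y) - 1"
    using pos by (intro ln_le_minus_one) auto
  also have "\<dots> = (1 - q) * (y / (1 + q * y))" using pos by (simp add: field_simps)
  also have "y / (1 + q * y) \<le> y / (q * (1 + y))"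
    using assms by (intro divide_left_mono mult_pos_pos) (auto simp: algebra_simps add_pos_nonneg)
  then have "(1 - q) * (y / (1 + q * y)) \<le> (1 - q) * (y / (q * (1 + y)))"
    using assms by (intro mult_left_mono) auto
  finally show "ln (1 + y) - ln (1 + q * y) \<le> (1 - q) / q * (y / (1 + y))"
    using pos by (simp add: ln_div)
qed

text \<open>
  By the preceding bounds \<open>ln (1 + y)\<close> acts as a discrete primitive along the geometric sequence
  \<open>y = q\<^sup>n Y\<close>. In effect, the terms are of order \<open>1\<close> for about \<open>ln Y / ln (1/q)\<close> indices and decay
  geometrically afterwards.
\<close>

lemma log_geometric_sum_bounds:
  fixes q Y :: real
  assumes "0 < q" "q < 1" "0 \<le> Y"
  shows "(1 - q) * (\<Sum>n<N. q ^ n * Y / (1 + q ^ n * Y)) \<le> ln (1 + Y)"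
    and "ln (1 + Y) - ln (1 + q ^ N * Y) \<le> (1 - q) / q * (\<Sum>n<N. q ^ n * Y / (1 + q ^ n * Y))"
proof -
  have nonneg: "0 \<le> q ^ n * Y" for n using assms by simp
  have tele: "(\<Sum>n<N. ln (1 + q ^ n * Y) - ln (1 + q * (q ^ n * Y))) = ln (1 + Y) - ln (1 + q ^ N * Y)"
    using sum_lessThan_telescope'[of "\<lambda>n. ln (1 + q ^ n * Y)" N] by (simp add: mult.assoc)
  have "(1 - q) * (\<Sum>n<N. q ^ n * Y / (1 + q ^ n * Y)) \<le> ln (1 + Y) - ln (1 + q ^ N * Y)"
    unfolding tele[symmetric] sum_distrib_left
    by (intro sum_mono log_difference_bounds assms nonneg)
  moreover have "0 \<le> ln (1 + q ^ N * Y)" using nonneg[of N] by (intro ln_ge_zero) simp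
  ultimately show "(1 - q) * (\<Sum>n<N. q ^ n * Y / (1 + q ^ n * Y)) \<le> ln (1 + Y)" by simp
  show "ln (1 + Y) - ln (1 + q ^ N * Y) \<le> (1 - q) / q * (\<Sum>n<N. q ^ n * Y / (1 + q ^ n * Y))"
    unfolding tele[symmetric] sum_distrib_left
    by (intro sum_mono log_difference_bounds assms nonneg)
qed

text \<open>
  For sequences the finitely many terms that \<open>O\<close> disregards cannot spoil boundedness.
\<close>

lemma bigo_one_iff_bounded:
  fixes f :: "nat \<Rightarrow> real"
  shows "f \<in> O(\<lambda>_. 1) \<longleftrightarrow> (\<exists>C. \<forall>n. \<bar>f n\<bar> \<le> C)"
proof
  assume "f \<in> O(\<lambda>_. 1)"
  then obtain c where "\<forall>\<^sub>F n in sequentially. \<bar>f n\<bar> \<le> c" by (auto elim!: landau_o.bigE)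
  then have "Bseq f" by (intro BfunI[of _ c]) simp
  then show "\<exists>C. \<forall>n. \<bar>f n\<bar> \<le> C" by (auto simp: Bseq_def)
next
  assume "\<exists>C. \<forall>n. \<bar>f n\<bar> \<le> C"
  then obtain C where "\<And>n. \<bar>f n\<bar> \<le> C" by blast
  then show "f \<in> O(\<lambda>_. 1)" by (intro landau_o.bigI[of "max C 1"]) (auto intro!: always_eventually simp: le_max_iff_disj)
qed

locale herglotz_map =
  fixes G :: "complex \<Rightarrow> complex" and \<tau> :: complex and \<alpha> :: real and \<sigma> :: "complex measure"
  assumes hol: "G holomorphic_on unit_disc" and maps: "G ` unit_disc \<subseteq> unit_disc"
    and norm_\<tau>: "cmod \<tau> = 1" and \<alpha>: "0 < \<alpha>" "\<alpha> < 1"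
    and herglotz: "herglotz_measure G \<tau> \<alpha> \<sigma>"
begin

sublocale finite_measure \<sigma>
  using herglotz by (simp add: herglotz_measure_def)

lemma sets_\<sigma>: "sets \<sigma> = sets (restrict_space borel (sphere 0 1 - {\<tau>}))"
  using herglotz by (simp add: herglotz_measure_def)

lemma space_\<sigma>: "space \<sigma> = sphere 0 1 - {\<tau>}"
  using sets_eq_imp_space_eq[OF sets_\<sigma>] by (simp add: space_restrict_space)

lemma measurable_\<sigma>:
  fixes f :: "complex \<Rightarrow> 'b::topological_space"
  assumes "continuous_on (sphere 0 1 - {\<tau>}) f"
  shows "f \<in> borel_measurable \<sigma>"
  using borel_measurable_continuous_on_restrict[OF assms] measurable_cong_sets[OF sets_\<sigma> refl] by blast

text \<open>
  The Poisson kernel at \<open>\<zeta>\<close> divided by the Poisson kernel at \<open>\<tau>\<close>, as functions of \<open>z\<close>.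
\<close>

definition ratio :: "complex \<Rightarrow> complex \<Rightarrow> real" where
  "ratio z \<zeta> = (cmod (\<tau> - z))\<^sup>2 / (cmod (\<zeta> - z))\<^sup>2"

lemma
  assumes z: "z \<in> unit_disc"
  shows integrable_herglotz_kernel: "integrable \<sigma> (\<lambda>\<zeta>. (\<zeta> + z) / (\<zeta> - z))"
    and integrable_ratio: "integrable \<sigma> (ratio z)"
proof -
  have ne: "\<zeta> \<noteq> z" and far: "1 - cmod z \<le> cmod (\<zeta> - z)" and z1: "1 - cmod z > 0"
    and one: "cmod \<zeta> = 1" if "\<zeta> \<in> sphere 0 1 - {\<tau>}" for \<zeta>
    using that z one_minus_norm_le_dist_circle[of \<zeta> z] by auto
  show "integrable \<sigma> (\<lambda>\<zeta>. (\<zeta> + z) / (\<zeta> - z))"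
  proof (rule integrable_const_bound)
    show "AE \<zeta> in \<sigma>. norm ((\<zeta> + z) / (\<zeta> - z)) \<le> 2 / (1 - cmod z)"
    proof (rule AE_I2, unfold space_\<sigma>)
      fix \<zeta> assume \<zeta>: "\<zeta> \<in> sphere 0 1 - {\<tau>}"
      have "cmod (\<zeta> + z) \<le> 2" using norm_triangle_ineq[of \<zeta> z] one[OF \<zeta>] z by simp
      then show "norm ((\<zeta> + z) / (\<zeta> - z)) \<le> 2 / (1 - cmod z)"
        unfolding norm_divide using far[OF \<zeta>] z1[OF \<zeta>] by (intro frac_le) auto
    qed
    show "(\<lambda>\<zeta>. (\<zeta> + z) / (\<zeta> - z)) \<in> borel_measurable \<sigma>"
      using ne by (intro measurable_\<sigma> continuous_intros) auto
  qed
  show "integrable \<sigma> (ratio z)"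
  proof (rule integrable_const_bound)
    show "AE \<zeta> in \<sigma>. norm (ratio z \<zeta>) \<le> (cmod (\<tau> - z))\<^sup>2 / (1 - cmod z)\<^sup>2"
    proof (rule AE_I2, unfold space_\<sigma>)
      fix \<zeta> assume \<zeta>: "\<zeta> \<in> sphere 0 1 - {\<tau>}"
      show "norm (ratio z \<zeta>) \<le> (cmod (\<tau> - z))\<^sup>2 / (1 - cmod z)\<^sup>2"
        unfolding ratio_def using far[OF \<zeta>] z1[OF \<zeta>]
        by (simp add: frac_le power_mono)
    qed
    show "ratio z \<in> borel_measurable \<sigma>"
      unfolding ratio_def[abs_def] using ne by (intro measurable_\<sigma> continuous_intros) auto
  qed
qed

lemma ratio_nonneg: "0 \<le> ratio z \<zeta>"
  by (simp add: ratio_def)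

lemma \<tau>_neq: "z \<in> unit_disc \<Longrightarrow> \<tau> \<noteq> z"
  using norm_\<tau> by auto

text \<open>
  This is the real part of the Herglotz representation, where the imaginary constant disappears.
\<close>

lemma poisson_kernel_step:
  assumes z: "z \<in> unit_disc"
  shows "poisson_kernel \<tau> (G z) = poisson_kernel \<tau> z * (1 / \<alpha> + (\<integral>\<zeta>. ratio z \<zeta> \<partial>\<sigma>))"
proof -
  obtain b where "(1 + cnj \<tau> * G z) / (1 - cnj \<tau> * G z) =
          of_real (1 / \<alpha>) * ((1 + cnj \<tau> * z) / (1 - cnj \<tau> * z)) + \<i> * of_real b +
          (\<integral>\<zeta>. (\<zeta> + z) / (\<zeta> - z) \<partial>\<sigma>)"
    using herglotz z unfolding herglotz_measure_def by blast
  then have "(\<tau> + G z) / (\<tau> - G z) = of_real (1 / \<alpha>) * ((\<tau> + z) / (\<tau> - z)) + \<i> * of_real b +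
          (\<integral>\<zeta>. (\<zeta> + z) / (\<zeta> - z) \<partial>\<sigma>)"
    by (simp only: cayley_eq_herglotz_kernel[OF norm_\<tau>])
  moreover have "Re (of_real (1 / \<alpha>) * c + \<i> * of_real b + d) = 1 / \<alpha> * Re c + Re d" for c d
    by simp
  ultimately have "Re ((\<tau> + G z) / (\<tau> - G z)) =
      1 / \<alpha> * Re ((\<tau> + z) / (\<tau> - z)) + Re (\<integral>\<zeta>. (\<zeta> + z) / (\<zeta> - z) \<partial>\<sigma>)"
    by presburger
  then have "poisson_kernel \<tau> (G z) = 1 / \<alpha> * poisson_kernel \<tau> z + Re (\<integral>\<zeta>. (\<zeta> + z) / (\<zeta> - z) \<partial>\<sigma>)"
    by (simp only: Re_herglotz_kernel[OF norm_\<tau>])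
  also have "Re (\<integral>\<zeta>. (\<zeta> + z) / (\<zeta> - z) \<partial>\<sigma>) = (\<integral>\<zeta>. Re ((\<zeta> + z) / (\<zeta> - z)) \<partial>\<sigma>)"
    using integrable_herglotz_kernel[OF z] by simp
  also have "\<dots> = (\<integral>\<zeta>. poisson_kernel \<tau> z * ratio z \<zeta> \<partial>\<sigma>)"
  proof (rule Bochner_Integration.integral_cong[OF refl])
    fix \<zeta> assume "\<zeta> \<in> space \<sigma>"
    then have "cmod \<zeta> = 1" by (simp add: space_\<sigma>)
    then show "Re ((\<zeta> + z) / (\<zeta> - z)) = poisson_kernel \<tau> z * ratio z \<zeta>"
      using \<tau>_neq[OF z] by (simp only: Re_herglotz_kernel) (simp add: poisson_kernel_def ratio_def)
  qed
  also have "\<dots> = poisson_kernel \<tau> z * (\<integral>\<zeta>. ratio z \<zeta> \<partial>\<sigma>)" by simp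
  finally show ?thesis by (simp add: distrib_left)
qed

definition orb :: "nat \<Rightarrow> complex" where "orb n = (G ^^ n) 0"

text \<open>
  The relative contribution of the Herglotz measure to the growth of the Poisson kernel in step \<open>n\<close>.
\<close>

definition gain :: "nat \<Rightarrow> real" where "gain n = (\<integral>\<zeta>. ratio (orb n) \<zeta> \<partial>\<sigma>)"

text \<open>
  The growth of the Poisson kernel at \<open>\<tau>\<close> along the orbit, beyond the growth \<open>\<alpha>\<^bsup>-n\<^esup>\<close> that every
  hyperbolic map has.
\<close>

definition excess :: "nat \<Rightarrow> real" where "excess n = poisson_kernel \<tau> (orb n) * \<alpha> ^ n"

lemma orb_Suc: "orb (Suc n) = G (orb n)" by (simp add: orb_def)

lemma orb_in_disc: "orb n \<in> unit_disc"
proof (induction n)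
  case 0 then show ?case by (simp add: orb_def)
next
  case (Suc n) then show ?case unfolding orb_Suc using maps by blast
qed

lemma gain_nonneg: "0 \<le> gain n"
  unfolding gain_def by (intro Bochner_Integration.integral_nonneg ratio_nonneg)

lemma excess_Suc: "excess (Suc n) = excess n * (1 + \<alpha> * gain n)"
proof -
  have "excess (Suc n) = \<alpha> ^ n * (\<alpha> * poisson_kernel \<tau> (G (orb n)))"
    by (simp add: excess_def orb_Suc)
  also have "\<alpha> * poisson_kernel \<tau> (G (orb n)) = poisson_kernel \<tau> (orb n) * (1 + \<alpha> * gain n)"
    unfolding poisson_kernel_step[OF orb_in_disc] gain_def using \<alpha> by (simp add: field_simps)
  finally show ?thesis by (simp add: excess_def)
qed

lemma excess_ge_1: "1 \<le> excess n"
proof (induction n)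
  case 0 show ?case by (simp add: excess_def orb_def poisson_kernel_def norm_\<tau>)
next
  case (Suc n)
  have "1 * 1 \<le> excess n * (1 + \<alpha> * gain n)"
    using Suc \<alpha> gain_nonneg[of n] by (intro mult_mono) auto
  then show ?case by (simp add: excess_Suc)
qed

text \<open>
  The recursion makes the excess the product of the factors \<open>1 + \<alpha> gain\<close>, and a product of factors
  \<open>1 + a\<^sub>n\<close> with \<open>a\<^sub>n \<ge> 0\<close> lies between \<open>1 + \<Sum> a\<^sub>n\<close> and \<open>exp (\<Sum> a\<^sub>n)\<close>.
\<close>

lemma excess_bounded_iff: "(\<exists>B. \<forall>n. excess n \<le> B) \<longleftrightarrow> (\<exists>K. \<forall>N. (\<Sum>n<N. gain n) \<le> K)"
proof
  assume "\<exists>B. \<forall>n. excess n \<le> B"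
  then obtain B where B: "\<And>n. excess n \<le> B" by blast
  have "\<alpha> * (\<Sum>n<N. gain n) \<le> excess N" for N
  proof (induction N)
    case 0 then show ?case using excess_ge_1[of 0] by simp
  next
    case (Suc N)
    have "\<alpha> * gain N * 1 \<le> \<alpha> * gain N * excess N"
      using excess_ge_1[of N] \<alpha> gain_nonneg[of N] by (intro mult_left_mono) auto
    with Suc show ?case by (simp add: excess_Suc algebra_simps)
  qed
  then have "\<alpha> * (\<Sum>n<N. gain n) \<le> B" for N using B order_trans by blast
  then have "(\<Sum>n<N. gain n) \<le> B / \<alpha>" for N using \<alpha> by (simp add: pos_le_divide_eq mult.commute)
  then show "\<exists>K. \<forall>N. (\<Sum>n<N. gain n) \<le> K" by blast
next
  assume "\<exists>K. \<forall>N. (\<Sum>n<N. gain n) \<le> K"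
  then obtain K where K: "\<And>N. (\<Sum>n<N. gain n) \<le> K" by blast
  have "excess N \<le> exp (\<alpha> * (\<Sum>n<N. gain n))" for N
  proof (induction N)
    case 0 show ?case by (simp add: excess_def orb_def poisson_kernel_def norm_\<tau>)
  next
    case (Suc N)
    have "excess N * (1 + \<alpha> * gain N) \<le> exp (\<alpha> * (\<Sum>n<N. gain n)) * exp (\<alpha> * gain N)"
      using Suc \<alpha> gain_nonneg[of N] by (intro mult_mono exp_ge_add_one_self) auto
    then show ?case by (simp add: excess_Suc exp_add[symmetric] distrib_left)
  qed
  also have "exp (\<alpha> * (\<Sum>n<N. gain n)) \<le> exp (\<alpha> * K)" for N using K \<alpha> by simp
  finally show "\<exists>B. \<forall>n. excess n \<le> B" by blast
qed

text \<open>
  In the half-plane coordinate \<open>w\<close> the claim is \<open>|w\<^sub>n| \<le> M R\<^sub>n\<close>. By Schwarz-Pick the hyperbolic length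
  of the steps does not increase, so \<open>|w\<^bsub>n+1\<^esub> - w\<^sub>n| \<le> k R\<^sub>n\<close>. Since \<open>R\<^sub>n\<close> grows at least by the factor
  \<open>1/\<alpha>\<close>, these increments sum up to at most a multiple of the last \<open>R\<^sub>n\<close>.
\<close>

lemma orbit_nontangential: "\<exists>M\<ge>1. \<forall>n. cmod (\<tau> - orb n) \<le> M * (1 - cmod (orb n))"
proof -
  define w where "w n = (\<tau> + orb n) / (\<tau> - orb n)" for n
  define R where "R n = Re (w n)" for n
  define q where "q = pseudo_dist (orb 0) (orb 1)"
  have R: "R n = poisson_kernel \<tau> (orb n)" for n
    unfolding R_def w_def by (rule Re_herglotz_kernel[OF norm_\<tau>])
  have nz: "\<tau> - orb n \<noteq> 0" for n using \<tau>_neq[OF orb_in_disc] by simp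
  have R_Suc: "R (Suc n) \<ge> 1 / \<alpha> * R n" and R1: "R n \<ge> 1" for n
  proof -
    have "R n = excess n * (1 / \<alpha> ^ n)" using \<alpha> by (simp add: R excess_def)
    moreover have "1 / \<alpha> ^ n \<ge> 1" using \<alpha> by (simp add: power_le_one)
    ultimately show 1: "R n \<ge> 1"
      using mult_mono[of 1 "excess n" 1 "1 / \<alpha> ^ n"] excess_ge_1[of n] by simp
    have "R n * (1 / \<alpha> + 0) \<le> R n * (1 / \<alpha> + gain n)"
      using 1 gain_nonneg[of n] by (intro mult_left_mono) auto
    then show "R (Suc n) \<ge> 1 / \<alpha> * R n"
      using poisson_kernel_step[OF orb_in_disc[of n]] by (simp add: R orb_Suc gain_def)
  qed
  have q: "0 \<le> q" "q < 1"
    using pseudo_dist_less_1 orb_in_disc by (auto simp: q_def)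
  have contract: "pseudo_dist (orb n) (orb (Suc n)) \<le> q" for n
  proof (induction n)
    case 0 then show ?case by (simp add: q_def)
  next
    case (Suc n)
    then show ?case
      using Schwarz_Pick[OF hol maps orb_in_disc[of n] orb_in_disc[of "Suc n"]]
      by (simp add: orb_Suc)
  qed
  \<comment> \<open>The map \<open>w\<close> turns the pseudo-hyperbolic distance into \<open>|w' - w| / |w' + cnj w|\<close>, and \<open>|w' + cnj w|\<close> is at
    most \<open>|w' - w| + 2 R\<close>.\<close>
  have step: "cmod (w (Suc n) - w n) \<le> 2 * q / (1 - q) * R n" for n
  proof -
    let ?z = "orb n" and ?z' = "orb (Suc n)"
    have \<tau>\<tau>: "\<tau> * cnj \<tau> = 1" using complex_norm_square[of \<tau>] norm_\<tau> by simp
    have nz': "cnj \<tau> - cnj ?z \<noteq> 0" using nz[of n] by (metis complex_cnj_diff complex_cnj_zero_iff)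
    have "w (Suc n) - w n = 2 * \<tau> * (?z' - ?z) / ((\<tau> - ?z') * (\<tau> - ?z))"
      unfolding w_def using nz[of n] nz[of "Suc n"] by (simp add: divide_simps) (simp add: algebra_simps)
    then have 1: "cmod (w (Suc n) - w n) = 2 * cmod (?z' - ?z) / (cmod (\<tau> - ?z') * cmod (\<tau> - ?z))"
      by (simp add: norm_divide norm_mult norm_\<tau>)
    have "w (Suc n) + cnj (w n) = ((\<tau> + ?z') * (cnj \<tau> - cnj ?z) + (cnj \<tau> + cnj ?z) * (\<tau> - ?z')) /
            ((\<tau> - ?z') * (cnj \<tau> - cnj ?z))"
      unfolding w_def complex_cnj_divide complex_cnj_add complex_cnj_diff
      using nz' nz[of "Suc n"] by (rule add_frac_eq[OF _ _, rotated])
    also have "(\<tau> + ?z') * (cnj \<tau> - cnj ?z) + (cnj \<tau> + cnj ?z) * (\<tau> - ?z') = 2 * (\<tau> * cnj \<tau> - cnj ?z * ?z')"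
      by (simp add: algebra_simps)
    also have "\<dots> = 2 * (1 - cnj ?z * ?z')" by (simp add: \<tau>\<tau>)
    finally have 2: "cmod (w (Suc n) + cnj (w n)) = 2 * cmod (1 - cnj ?z * ?z') / (cmod (\<tau> - ?z') * cmod (\<tau> - ?z))"
      by (simp add: norm_divide norm_mult flip: complex_cnj_diff del: right_diff_distrib_numeral)
    have nzc: "1 - cnj ?z * ?z' \<noteq> 0"
      using one_minus_cnj_mult_neq_0[of ?z ?z'] orb_in_disc[of n] orb_in_disc[of "Suc n"] by simp
    have "cmod (w (Suc n) - w n) = pseudo_dist ?z ?z' * cmod (w (Suc n) + cnj (w n))"
      unfolding 1 2 pseudo_dist_def using nzc by (simp add: norm_minus_commute)
    also have "\<dots> \<le> q * cmod (w (Suc n) + cnj (w n))"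
      using contract by (intro mult_right_mono) auto
    also have "\<dots> \<le> q * (cmod (w (Suc n) - w n) + 2 * R n)"
    proof (rule mult_left_mono[OF _ q(1)])
      have "w (Suc n) + cnj (w n) = (w (Suc n) - w n) + of_real (2 * R n)"
        by (simp add: R_def complex_eq_iff)
      then have "cmod (w (Suc n) + cnj (w n)) \<le> cmod (w (Suc n) - w n) + cmod (of_real (2 * R n))"
        by (metis norm_triangle_ineq)
      then show "cmod (w (Suc n) + cnj (w n)) \<le> cmod (w (Suc n) - w n) + 2 * R n"
        using R1[of n] by (simp del: of_real_mult)
    qed
    finally show ?thesis using q by (simp add: field_simps)
  qed
  define k where "k = 2 * q / (1 - q)"
  \<comment> \<open>The induction step needs \<open>M + k \<le> M / \<alpha>\<close>, and the start \<open>w 0 = 1\<close> needs \<open>M \<ge> 1\<close>.\<close>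
  define M where "M = max 1 (k / (1 / \<alpha> - 1))"
  have "1 / \<alpha> - 1 > 0" using \<alpha> by simp
  then have M: "M \<ge> 1" "k \<le> (1 / \<alpha> - 1) * M"
    by (auto simp: M_def pos_divide_le_eq[symmetric] mult.commute[of _ "max _ _"])
  have wR: "cmod (w n) \<le> M * R n" for n
  proof (induction n)
    case 0
    have "w 0 = 1" using norm_\<tau> by (auto simp: w_def orb_def)
    then show ?case using M R1[of 0] by (simp add: R_def)
  next
    case (Suc n)
    have "cmod (w (Suc n)) \<le> cmod (w n) + cmod (w (Suc n) - w n)"
      by (metis add.commute diff_add_cancel norm_triangle_ineq)
    also have "\<dots> \<le> M * R n + k * R n" using Suc step[of n] by (simp add: k_def)
    also have "\<dots> \<le> M * R n + ((1 / \<alpha> - 1) * M) * R n"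
      using M R1[of n] by (intro add_left_mono mult_right_mono) auto
    also have "\<dots> = M * (1 / \<alpha> * R n)" by (simp add: algebra_simps)
    also have "\<dots> \<le> M * R (Suc n)" using R_Suc M by (intro mult_left_mono) auto
    finally show ?case .
  qed
  have "cmod (\<tau> - orb n) \<le> (M + 1) * (1 - cmod (orb n))" for n
  proof -
    let ?d = "cmod (\<tau> - orb n)" and ?r = "cmod (orb n)"
    have d: "?d > 0" using nz[of n] by simp
    have r: "?r < 1" using orb_in_disc[of n] by simp
    have "w n + 1 = 2 * \<tau> / (\<tau> - orb n)" unfolding w_def using nz[of n] by (simp add: field_simps)
    then have "2 / ?d = cmod (w n + 1)" by (simp add: norm_divide norm_mult norm_\<tau>)
    also have "\<dots> \<le> M * R n + 1 * R n"
      using wR[of n] R1[of n] norm_triangle_ineq[of "w n" 1] by simp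
    also have "\<dots> = (M + 1) * ((1 - ?r\<^sup>2) / ?d\<^sup>2)" unfolding R poisson_kernel_def by (rule distrib_right[symmetric])
    finally have "2 * ?d \<le> (M + 1) * (1 - ?r\<^sup>2)"
      using d by (simp add: field_simps power2_eq_square)
    also have "1 - ?r\<^sup>2 = (1 - ?r) * (1 + ?r)" by (simp add: power2_eq_square algebra_simps)
    also have "(M + 1) * ((1 - ?r) * (1 + ?r)) \<le> (M + 1) * ((1 - ?r) * 2)"
      using r M by (intro mult_left_mono) auto
    also have "\<dots> = 2 * ((M + 1) * (1 - ?r))" by (simp only: mult_ac)
    finally show ?thesis by linarith
  qed
  then show ?thesis using M by (intro exI[of _ "M + 1"]) auto
qed

lemma poisson_kernel_le: "poisson_kernel \<tau> (orb n) \<le> 2 / cmod (\<tau> - orb n)"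
proof -
  let ?r = "cmod (orb n)" and ?d = "cmod (\<tau> - orb n)"
  have r: "?r < 1" using orb_in_disc[of n] by simp
  have d: "?d > 0" using \<tau>_neq[OF orb_in_disc[of n]] by simp
  have "1 - ?r\<^sup>2 = (1 - ?r) * (1 + ?r)" by (simp add: power2_eq_square algebra_simps)
  also have "\<dots> \<le> ?d * 2"
    using r one_minus_norm_le_dist_circle[OF norm_\<tau>, of "orb n"] by (intro mult_mono) auto
  finally have "(1 - ?r\<^sup>2) / ?d\<^sup>2 \<le> ?d * 2 / ?d\<^sup>2" by (rule divide_right_mono) simp
  also have "\<dots> = 2 / ?d" using d by (simp add: power2_eq_square)
  finally show ?thesis by (simp add: poisson_kernel_def)
qed

lemma dist_orbit_le: "cmod (\<tau> - orb n) \<le> 2 * \<alpha> ^ n"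
proof -
  have d: "cmod (\<tau> - orb n) > 0" using \<tau>_neq[OF orb_in_disc[of n]] by simp
  have "1 \<le> poisson_kernel \<tau> (orb n) * \<alpha> ^ n" using excess_ge_1[of n] by (simp add: excess_def)
  also have "\<dots> \<le> 2 / cmod (\<tau> - orb n) * \<alpha> ^ n"
    using poisson_kernel_le \<alpha> by (intro mult_right_mono) auto
  finally show ?thesis using d by (simp add: field_simps)
qed

text \<open>
  Non-tangentially, \<open>1 - |z|\<close> and \<open>|\<tau> - z|\<close> are comparable, so the Poisson kernel is comparable to
  \<open>1 / |\<tau> - z|\<close>, and an upper bound for the kernel bounds the distance from below.
\<close>

lemma dist_orbit_ge:
  assumes B: "excess n \<le> B" and M: "cmod (\<tau> - orb n) \<le> M * (1 - cmod (orb n))" "M \<ge> 1"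
  shows "\<alpha> ^ n \<le> M * B * cmod (\<tau> - orb n)"
proof -
  let ?r = "cmod (orb n)" and ?d = "cmod (\<tau> - orb n)" and ?R = "poisson_kernel \<tau> (orb n)"
  have r: "?r < 1" using orb_in_disc[of n] by simp
  have d: "?d > 0" using \<tau>_neq[OF orb_in_disc[of n]] by simp
  have "?r\<^sup>2 \<le> ?r" using r by (simp add: power2_eq_square mult_left_le_one_le)
  then have "M * (1 - ?r) \<le> M * (1 - ?r\<^sup>2)" using M by (intro mult_left_mono) auto
  also have "1 - ?r\<^sup>2 = ?R * ?d * ?d" using d by (simp add: poisson_kernel_def power2_eq_square)
  finally have "1 * ?d \<le> (M * ?R * ?d) * ?d" using M(1) by (simp add: mult.assoc)
  then have "1 \<le> M * ?R * ?d" using d mult_le_cancel_right_pos by blast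
  then have "\<alpha> ^ n * 1 \<le> \<alpha> ^ n * (M * ?R * ?d)" using \<alpha> by (intro mult_left_mono) auto
  also have "\<dots> = M * excess n * ?d" by (simp add: excess_def)
  also have "\<dots> \<le> M * B * ?d" using B M d by (intro mult_right_mono mult_left_mono) auto
  finally show ?thesis by simp
qed

text \<open>
  With \<open>a\<^sub>n = 1 - |z\<^sub>n|\<^sup>2\<close> the rate condition says that \<open>\<alpha>\<^sup>n / a\<^sub>n\<close> stays between positive constants.
  The lower bound always holds. An upper bound amounts to a bound on the excess, since
  non-tangentially \<open>a\<^sub>n\<close> is comparable to \<open>|\<tau> - z\<^sub>n|\<close> and the Poisson kernel to its reciprocal.
\<close>

lemma excess_bounded_iff_rate:
  "(\<exists>B. \<forall>n. excess n \<le> B) \<longleftrightarrow>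
   (\<lambda>n. - ln (1 - (cmod (orb n))\<^sup>2) - real n * ln (1 / \<alpha>)) \<in> O(\<lambda>_. 1)"
proof -
  define a where "a n = 1 - (cmod (orb n))\<^sup>2" for n
  have r: "cmod (orb n) < 1" for n using orb_in_disc[of n] by simp
  have a: "a n > 0" for n using r[of n] by (simp add: a_def abs_square_less_1)
  have d: "cmod (\<tau> - orb n) > 0" for n using \<tau>_neq[OF orb_in_disc[of n]] by simp
  have E: "- ln (1 - (cmod (orb n))\<^sup>2) - real n * ln (1 / \<alpha>) = ln (\<alpha> ^ n / a n)" for n
    using a[of n] \<alpha> unfolding a_def[symmetric] by (simp add: ln_div ln_realpow)
  have q: "\<alpha> ^ n / a n > 0" for n using a[of n] \<alpha> by simp
  have a_le: "a n \<le> 2 * cmod (\<tau> - orb n)" for n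
  proof -
    have "a n = (1 - cmod (orb n)) * (1 + cmod (orb n))"
      by (simp add: a_def power2_eq_square algebra_simps)
    also have "\<dots> \<le> cmod (\<tau> - orb n) * 2"
      using r[of n] one_minus_norm_le_dist_circle[OF norm_\<tau>, of "orb n"] by (intro mult_mono) auto
    finally show ?thesis by simp
  qed
  show ?thesis unfolding E bigo_one_iff_bounded
  proof
    assume "\<exists>B. \<forall>n. excess n \<le> B"
    then obtain B where B: "\<And>n. excess n \<le> B" by blast
    obtain M where M: "M \<ge> 1" "\<And>n. cmod (\<tau> - orb n) \<le> M * (1 - cmod (orb n))"
      using orbit_nontangential by blast
    have MB: "M * B > 0" using M B[of 0] excess_ge_1[of 0] by (intro mult_pos_pos) auto
    have "\<bar>ln (\<alpha> ^ n / a n)\<bar> \<le> ln 4 + \<bar>ln (M * B * M)\<bar>" for n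
    proof -
      have "a n \<le> 4 * \<alpha> ^ n" using a_le[of n] dist_orbit_le[of n] by simp
      then have "1 / 4 \<le> \<alpha> ^ n / a n" using a[of n] by (simp add: field_simps)
      then have "ln (1 / 4) \<le> ln (\<alpha> ^ n / a n)" using q[of n] by (subst ln_le_cancel_iff) auto
      then have 1: "- ln 4 \<le> ln (\<alpha> ^ n / a n)" by (simp add: ln_div)
      have "(cmod (orb n))\<^sup>2 \<le> cmod (orb n)"
        using r[of n] by (simp add: power2_eq_square mult_left_le_one_le)
      then have "M * (1 - cmod (orb n)) \<le> M * a n"
        unfolding a_def using M(1) by (intro mult_left_mono) auto
      then have "cmod (\<tau> - orb n) \<le> M * a n" using M(2)[of n] by simp
      then have "M * B * cmod (\<tau> - orb n) \<le> M * B * (M * a n)"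
        using MB by (intro mult_left_mono) auto
      with dist_orbit_ge[OF B M(2,1), of n] have "\<alpha> ^ n \<le> M * B * M * a n"
        by (metis mult.assoc order_trans)
      then have "\<alpha> ^ n / a n \<le> M * B * M" using a[of n] by (simp add: pos_divide_le_eq)
      then have "ln (\<alpha> ^ n / a n) \<le> ln (M * B * M)"
        using q[of n] MB M(1) by (subst ln_le_cancel_iff) auto
      moreover have "0 \<le> ln (4::real)" by simp
      ultimately show ?thesis using 1 by linarith
    qed
    then show "\<exists>C. \<forall>n. \<bar>ln (\<alpha> ^ n / a n)\<bar> \<le> C" by blast
  next
    assume "\<exists>C. \<forall>n. \<bar>ln (\<alpha> ^ n / a n)\<bar> \<le> C"
    then obtain C where C: "\<And>n. \<bar>ln (\<alpha> ^ n / a n)\<bar> \<le> C" by blast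
    have "excess n \<le> 4 * exp C" for n
    proof -
      have "ln (\<alpha> ^ n / a n) \<le> C" using C[of n] by simp
      then have "\<alpha> ^ n / a n \<le> exp C" using q[of n] by (metis exp_le_cancel_iff exp_ln)
      then have 1: "\<alpha> ^ n \<le> exp C * a n" using a[of n] by (simp add: pos_divide_le_eq)
      have "excess n \<le> 2 / cmod (\<tau> - orb n) * (exp C * a n)"
        unfolding excess_def using poisson_kernel_le 1 \<alpha> by (intro mult_mono) auto
      also have "\<dots> \<le> 2 / cmod (\<tau> - orb n) * (exp C * (2 * cmod (\<tau> - orb n)))"
        using a_le by (intro mult_left_mono) auto
      also have "\<dots> = 4 * exp C" using d[of n] by simp
      finally show ?thesis .
    qed
    then show "\<exists>B. \<forall>n. excess n \<le> B" by blast
  qed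
qed

text \<open>
  Non-tangential approach makes \<open>|\<zeta> - z\<^sub>n|\<close> at least a fixed multiple of both \<open>|\<zeta> - \<tau>|\<close> and
  \<open>|\<tau> - z\<^sub>n|\<close>. The resulting bound increases with \<open>|\<tau> - z\<^sub>n|\<close>, which may thus be replaced by its upper
  bound \<open>2 \<alpha>\<^sup>n\<close>.
\<close>

lemma ratio_upper:
  assumes M: "M \<ge> 1" "cmod (\<tau> - orb n) \<le> M * (1 - cmod (orb n))" and \<zeta>: "\<zeta> \<in> sphere 0 1 - {\<tau>}"
    and y: "y = (\<alpha>\<^sup>2) ^ n * (4 / (cmod (\<zeta> - \<tau>))\<^sup>2)"
  shows "ratio (orb n) \<zeta> \<le> ((1 + M)\<^sup>2 + M\<^sup>2) * (y / (1 + y))"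
proof -
  let ?T = "cmod (\<zeta> - \<tau>)" and ?d = "cmod (\<tau> - orb n)" and ?e = "cmod (\<zeta> - orb n)"
  let ?C = "(1 + M)\<^sup>2 + M\<^sup>2" and ?s = "2 * \<alpha> ^ n"
  have T: "?T > 0" using \<zeta> by simp
  have d: "?d > 0" using \<tau>_neq[OF orb_in_disc[of n]] by simp
  have far: "1 - cmod (orb n) \<le> ?e" "1 - cmod (orb n) > 0"
    using one_minus_norm_le_dist_circle[of \<zeta> "orb n"] \<zeta> orb_in_disc[of n] by auto
  have e: "?e > 0" "?d \<le> M * ?e"
    using far M mult_left_mono[OF far(1), of M] by linarith+
  have "?T \<le> ?e + ?d"
    using norm_triangle_ineq[of "\<zeta> - orb n" "orb n - \<tau>"] by (simp add: norm_minus_commute)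
  also have "\<dots> \<le> (1 + M) * ?e" using e by (simp add: distrib_right)
  finally have "?T\<^sup>2 \<le> ((1 + M) * ?e)\<^sup>2" using T by (intro power_mono) auto
  moreover have "?d\<^sup>2 \<le> (M * ?e)\<^sup>2" using e by (intro power_mono) auto
  ultimately have "?T\<^sup>2 + ?d\<^sup>2 \<le> ((1 + M) * ?e)\<^sup>2 + (M * ?e)\<^sup>2" by (rule add_mono)
  also have "\<dots> = ?C * ?e\<^sup>2" unfolding power_mult_distrib by (rule distrib_right[symmetric])
  finally have sum: "?T\<^sup>2 + ?d\<^sup>2 \<le> ?C * ?e\<^sup>2" .
  have pos: "?T\<^sup>2 + ?d\<^sup>2 > 0" "?e\<^sup>2 > 0" "?T\<^sup>2 + ?s\<^sup>2 > 0" using T e by (auto intro: add_pos_nonneg)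
  have "?d\<^sup>2 * (?T\<^sup>2 + ?d\<^sup>2) \<le> ?d\<^sup>2 * (?C * ?e\<^sup>2)" using sum by (intro mult_left_mono) auto
  then have "ratio (orb n) \<zeta> \<le> ?C * (?d\<^sup>2 / (?T\<^sup>2 + ?d\<^sup>2))"
    unfolding ratio_def using pos by (simp add: field_simps)
  also have "?d\<^sup>2 / (?T\<^sup>2 + ?d\<^sup>2) \<le> ?s\<^sup>2 / (?T\<^sup>2 + ?s\<^sup>2)"
  proof -
    have "?d\<^sup>2 \<le> ?s\<^sup>2" using dist_orbit_le by (intro power_mono) auto
    then have "?T\<^sup>2 * ?d\<^sup>2 \<le> ?T\<^sup>2 * ?s\<^sup>2" by (intro mult_left_mono) auto
    then have "?d\<^sup>2 * (?T\<^sup>2 + ?s\<^sup>2) \<le> ?s\<^sup>2 * (?T\<^sup>2 + ?d\<^sup>2)" by (simp add: algebra_simps)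
    then show ?thesis using pos by (simp add: divide_le_eq pos_le_divide_eq del: power_mult_distrib)
  qed
  then have "?C * (?d\<^sup>2 / (?T\<^sup>2 + ?d\<^sup>2)) \<le> ?C * (?s\<^sup>2 / (?T\<^sup>2 + ?s\<^sup>2))"
    by (intro mult_left_mono) auto
  also have "?s\<^sup>2 / (?T\<^sup>2 + ?s\<^sup>2) = y / (1 + y)"
  proof -
    have "y = ?s\<^sup>2 / ?T\<^sup>2" by (simp add: y power_mult_distrib power_mult[symmetric] mult.commute)
    moreover have "?s\<^sup>2 / ?T\<^sup>2 / (1 + ?s\<^sup>2 / ?T\<^sup>2) = ?s\<^sup>2 / (?T\<^sup>2 + ?s\<^sup>2)"
      using T pos(3) by (simp add: divide_simps)
    ultimately show ?thesis by (simp only:)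
  qed
  finally show ?thesis by simp
qed

text \<open>
  Here the triangle inequality suffices: \<open>|\<zeta> - z\<^sub>n| \<le> |\<zeta> - \<tau>| + |\<tau> - z\<^sub>n|\<close>.
\<close>

lemma ratio_lower:
  assumes c: "c > 0" "c * \<alpha> ^ n \<le> cmod (\<tau> - orb n)" and \<zeta>: "\<zeta> \<in> sphere 0 1 - {\<tau>}"
    and y: "y = (\<alpha>\<^sup>2) ^ n * (c\<^sup>2 / (cmod (\<zeta> - \<tau>))\<^sup>2)"
  shows "y / (1 + y) \<le> 2 * ratio (orb n) \<zeta>"
proof -
  let ?T = "cmod (\<zeta> - \<tau>)" and ?d = "cmod (\<tau> - orb n)" and ?e = "cmod (\<zeta> - orb n)"
  let ?s = "c * \<alpha> ^ n"
  have T: "?T > 0" using \<zeta> by simp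
  have e: "?e > 0" using \<zeta> orb_in_disc[of n] by auto
  have "?e \<le> ?T + ?d" using norm_triangle_ineq[of "\<zeta> - \<tau>" "\<tau> - orb n"] by simp
  then have "?e\<^sup>2 \<le> (?T + ?d)\<^sup>2" using e by (intro power_mono) auto
  also have "\<dots> \<le> 2 * (?T\<^sup>2 + ?d\<^sup>2)"
    using zero_le_power2[of "?T - ?d"] by (simp add: power2_eq_square algebra_simps)
  finally have sum: "?e\<^sup>2 \<le> 2 * (?T\<^sup>2 + ?d\<^sup>2)" .
  have pos: "?T\<^sup>2 + ?d\<^sup>2 > 0" "?e\<^sup>2 > 0" "?T\<^sup>2 + ?s\<^sup>2 > 0" using T e by (auto intro: add_pos_nonneg)
  have "y = ?s\<^sup>2 / ?T\<^sup>2" by (simp add: y power_mult_distrib power_mult[symmetric] mult.commute)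
  moreover have "?s\<^sup>2 / ?T\<^sup>2 / (1 + ?s\<^sup>2 / ?T\<^sup>2) = ?s\<^sup>2 / (?T\<^sup>2 + ?s\<^sup>2)"
    using T pos(3) by (simp add: divide_simps)
  ultimately have "y / (1 + y) = ?s\<^sup>2 / (?T\<^sup>2 + ?s\<^sup>2)" by simp
  also have "\<dots> \<le> ?d\<^sup>2 / (?T\<^sup>2 + ?d\<^sup>2)"
  proof -
    have "?s\<^sup>2 \<le> ?d\<^sup>2" using c \<alpha> by (intro power_mono) auto
    then have "?T\<^sup>2 * ?s\<^sup>2 \<le> ?T\<^sup>2 * ?d\<^sup>2" by (intro mult_left_mono) auto
    then have "?s\<^sup>2 * (?T\<^sup>2 + ?d\<^sup>2) \<le> ?d\<^sup>2 * (?T\<^sup>2 + ?s\<^sup>2)" by (simp add: algebra_simps)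
    then show ?thesis using pos by (simp add: divide_le_eq pos_le_divide_eq del: power_mult_distrib)
  qed
  also have "\<dots> \<le> 2 * ratio (orb n) \<zeta>"
  proof -
    have "?d\<^sup>2 * ?e\<^sup>2 \<le> ?d\<^sup>2 * (2 * (?T\<^sup>2 + ?d\<^sup>2))" using sum by (intro mult_left_mono) auto
    then show ?thesis unfolding ratio_def using pos by (simp add: field_simps)
  qed
  finally show ?thesis .
qed

lemma sum_gain: "(\<Sum>n<N. gain n) = (\<integral>\<zeta>. (\<Sum>n<N. ratio (orb n) \<zeta>) \<partial>\<sigma>)"
  unfolding gain_def by (rule Bochner_Integration.integral_sum[symmetric]) (rule integrable_ratio[OF orb_in_disc])

lemma integrable_sum_ratio: "integrable \<sigma> (\<lambda>\<zeta>. \<Sum>n<N. ratio (orb n) \<zeta>)"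
  by (intro Bochner_Integration.integrable_sum integrable_ratio[OF orb_in_disc])

text \<open>
  Summed over \<open>n\<close>, the upper bound on the ratios is at most a constant times
  \<open>ln (1 + 4 / |\<zeta> - \<tau>|\<^sup>2)\<close>, uniformly in the number of terms, and this is
  \<open>2 ln (1 / |\<zeta> - \<tau>|)\<close> up to a constant.
\<close>

lemma log_integrable_imp_gain_summable:
  assumes int: "integrable \<sigma> (\<lambda>\<zeta>. ln (1 / cmod (\<zeta> - \<tau>)))"
  shows "\<exists>K. \<forall>N. (\<Sum>n<N. gain n) \<le> K"
proof -
  obtain M where M: "M \<ge> 1" "\<And>n. cmod (\<tau> - orb n) \<le> M * (1 - cmod (orb n))"
    using orbit_nontangential by blast
  define C where "C = ((1 + M)\<^sup>2 + M\<^sup>2) / (1 - \<alpha>\<^sup>2)"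
  have \<alpha>2: "0 < \<alpha>\<^sup>2" "\<alpha>\<^sup>2 < 1" using \<alpha> by (auto simp: abs_square_less_1)
  have C: "C \<ge> 0" using \<alpha>2 by (simp add: C_def)
  let ?h = "\<lambda>\<zeta>. C * (ln 8 + 2 * ln (1 / cmod (\<zeta> - \<tau>)))"
  have "(\<Sum>n<N. gain n) \<le> (\<integral>\<zeta>. ?h \<zeta> \<partial>\<sigma>)" for N
    unfolding sum_gain
  proof (rule Bochner_Integration.integral_mono[OF integrable_sum_ratio])
    show "integrable \<sigma> ?h" using int by simp
    fix \<zeta> assume "\<zeta> \<in> space \<sigma>"
    then have \<zeta>: "\<zeta> \<in> sphere 0 1 - {\<tau>}" by (simp add: space_\<sigma>)
    let ?T = "cmod (\<zeta> - \<tau>)"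
    have T: "0 < ?T" "?T \<le> 2" using \<zeta> norm_triangle_ineq4[of \<zeta> \<tau>] norm_\<tau> by auto
    define Y where "Y = 4 / ?T\<^sup>2"
    have "(\<Sum>n<N. ratio (orb n) \<zeta>)
        \<le> (\<Sum>n<N. ((1 + M)\<^sup>2 + M\<^sup>2) * ((\<alpha>\<^sup>2) ^ n * Y / (1 + (\<alpha>\<^sup>2) ^ n * Y)))"
      by (intro sum_mono ratio_upper[OF M(1) M(2) \<zeta>]) (simp add: Y_def)
    also have "\<dots> = C * ((1 - \<alpha>\<^sup>2) * (\<Sum>n<N. (\<alpha>\<^sup>2) ^ n * Y / (1 + (\<alpha>\<^sup>2) ^ n * Y)))"
      using \<alpha>2 by (simp add: C_def sum_distrib_left)
    also have "\<dots> \<le> C * ln (1 + Y)"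
      using C by (intro mult_left_mono log_geometric_sum_bounds(1) \<alpha>2) (auto simp: Y_def)
    also have "ln (1 + Y) \<le> ln (8 / ?T\<^sup>2)"
    proof (subst ln_le_cancel_iff)
      have "?T\<^sup>2 \<le> 2\<^sup>2" using T by (intro power_mono) auto
      then have "1 \<le> 4 / ?T\<^sup>2" using T by (simp add: pos_le_divide_eq)
      moreover have "8 / ?T\<^sup>2 = 4 / ?T\<^sup>2 + 4 / ?T\<^sup>2" by simp
      ultimately show "1 + Y \<le> 8 / ?T\<^sup>2" unfolding Y_def by linarith
    qed (use T in \<open>auto simp: Y_def intro: add_pos_nonneg\<close>)
    then have "C * ln (1 + Y) \<le> C * ln (8 / ?T\<^sup>2)" using C by (intro mult_left_mono)
    also have "ln (8 / ?T\<^sup>2) = ln 8 + 2 * ln (1 / ?T)"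
      using T by (simp add: ln_div ln_realpow)
    finally show "(\<Sum>n<N. ratio (orb n) \<zeta>) \<le> ?h \<zeta>" by simp
  qed
  then show ?thesis by blast
qed

text \<open>
  The functions \<open>ln (1 + Y) - ln (1 + \<alpha>\<^bsup>2N\<^esup> Y)\<close> with \<open>Y = c\<^sup>2 / |\<zeta> - \<tau>|\<^sup>2\<close> are dominated by partial
  sums of the ratios, hence have bounded integrals. They increase to \<open>ln (1 + Y)\<close>, which is therefore
  integrable by monotone convergence.
\<close>

lemma gain_summable_imp_log_integrable:
  assumes K: "\<And>N. (\<Sum>n<N. gain n) \<le> K" and c: "c > 0" "\<And>n. c * \<alpha> ^ n \<le> cmod (\<tau> - orb n)"
  shows "integrable \<sigma> (\<lambda>\<zeta>. ln (1 / cmod (\<zeta> - \<tau>)))"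
proof -
  have \<alpha>2: "0 < \<alpha>\<^sup>2" "\<alpha>\<^sup>2 < 1" using \<alpha> by (auto simp: abs_square_less_1)
  define Y where "Y \<zeta> = c\<^sup>2 / (cmod (\<zeta> - \<tau>))\<^sup>2" for \<zeta>
  define f where "f N \<zeta> = ln (1 + Y \<zeta>) - ln (1 + (\<alpha>\<^sup>2) ^ N * Y \<zeta>)" for N \<zeta>
  define C where "C = (1 - \<alpha>\<^sup>2) / \<alpha>\<^sup>2 * 2"
  have C: "C \<ge> 0" using \<alpha>2 by (simp add: C_def)
  have Y: "Y \<zeta> \<ge> 0" for \<zeta> by (simp add: Y_def)
  have pos: "1 + (\<alpha>\<^sup>2) ^ N * Y \<zeta> > 0" for N \<zeta>
    using \<alpha>2 Y[of \<zeta>] by (intro add_pos_nonneg) auto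
  have mono: "mono (\<lambda>N. f N \<zeta>)" for \<zeta>
  proof (rule monoI)
    fix m n :: nat assume "m \<le> n"
    then have "(\<alpha>\<^sup>2) ^ n * Y \<zeta> \<le> (\<alpha>\<^sup>2) ^ m * Y \<zeta>"
      using \<alpha>2 Y by (intro mult_right_mono power_decreasing) auto
    then show "f m \<zeta> \<le> f n \<zeta>"
      using pos[of n \<zeta>] pos[of m \<zeta>] by (simp add: f_def)
  qed
  have f0: "0 \<le> f N \<zeta>" for N \<zeta> using monoD[OF mono, of 0 N \<zeta>] by (simp add: f_def)
  have f_le: "f N \<zeta> \<le> C * (\<Sum>n<N. ratio (orb n) \<zeta>)" if \<zeta>: "\<zeta> \<in> space \<sigma>" for N \<zeta>
  proof -
    have "f N \<zeta> \<le> (1 - \<alpha>\<^sup>2) / \<alpha>\<^sup>2 * (\<Sum>n<N. (\<alpha>\<^sup>2) ^ n * Y \<zeta> / (1 + (\<alpha>\<^sup>2) ^ n * Y \<zeta>))"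
      unfolding f_def by (intro log_geometric_sum_bounds(2) \<alpha>2 Y)
    also have "\<dots> \<le> (1 - \<alpha>\<^sup>2) / \<alpha>\<^sup>2 * (\<Sum>n<N. 2 * ratio (orb n) \<zeta>)"
      using \<alpha>2 \<zeta> by (intro mult_left_mono sum_mono ratio_lower[OF c]) (auto simp: space_\<sigma> Y_def)
    also have "\<dots> = C * (\<Sum>n<N. ratio (orb n) \<zeta>)"
      unfolding C_def sum_distrib_left[symmetric] by simp
    finally show ?thesis .
  qed
  have contY: "continuous_on (sphere 0 1 - {\<tau>}) Y"
    unfolding Y_def[abs_def] by (intro continuous_intros) auto
  have meas: "f N \<in> borel_measurable \<sigma>" for N
    unfolding f_def[abs_def]
    by (intro measurable_\<sigma> continuous_intros contY) (use pos[of 0] pos in \<open>auto simp: less_imp_neq[symmetric]\<close>)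
  have int: "integrable \<sigma> (f N)" for N
  proof (rule Bochner_Integration.integrable_bound)
    show "integrable \<sigma> (\<lambda>\<zeta>. C * (\<Sum>n<N. ratio (orb n) \<zeta>))"
      using integrable_sum_ratio by simp
    show "AE \<zeta> in \<sigma>. norm (f N \<zeta>) \<le> norm (C * (\<Sum>n<N. ratio (orb n) \<zeta>))"
    proof (rule AE_I2)
      fix \<zeta> assume "\<zeta> \<in> space \<sigma>"
      then have "f N \<zeta> \<le> \<bar>C * (\<Sum>n<N. ratio (orb n) \<zeta>)\<bar>"
        using f_le abs_ge_self order_trans by blast
      then show "norm (f N \<zeta>) \<le> norm (C * (\<Sum>n<N. ratio (orb n) \<zeta>))"
        using f0 by (simp only: real_norm_def abs_of_nonneg)
    qed
  qed (rule meas)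
  have bound: "integral\<^sup>L \<sigma> (f N) \<le> C * K" for N
  proof -
    have "integral\<^sup>L \<sigma> (f N) \<le> (\<integral>\<zeta>. C * (\<Sum>n<N. ratio (orb n) \<zeta>) \<partial>\<sigma>)"
      using f_le integrable_sum_ratio by (intro Bochner_Integration.integral_mono int) auto
    also have "\<dots> = C * (\<Sum>n<N. gain n)" by (simp add: sum_gain)
    also have "\<dots> \<le> C * K" using K C by (intro mult_left_mono)
    finally show ?thesis .
  qed
  have "incseq (\<lambda>N. integral\<^sup>L \<sigma> (f N))"
    using mono by (intro incseq_SucI Bochner_Integration.integral_mono int) (auto simp: mono_def)
  then obtain x where x: "(\<lambda>N. integral\<^sup>L \<sigma> (f N)) \<longlonglongrightarrow> x"
    using bound incseq_convergent by blast
  have lim: "(\<lambda>N. f N \<zeta>) \<longlonglongrightarrow> ln (1 + Y \<zeta>)" for \<zeta>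
  proof -
    have "(\<lambda>N. (\<alpha>\<^sup>2) ^ N) \<longlonglongrightarrow> 0" using \<alpha>2 by (intro LIMSEQ_realpow_zero) auto
    then have "(\<lambda>N. (\<alpha>\<^sup>2) ^ N * Y \<zeta>) \<longlonglongrightarrow> 0 * Y \<zeta>" by (rule tendsto_mult) (rule tendsto_const)
    then have "(\<lambda>N. f N \<zeta>) \<longlonglongrightarrow> ln (1 + Y \<zeta>) - ln (1 + 0 * Y \<zeta>)"
      unfolding f_def by (intro tendsto_diff[OF tendsto_const] tendsto_ln tendsto_add[OF tendsto_const]) auto
    then show ?thesis by simp
  qed
  have "integrable \<sigma> (\<lambda>\<zeta>. ln (1 + Y \<zeta>))"
  proof (rule integrable_monotone_convergence[OF int _ _ x])
    show "AE \<zeta> in \<sigma>. mono (\<lambda>N. f N \<zeta>)" using mono by simp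
    show "AE \<zeta> in \<sigma>. (\<lambda>N. f N \<zeta>) \<longlonglongrightarrow> ln (1 + Y \<zeta>)" using lim by simp
    show "(\<lambda>\<zeta>. ln (1 + Y \<zeta>)) \<in> borel_measurable \<sigma>"
      by (intro measurable_\<sigma> continuous_intros contY) (use pos[of 0] in \<open>auto simp: less_imp_neq[symmetric]\<close>)
  qed
  then have int': "integrable \<sigma> (\<lambda>\<zeta>. ln (1 + Y \<zeta>) + (\<bar>ln c\<bar> + ln 2))" by simp
  show ?thesis
  proof (rule Bochner_Integration.integrable_bound[OF int'])
    show "(\<lambda>\<zeta>. ln (1 / cmod (\<zeta> - \<tau>))) \<in> borel_measurable \<sigma>"
      by (intro measurable_\<sigma> continuous_intros) auto
    show "AE \<zeta> in \<sigma>. norm (ln (1 / cmod (\<zeta> - \<tau>))) \<le> norm (ln (1 + Y \<zeta>) + (\<bar>ln c\<bar> + ln 2))"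
    proof (rule AE_I2)
      fix \<zeta> assume "\<zeta> \<in> space \<sigma>"
      then have \<zeta>: "\<zeta> \<in> sphere 0 1 - {\<tau>}" by (simp add: space_\<sigma>)
      let ?T = "cmod (\<zeta> - \<tau>)"
      have T: "0 < ?T" "?T \<le> 2" using \<zeta> norm_triangle_ineq4[of \<zeta> \<tau>] norm_\<tau> by auto
      have "ln ?T \<le> ln 2" using T by simp
      then have 1: "- ln 2 \<le> ln (1 / ?T)" using T by (simp add: ln_div)
      have Y0: "Y \<zeta> > 0" using T c by (simp add: Y_def)
      have nn: "0 \<le> ln (1 + Y \<zeta>)" using Y by (intro ln_ge_zero) simp
      have "ln (Y \<zeta>) \<le> ln (1 + Y \<zeta>)" using Y0 by simp
      moreover have "ln (Y \<zeta>) = 2 * ln c + 2 * ln (1 / ?T)"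
        unfolding Y_def using T c by (simp add: ln_div ln_realpow)
      ultimately have "ln (1 / ?T) \<le> ln (1 + Y \<zeta>) + \<bar>ln c\<bar>" using nn by argo
      moreover have "0 \<le> ln (2::real)" by simp
      ultimately show "norm (ln (1 / ?T)) \<le> norm (ln (1 + Y \<zeta>) + (\<bar>ln c\<bar> + ln 2))"
        using 1 nn unfolding real_norm_def by linarith
    qed
  qed
qed

proposition rate_iff_log_integrable:
  "(\<lambda>n. - ln (1 - (cmod (orb n))\<^sup>2) - real n * ln (1 / \<alpha>)) \<in> O(\<lambda>_. 1) \<longleftrightarrow>
   integrable \<sigma> (\<lambda>\<zeta>. ln (1 / cmod (\<zeta> - \<tau>)))"
  unfolding excess_bounded_iff_rate[symmetric]
proof
  assume "\<exists>B. \<forall>n. excess n \<le> B"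
  then obtain B where B: "\<And>n. excess n \<le> B" by blast
  obtain K where K: "\<And>N. (\<Sum>n<N. gain n) \<le> K"
    using excess_bounded_iff B by blast
  obtain M where M: "M \<ge> 1" "\<And>n. cmod (\<tau> - orb n) \<le> M * (1 - cmod (orb n))"
    using orbit_nontangential by blast
  have MB: "M * B > 0" using M B[of 0] excess_ge_1[of 0] by (intro mult_pos_pos) auto
  have "1 / (M * B) * \<alpha> ^ n \<le> cmod (\<tau> - orb n)" for n
    using dist_orbit_ge[OF B M(2,1)] MB by (simp add: divide_le_eq mult.commute)
  then show "integrable \<sigma> (\<lambda>\<zeta>. ln (1 / cmod (\<zeta> - \<tau>)))"
    using gain_summable_imp_log_integrable[OF K, of "1 / (M * B)"] MB by simp
next
  assume "integrable \<sigma> (\<lambda>\<zeta>. ln (1 / cmod (\<zeta> - \<tau>)))"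
  then show "\<exists>B. \<forall>n. excess n \<le> B"
    using log_integrable_imp_gain_summable excess_bounded_iff by blast
qed

end

section \<open>The hyperbolic rate as a rate of approach to the circle\<close>

text \<open>
  Write \<open>2 artanh p\<close> as \<open>2 ln (1 + p) - ln (1 - p\<^sup>2)\<close> and insert the product formula for \<open>1 - p\<^sup>2\<close>: its
  factor \<open>1 - |b|\<^sup>2\<close> gives the main term, all other terms are bounded for fixed \<open>v\<close>.
\<close>

lemma artanh_pseudo_dist_bound:
  assumes v: "cmod v < 1"
  shows "\<exists>C. \<forall>b\<in>unit_disc. \<bar>2 * artanh (pseudo_dist b v) - (- ln (1 - (cmod b)\<^sup>2))\<bar> \<le> C"
proof (intro exI ballI)
  fix b assume "b \<in> unit_disc"
  then have b: "cmod b < 1" by simp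
  define p where "p = pseudo_dist b v"
  define e where "e = cmod (1 - cnj b * v)"
  have p: "0 \<le> p" "p < 1" using pseudo_dist_less_1[OF b v] by (auto simp: p_def)
  have sq: "(cmod b)\<^sup>2 < 1" "(cmod v)\<^sup>2 < 1" using b v by (auto simp: abs_square_less_1)
  have "cmod (cnj b * v) \<le> 1 * cmod v" unfolding norm_mult using b by (intro mult_right_mono) auto
  then have e: "1 - cmod v \<le> e" "e \<le> 2" "e > 0"
    using norm_triangle_ineq2[of 1 "cnj b * v"] norm_triangle_ineq4[of 1 "cnj b * v"] v
    by (auto simp: e_def)
  have "1 - p\<^sup>2 = (1 - (cmod b)\<^sup>2) * (1 - (cmod v)\<^sup>2) / e\<^sup>2"
    unfolding p_def e_def by (rule one_minus_pseudo_dist_squared[OF b v])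
  then have "ln (1 - p\<^sup>2) = ln (1 - (cmod b)\<^sup>2) + ln (1 - (cmod v)\<^sup>2) - 2 * ln e"
    using sq e by (simp add: ln_div ln_mult ln_realpow)
  moreover have "1 - p\<^sup>2 = (1 + p) * (1 - p)" by (simp add: power2_eq_square algebra_simps)
  then have "ln (1 - p\<^sup>2) = ln (1 + p) + ln (1 - p)" using p by (simp add: ln_mult)
  moreover have "2 * artanh p = ln (1 + p) - ln (1 - p)" using p by (simp add: artanh_def ln_div)
  ultimately have eq: "2 * artanh p - (- ln (1 - (cmod b)\<^sup>2)) = 2 * ln (1 + p) - ln (1 - (cmod v)\<^sup>2) + 2 * ln e"
    by simp
  have "0 \<le> ln (1 + p)" "ln (1 + p) \<le> ln 2" using p by auto
  moreover have "ln (1 - cmod v) \<le> ln e" "ln e \<le> ln 2" using e v by auto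
  ultimately show "\<bar>2 * artanh (pseudo_dist b v) - (- ln (1 - (cmod b)\<^sup>2))\<bar>
      \<le> 4 * ln 2 + \<bar>ln (1 - (cmod v)\<^sup>2)\<bar> + 2 * \<bar>ln (1 - cmod v)\<bar>"
    unfolding p_def[symmetric] eq by linarith
qed

lemma bigo_one_cong_bounded:
  fixes f g :: "nat \<Rightarrow> real"
  assumes "\<And>n. \<bar>f n - g n\<bar> \<le> C"
  shows "f \<in> O(\<lambda>_. 1) \<longleftrightarrow> g \<in> O(\<lambda>_. 1)"
proof -
  have "(\<lambda>n. f n - g n) \<in> O(\<lambda>_. 1)" using assms bigo_one_iff_bounded by blast
  from sum_in_bigo(1)[OF this, of g] sum_in_bigo(2)[OF _ this, of f]
  show ?thesis by auto
qed

text \<open>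
  The product formula for \<open>1 - p\<^sup>2\<close> bounds \<open>(1 - |a|\<^sup>2) (1 - |b|\<^sup>2)\<close> from below by a multiple of
  \<open>|1 - cnj a * b|\<^sup>2\<close>, which is at least \<open>(1 - |a|)\<^sup>2\<close>.
\<close>

lemma pseudo_dist_imp_boundary_comparable:
  assumes ab: "cmod a < 1" "cmod b < 1" and q: "pseudo_dist a b \<le> q" "q < 1"
  shows "(1 - q\<^sup>2) / 4 * (1 - (cmod a)\<^sup>2) \<le> 1 - (cmod b)\<^sup>2"
proof -
  let ?A = "1 - (cmod a)\<^sup>2" and ?B = "1 - (cmod b)\<^sup>2" and ?e = "cmod (1 - cnj a * b)"
  have "0 \<le> q" using q(1) pseudo_dist_nonneg[of a b] by linarith
  then have q0: "1 - q\<^sup>2 > 0" using q(2) by (simp add: abs_square_less_1)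
  have A: "?A > 0" using ab by (simp add: abs_square_less_1)
  have e: "?e > 0" using one_minus_cnj_mult_neq_0[of a b] ab by simp
  have "(pseudo_dist a b)\<^sup>2 \<le> q\<^sup>2" using q by (intro power_mono) auto
  then have "1 - q\<^sup>2 \<le> ?A * ?B / ?e\<^sup>2"
    using one_minus_pseudo_dist_squared[OF ab] by simp
  then have 1: "(1 - q\<^sup>2) * ?e\<^sup>2 \<le> ?A * ?B" using e by (simp add: pos_le_divide_eq)
  have "cmod (cnj a * b) \<le> cmod a * 1" unfolding norm_mult using ab by (intro mult_mono) auto
  then have "1 - cmod a \<le> ?e" using norm_triangle_ineq2[of 1 "cnj a * b"] by simp
  moreover have "?A \<le> 2 * (1 - cmod a)"
  proof -
    have "?A = (1 + cmod a) * (1 - cmod a)" by (simp add: power2_eq_square algebra_simps)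
    also have "\<dots> \<le> 2 * (1 - cmod a)" using ab by (intro mult_right_mono) auto
    finally show ?thesis .
  qed
  ultimately have "?A / 2 \<le> ?e" by simp
  then have "(?A / 2)\<^sup>2 \<le> ?e\<^sup>2" using A by (intro power_mono) auto
  then have "(1 - q\<^sup>2) * (?A / 2)\<^sup>2 \<le> (1 - q\<^sup>2) * ?e\<^sup>2" using q0 by (intro mult_left_mono) auto
  also note 1
  also have "(1 - q\<^sup>2) * (?A / 2)\<^sup>2 = ?A * ((1 - q\<^sup>2) / 4 * ?A)"
    by (simp add: power_divide power2_eq_square[of ?A])
  finally have "?A * ((1 - q\<^sup>2) / 4 * ?A) \<le> ?A * ?B" .
  then show ?thesis using A mult_le_cancel_left_pos by blast
qed

text \<open>
  The extremal rate with the hyperbolic distance replaced by its leading term, so that no second base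
  point occurs.
\<close>

definition boundary_rate :: "(complex \<Rightarrow> complex) \<Rightarrow> real \<Rightarrow> complex \<Rightarrow> bool" where
  "boundary_rate G \<alpha> b \<longleftrightarrow>
     (\<lambda>n. - ln (1 - (cmod ((G ^^ n) b))\<^sup>2) - real n * ln (1 / \<alpha>)) \<in> O(\<lambda>_. 1)"

lemma funpow_in: "f ` S \<subseteq> S \<Longrightarrow> x \<in> S \<Longrightarrow> (f ^^ n) x \<in> S"
  by (induction n) auto

lemma boundary_rate_base_point:
  assumes G: "G holomorphic_on unit_disc" "G ` unit_disc \<subseteq> unit_disc"
    and ab: "a \<in> unit_disc" "b \<in> unit_disc"
  shows "boundary_rate G \<alpha> a \<longleftrightarrow> boundary_rate G \<alpha> b"
proof -
  define q where "q = pseudo_dist a b"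
  have q: "0 \<le> q" "q < 1" using pseudo_dist_less_1 ab by (auto simp: q_def)
  note in_disc = funpow_in[OF G(2)]
  have contract: "pseudo_dist ((G ^^ n) a) ((G ^^ n) b) \<le> q" for n
  proof (induction n)
    case (Suc n)
    then show ?case
      using Schwarz_Pick[OF G in_disc[OF ab(1)] in_disc[OF ab(2)], of n n] by simp
  qed (simp add: q_def)
  define K where "K = (1 - q\<^sup>2) / 4"
  have k: "K > 0" using q by (simp add: K_def abs_square_less_1)
  have "\<bar>(- ln (1 - (cmod ((G ^^ n) a))\<^sup>2) - real n * ln (1 / \<alpha>))
      - (- ln (1 - (cmod ((G ^^ n) b))\<^sup>2) - real n * ln (1 / \<alpha>))\<bar> \<le> - ln K" for n
  proof -
    let ?a = "(G ^^ n) a" and ?b = "(G ^^ n) b"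
    have lt: "cmod ?a < 1" "cmod ?b < 1" using in_disc[OF ab(1)] in_disc[OF ab(2)] by simp_all
    have pos: "1 - (cmod ?a)\<^sup>2 > 0" "1 - (cmod ?b)\<^sup>2 > 0" using lt by (simp_all add: abs_square_less_1)
    have "K * (1 - (cmod ?a)\<^sup>2) \<le> 1 - (cmod ?b)\<^sup>2"
      unfolding K_def by (rule pseudo_dist_imp_boundary_comparable[OF lt contract q(2)])
    then have 1: "ln K + ln (1 - (cmod ?a)\<^sup>2) \<le> ln (1 - (cmod ?b)\<^sup>2)"
      using k pos by (simp flip: ln_mult_pos)
    have "pseudo_dist ?b ?a \<le> q" using contract[of n] by (simp add: pseudo_dist_commute)
    then have "K * (1 - (cmod ?b)\<^sup>2) \<le> 1 - (cmod ?a)\<^sup>2"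
      unfolding K_def by (rule pseudo_dist_imp_boundary_comparable[OF lt(2,1) _ q(2)])
    then have "ln K + ln (1 - (cmod ?b)\<^sup>2) \<le> ln (1 - (cmod ?a)\<^sup>2)"
      using k pos by (simp flip: ln_mult_pos)
    with 1 show ?thesis by (simp add: abs_le_iff)
  qed
  then show ?thesis unfolding boundary_rate_def by (rule bigo_one_cong_bounded)
qed

lemma conjugate_map_funpow:
  assumes \<psi>: "conformal_onto_disc \<psi> \<Omega>" and g: "g ` \<Omega> \<subseteq> \<Omega>" and z: "z \<in> \<Omega>"
  shows "(conjugate_map \<Omega> \<psi> g ^^ n) (\<psi> z) = \<psi> ((g ^^ n) z)"
proof (induction n)
  case (Suc n)
  then show ?case
    using conformal_onto_discD(5)[OF \<psi> funpow_in[OF g z, of n]] by (simp add: conjugate_map_def)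
qed simp

lemma conjugate_map_self_map:
  assumes \<psi>: "conformal_onto_disc \<psi> \<Omega>" and g: "g holomorphic_on \<Omega>" "g ` \<Omega> \<subseteq> \<Omega>"
  shows "conjugate_map \<Omega> \<psi> g holomorphic_on unit_disc"
    and "conjugate_map \<Omega> \<psi> g ` unit_disc \<subseteq> unit_disc"
proof -
  note D = conformal_onto_discD[OF \<psi>]
  show "conjugate_map \<Omega> \<psi> g ` unit_disc \<subseteq> unit_disc"
    using D(3,4) g(2) by (auto simp: conjugate_map_def image_subset_iff)
  have "\<psi> \<circ> g holomorphic_on \<Omega>" by (rule holomorphic_on_compose_gen[OF g(1) D(1) g(2)])
  then show "conjugate_map \<Omega> \<psi> g holomorphic_on unit_disc"
    unfolding conjugate_map_def by (rule holomorphic_on_compose_gen[OF D(2)]) (use D(4) in blast)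
qed

lemma hyperbolic_rate_iff_boundary_rate:
  assumes \<Omega>: "open \<Omega>" "simply_connected \<Omega>" and \<psi>: "conformal_onto_disc \<psi> \<Omega>"
    and g: "g ` \<Omega> \<subseteq> \<Omega>" and zw: "z \<in> \<Omega>" "w \<in> \<Omega>"
  shows "hyperbolic_rate_at \<Omega> g \<alpha> z w \<longleftrightarrow> boundary_rate (conjugate_map \<Omega> \<psi> g) \<alpha> (\<psi> z)"
proof -
  note D = conformal_onto_discD[OF \<psi>]
  have "cmod (\<psi> w) < 1" using D(3)[OF zw(2)] by simp
  then obtain C where C: "\<And>b. b \<in> unit_disc \<Longrightarrow>
      \<bar>2 * artanh (pseudo_dist b (\<psi> w)) - (- ln (1 - (cmod b)\<^sup>2))\<bar> \<le> C"
    using artanh_pseudo_dist_bound by blast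
  have "\<bar>(poincare_dist \<Omega> ((g ^^ n) z) w - real n * ln (1 / \<alpha>)) -
      (- ln (1 - (cmod ((conjugate_map \<Omega> \<psi> g ^^ n) (\<psi> z)))\<^sup>2) - real n * ln (1 / \<alpha>))\<bar> \<le> C" for n
  proof -
    have gn: "(g ^^ n) z \<in> \<Omega>" using funpow_in[OF g zw(1)] .
    show ?thesis
      unfolding poincare_dist_simply_connected[OF \<Omega> \<psi> gn zw(2)] conjugate_map_funpow[OF \<psi> g zw(1)]
      using C[OF D(3)[OF gn]] by simp
  qed
  then show ?thesis
    unfolding hyperbolic_rate_at_def boundary_rate_def by (rule bigo_one_cong_bounded)
qed

lemma extremal_rate_iff_boundary_rate:
  assumes \<Omega>: "open \<Omega>" "simply_connected \<Omega>" "\<Omega> \<noteq> {}" and \<psi>: "conformal_onto_disc \<psi> \<Omega>"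
    and g: "g holomorphic_on \<Omega>" "g ` \<Omega> \<subseteq> \<Omega>"
  shows "extremal_hyperbolic_rate \<Omega> g \<alpha> \<longleftrightarrow> boundary_rate (conjugate_map \<Omega> \<psi> g) \<alpha> 0"
    and "(\<forall>z\<in>\<Omega>. \<forall>w\<in>\<Omega>. hyperbolic_rate_at \<Omega> g \<alpha> z w) \<longleftrightarrow> boundary_rate (conjugate_map \<Omega> \<psi> g) \<alpha> 0"
proof -
  have "hyperbolic_rate_at \<Omega> g \<alpha> z w \<longleftrightarrow> boundary_rate (conjugate_map \<Omega> \<psi> g) \<alpha> 0"
    if "z \<in> \<Omega>" "w \<in> \<Omega>" for z w
    using hyperbolic_rate_iff_boundary_rate[OF \<Omega>(1,2) \<psi> g(2) that]
      boundary_rate_base_point[OF conjugate_map_self_map[OF \<psi> g], of "\<psi> z" 0]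
      conformal_onto_discD(3)[OF \<psi> that(1)] by simp
  with \<Omega>(3) show "extremal_hyperbolic_rate \<Omega> g \<alpha> \<longleftrightarrow> boundary_rate (conjugate_map \<Omega> \<psi> g) \<alpha> 0"
    and "(\<forall>z\<in>\<Omega>. \<forall>w\<in>\<Omega>. hyperbolic_rate_at \<Omega> g \<alpha> z w) \<longleftrightarrow> boundary_rate (conjugate_map \<Omega> \<psi> g) \<alpha> 0"
    unfolding extremal_hyperbolic_rate_def by blast+
qed

lemma extremal_rate_unit_disc:
  assumes G: "G holomorphic_on unit_disc" "G ` unit_disc \<subseteq> unit_disc"
  shows "extremal_hyperbolic_rate unit_disc G \<alpha> \<longleftrightarrow> boundary_rate G \<alpha> 0"
proof -
  have "(conjugate_map unit_disc id G ^^ n) 0 = (G ^^ n) 0" for n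
    using conjugate_map_funpow[OF conformal_onto_disc_id G(2), of 0 n] by simp
  then show ?thesis
    using extremal_rate_iff_boundary_rate(1)[OF _ _ _ conformal_onto_disc_id G, of \<alpha>]
      convex_imp_simply_connected[OF convex_ball, of "0::complex" 1]
    by (simp add: boundary_rate_def)
qed

section \<open>Julia's inequality and the change of the Riemann map\<close>

lemma norm_one_minus_cnj_unit:
  assumes "cmod \<tau> = 1" shows "cmod (1 - cnj \<tau> * z) = cmod (\<tau> - z)"
proof -
  have "\<tau> * cnj \<tau> = 1" using complex_norm_square[of \<tau>] assms by simp
  then have "\<tau> * (1 - cnj \<tau> * z) = \<tau> - z" by (simp add: right_diff_distrib flip: mult.assoc)
  then show ?thesis using assms by (metis mult_1 norm_mult)
qed

text \<open>
  Julia's inequality at the Denjoy-Wolff point: the horodiscs at \<open>\<tau>\<close> are invariant. It is the limit of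
  Schwarz-Pick for the pair \<open>x\<^sub>n\<close>, \<open>z\<close> along an orbit \<open>x\<^sub>n\<close>. As \<open>1 - |x\<^sub>n|\<^sup>2\<close> tends to \<open>0\<close>, it fails to
  increase for infinitely many \<open>n\<close>, and for those the factors belonging to the orbit cancel in the
  favourable direction.
\<close>

lemma julia_denjoy_wolff:
  assumes G: "G holomorphic_on unit_disc" "G ` unit_disc \<subseteq> unit_disc"
    and dw: "denjoy_wolff_point G \<tau>" and z: "z \<in> unit_disc"
  shows "poisson_kernel \<tau> z \<le> poisson_kernel \<tau> (G z)"
proof (rule ccontr)
  assume "\<not> ?thesis"
  then have neg: "poisson_kernel \<tau> (G z) - poisson_kernel \<tau> z < 0" by simp
  have norm_\<tau>: "cmod \<tau> = 1" using dw by (simp add: denjoy_wolff_point_def)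
  define x where "x n = (G ^^ n) 0" for n
  have x: "x n \<in> unit_disc" for n unfolding x_def by (rule funpow_in[OF G(2)]) simp
  have x_Suc: "x (Suc n) = G (x n)" for n by (simp add: x_def)
  have lim: "x \<longlonglongrightarrow> \<tau>" using dw by (simp add: denjoy_wolff_point_def x_def[abs_def])
  have Gz: "G z \<in> unit_disc" using G z by blast
  define a where "a n = 1 - (cmod (x n))\<^sup>2" for n
  have a_pos: "a n > 0" for n using x[of n] by (simp add: a_def abs_square_less_1)
  have "a \<longlonglongrightarrow> 1 - (cmod \<tau>)\<^sup>2" unfolding a_def[abs_def] by (intro tendsto_intros lim)
  then have a_lim: "a \<longlonglongrightarrow> 0" by (simp add: norm_\<tau>)
  have freq: "\<exists>\<^sub>F n in sequentially. a (Suc n) \<le> a n"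
  proof (rule ccontr)
    assume "\<not> ?thesis"
    then have "\<exists>N. \<forall>n\<ge>N. a n < a (Suc n)"
      by (simp add: not_frequently eventually_sequentially not_le)
    then obtain N where N: "\<And>n. n \<ge> N \<Longrightarrow> a n < a (Suc n)" by blast
    have ge: "a N \<le> a n" if "n \<ge> N" for n
      using that by (induction n rule: dec_induct) (use N in \<open>fastforce+\<close>)
    then have "a N \<le> 0" by (intro tendsto_lowerbound[OF a_lim]) (auto simp: eventually_sequentially)
    with a_pos[of N] show False by simp
  qed
  define L where "L n = (1 - (cmod z)\<^sup>2) / (cmod (1 - cnj (x n) * z))\<^sup>2" for n
  define R where "R n = (1 - (cmod (G z))\<^sup>2) / (cmod (1 - cnj (x (Suc n)) * G z))\<^sup>2" for n
  have tz: "cmod (1 - cnj \<tau> * u) \<noteq> 0" if "u \<in> unit_disc" for u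
    using one_minus_cnj_mult_neq_0[of \<tau> u] norm_\<tau> that by simp
  have "L \<longlonglongrightarrow> (1 - (cmod z)\<^sup>2) / (cmod (1 - cnj \<tau> * z))\<^sup>2"
    unfolding L_def[abs_def] using tz[OF z] by (intro tendsto_intros lim) simp
  then have L: "L \<longlonglongrightarrow> poisson_kernel \<tau> z"
    by (simp add: poisson_kernel_def norm_one_minus_cnj_unit[OF norm_\<tau>])
  have "R \<longlonglongrightarrow> (1 - (cmod (G z))\<^sup>2) / (cmod (1 - cnj \<tau> * G z))\<^sup>2"
    unfolding R_def[abs_def] using tz[OF Gz] by (intro tendsto_intros LIMSEQ_Suc lim) simp
  then have R: "R \<longlonglongrightarrow> poisson_kernel \<tau> (G z)"
    by (simp add: poisson_kernel_def norm_one_minus_cnj_unit[OF norm_\<tau>])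
  have "(\<lambda>n. R n - L n) \<longlonglongrightarrow> poisson_kernel \<tau> (G z) - poisson_kernel \<tau> z"
    by (intro tendsto_diff L R)
  then have "\<forall>\<^sub>F n in sequentially. R n - L n < 0"
    using neg by (rule order_tendstoD)
  with freq have "\<exists>\<^sub>F n in sequentially. a (Suc n) \<le> a n \<and> R n - L n < 0"
    by (rule frequently_eventually_frequently)
  then obtain n where n: "a (Suc n) \<le> a n" "R n < L n"
    by (auto dest: frequently_ex)
  have lt: "cmod (x n) < 1" "cmod z < 1" "cmod (x (Suc n)) < 1" "cmod (G z) < 1"
    using x[of n] x[of "Suc n"] z Gz by simp_all
  have "pseudo_dist (x (Suc n)) (G z) \<le> pseudo_dist (x n) z"
    unfolding x_Suc by (rule Schwarz_Pick[OF G x z])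
  then have "(pseudo_dist (x (Suc n)) (G z))\<^sup>2 \<le> (pseudo_dist (x n) z)\<^sup>2"
    by (intro power_mono) auto
  then have "1 - (pseudo_dist (x n) z)\<^sup>2 \<le> 1 - (pseudo_dist (x (Suc n)) (G z))\<^sup>2" by linarith
  then have "a n * L n \<le> a (Suc n) * R n"
    unfolding one_minus_pseudo_dist_squared[OF lt(1,2)] one_minus_pseudo_dist_squared[OF lt(3,4)]
    by (simp add: a_def L_def R_def)
  also have "\<dots> \<le> a n * R n"
    using n(1) lt by (intro mult_right_mono) (auto simp: R_def power_le_one)
  finally show False using n(2) a_pos[of n] by simp
qed

text \<open>
  Inside a Stolz region the Poisson kernel at \<open>\<tau>\<close> is at least \<open>1 / (M |z - \<tau>|)\<close>. By Julia's inequality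
  it does not decrease under \<open>G\<close>, and at \<open>G z\<close> it is at most \<open>1 / |\<tau> - G z|\<^sup>2\<close>.
\<close>

lemma angular_limit_denjoy_wolff:
  assumes G: "G holomorphic_on unit_disc" "G ` unit_disc \<subseteq> unit_disc"
    and dw: "denjoy_wolff_point G \<tau>"
  shows "has_angular_limit G \<tau> \<tau>"
  unfolding has_angular_limit_def
proof (intro allI impI)
  fix M :: real assume M: "M > 1"
  have norm_\<tau>: "cmod \<tau> = 1" using dw by (simp add: denjoy_wolff_point_def)
  let ?S = "{z \<in> unit_disc. cmod (z - \<tau>) < M * (1 - cmod z)}"
  have le: "cmod (G z - \<tau>) \<le> sqrt (M * cmod (z - \<tau>))" if "z \<in> ?S" for z
  proof (rule real_le_rsqrt)
    have z: "z \<in> unit_disc" "cmod z < 1" "cmod (\<tau> - z) \<le> M * (1 - cmod z)"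
      using that by (auto simp: norm_minus_commute)
    have "G z \<in> unit_disc" using G z by blast
    then have nz: "cmod (\<tau> - z) > 0" "cmod (\<tau> - G z) > 0" using z norm_\<tau> by auto
    have "(cmod z)\<^sup>2 \<le> cmod z" using z by (simp add: power2_eq_square mult_left_le_one_le)
    then have "M * (1 - cmod z) \<le> M * (1 - (cmod z)\<^sup>2)" using M by (intro mult_left_mono) auto
    with z have "cmod (\<tau> - z) \<le> M * (1 - (cmod z)\<^sup>2)" by linarith
    also have "1 - (cmod z)\<^sup>2 = poisson_kernel \<tau> z * (cmod (\<tau> - z))\<^sup>2"
      using nz by (simp add: poisson_kernel_def)
    also have "\<dots> \<le> 1 / (cmod (\<tau> - G z))\<^sup>2 * (cmod (\<tau> - z))\<^sup>2"
    proof (rule mult_right_mono)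
      have "poisson_kernel \<tau> (G z) \<le> 1 / (cmod (\<tau> - G z))\<^sup>2"
        unfolding poisson_kernel_def by (intro divide_right_mono) auto
      with julia_denjoy_wolff[OF G dw z(1)] show "poisson_kernel \<tau> z \<le> 1 / (cmod (\<tau> - G z))\<^sup>2"
        by linarith
    qed simp
    finally have "1 * cmod (\<tau> - z) \<le> (M * cmod (\<tau> - z) / (cmod (\<tau> - G z))\<^sup>2) * cmod (\<tau> - z)"
      using M by (simp add: power2_eq_square mult.assoc)
    then have "1 \<le> M * cmod (\<tau> - z) / (cmod (\<tau> - G z))\<^sup>2"
      using nz mult_le_cancel_right_pos by blast
    then show "(cmod (G z - \<tau>))\<^sup>2 \<le> M * cmod (z - \<tau>)"
      using nz by (simp add: pos_le_divide_eq norm_minus_commute)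
  qed
  have "((\<lambda>z. sqrt (M * cmod (z - \<tau>))) \<longlongrightarrow> sqrt (M * cmod (\<tau> - \<tau>))) (at \<tau> within ?S)"
    by (intro tendsto_intros)
  then have "((\<lambda>z. sqrt (M * cmod (z - \<tau>))) \<longlongrightarrow> 0) (at \<tau> within ?S)" by simp
  then have "((\<lambda>z. G z - \<tau>) \<longlongrightarrow> 0) (at \<tau> within ?S)"
    by (rule Lim_null_comparison[rotated]) (use le in \<open>auto simp: eventually_at_filter\<close>)
  then show "(G \<longlongrightarrow> \<tau>) (at \<tau> within ?S)" by (simp add: LIM_zero_iff)
qed

text \<open>
  After composition with a Moebius map the automorphism and its inverse fix \<open>0\<close>. The Schwarz lemma
  for both yields equality in the Schwarz lemma, hence a rotation.
\<close>

lemma disc_automorphism_Moebius: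
  assumes T: "T holomorphic_on unit_disc" "T ` unit_disc \<subseteq> unit_disc"
    and S: "S holomorphic_on unit_disc" "S ` unit_disc \<subseteq> unit_disc"
    and ST: "\<And>z. z \<in> unit_disc \<Longrightarrow> S (T z) = z" and TS: "\<And>z. z \<in> unit_disc \<Longrightarrow> T (S z) = z"
  obtains c a where "cmod c = 1" "cmod a < 1"
    "\<And>z. z \<in> unit_disc \<Longrightarrow> T z = c * Moebius_function 0 a z"
proof -
  define a where "a = S 0"
  have aD: "a \<in> unit_disc" using S(2) by (simp add: a_def image_subset_iff)
  then have a: "cmod a < 1" "cmod (- a) < 1" by simp_all
  let ?m = "Moebius_function 0 a" and ?m' = "Moebius_function 0 (- a)"
  have m: "?m ` unit_disc \<subseteq> unit_disc" "?m' ` unit_disc \<subseteq> unit_disc"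
    using Moebius_function_norm_lt_1[OF a(1)] Moebius_function_norm_lt_1[OF a(2)] by auto
  have mm: "?m (?m' z) = z" "?m' (?m z) = z" if "z \<in> unit_disc" for z
    using Moebius_function_compose[of a "-a" z] Moebius_function_compose[of "-a" a z] a that by auto
  have h: "T \<circ> ?m' holomorphic_on unit_disc" and k: "?m \<circ> S holomorphic_on unit_disc"
    using holomorphic_on_compose_gen[OF Moebius_function_holomorphic[OF a(2)] T(1) m(2)]
      holomorphic_on_compose_gen[OF S(1) Moebius_function_holomorphic[OF a(1)] S(2)] by auto
  have h0: "(T \<circ> ?m') 0 = 0" "(?m \<circ> S) 0 = 0"
    using TS[of 0] by (simp_all add: Moebius_function_of_zero Moebius_function_eq_zero a_def)
  have hn: "cmod ((T \<circ> ?m') z) < 1" "cmod ((?m \<circ> S) z) < 1" if "cmod z < 1" for z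
    using T(2) S(2) m that by (auto simp: image_subset_iff)
  \<comment> \<open>Any nonzero point of the disc would do.\<close>
  let ?z = "1/2 :: complex"
  have z: "cmod ?z < 1" "?z \<in> unit_disc" "?z \<noteq> 0" by simp_all
  have le1: "cmod ((T \<circ> ?m') ?z) \<le> cmod ?z" by (rule Schwarz_Lemma(1)[OF h h0(1) hn(1) z(1)])
  have "cmod ((?m \<circ> S) ((T \<circ> ?m') ?z)) \<le> cmod ((T \<circ> ?m') ?z)"
    by (rule Schwarz_Lemma(1)[OF k h0(2) hn(2) hn(1)[OF z(1)]])
  moreover have "?m' ?z \<in> unit_disc" using m(2) z(2) by blast
  then have "(?m \<circ> S) ((T \<circ> ?m') ?z) = ?z" using ST mm(1)[OF z(2)] by simp
  ultimately have "cmod ?z \<le> cmod ((T \<circ> ?m') ?z)" by (simp only:)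
  with le1 have "cmod ((T \<circ> ?m') ?z) = cmod ?z" by (rule antisym)
  then have "\<exists>z. cmod z < 1 \<and> z \<noteq> 0 \<and> cmod ((T \<circ> ?m') z) = cmod z" using z by blast
  from Schwarz_Lemma(3)[OF h h0(1) hn(1) z(1) disjI1[OF this]]
  obtain c where c: "\<And>z. cmod z < 1 \<Longrightarrow> (T \<circ> ?m') z = c * z" "cmod c = 1"
    by blast
  show ?thesis
  proof (rule that[OF c(2) a(1)])
    fix z :: complex assume z: "z \<in> unit_disc"
    then have "?m z \<in> unit_disc" using m(1) by blast
    then show "T z = c * ?m z" using c(1)[of "?m z"] mm(2)[OF z] by simp
  qed
qed

lemma one_minus_cnj_mult_lower:
  assumes "cmod z \<le> 1" shows "1 - cmod a \<le> cmod (1 - cnj a * z)"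
proof -
  have "cmod (cnj a * z) \<le> cmod a * 1" unfolding norm_mult using assms by (intro mult_mono) auto
  then show ?thesis using norm_triangle_ineq2[of 1 "cnj a * z"] by simp
qed

lemma of_real_one_minus_norm_square: "complex_of_real (1 - (cmod a)\<^sup>2) = 1 - a * cnj a"
  by (simp only: of_real_diff of_real_1 complex_norm_square)

lemma Moebius_difference:
  assumes "cmod a < 1" "cmod z \<le> 1" "cmod w \<le> 1"
  shows "Moebius_function 0 a z - Moebius_function 0 a w =
         (z - w) * of_real (1 - (cmod a)\<^sup>2) / ((1 - cnj a * z) * (1 - cnj a * w))"
proof -
  have "cmod (1 - cnj a * z) > 0" "cmod (1 - cnj a * w) > 0"
    using one_minus_cnj_mult_lower[of z a] one_minus_cnj_mult_lower[of w a] assms by auto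
  then have nz: "1 - cnj a * z \<noteq> 0" "1 - cnj a * w \<noteq> 0" by auto
  have "(z - w) * of_real (1 - (cmod a)\<^sup>2) = (z - w) * (1 - a * cnj a)"
    by (simp only: of_real_one_minus_norm_square)
  also have "\<dots> = (z - a) * (1 - cnj a * w) - (w - a) * (1 - cnj a * z)" by (simp add: algebra_simps)
  finally show ?thesis
    unfolding Moebius_function_simple diff_frac_eq[OF nz] by (simp add: mult_ac)
qed

lemma norm_Moebius_on_circle:
  assumes "cmod a < 1" "cmod \<tau> = 1" shows "cmod (Moebius_function 0 a \<tau>) = 1"
proof -
  have "cmod (1 - cnj a * \<tau>) = cmod (\<tau> - a)"
    using norm_one_minus_cnj_unit[OF assms(2), of a]
    by (metis complex_cnj_cnj complex_cnj_diff complex_cnj_mult complex_cnj_one complex_mod_cnj mult.commute)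
  moreover have "cmod (\<tau> - a) \<noteq> 0" using assms by auto
  ultimately show ?thesis by (simp add: Moebius_function_simple norm_divide)
qed

lemma Moebius_field_derivative:
  assumes "cmod a < 1" "cmod z \<le> 1"
  shows "(Moebius_function 0 a has_field_derivative of_real (1 - (cmod a)\<^sup>2) / (1 - cnj a * z)\<^sup>2) (at z)"
proof -
  have nz: "1 - cnj a * z \<noteq> 0" using one_minus_cnj_mult_lower[of z a] assms by auto
  have "((\<lambda>z. (z - a) / (1 - cnj a * z)) has_field_derivative
      ((1 - cnj a * z) - (z - a) * (- cnj a)) / ((1 - cnj a * z) * (1 - cnj a * z))) (at z)"
    using nz by (auto intro!: derivative_eq_intros)
  also have "(1 - cnj a * z) - (z - a) * (- cnj a) = of_real (1 - (cmod a)\<^sup>2)"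
    unfolding of_real_one_minus_norm_square by (simp add: algebra_simps)
  finally show ?thesis by (simp add: Moebius_function_simple[abs_def] power2_eq_square)
qed

text \<open>
  Up to the boundary a Moebius map is Lipschitz, and it decreases \<open>1 - |z|\<^sup>2\<close> at most by a constant
  factor; so it maps a Stolz region into a Stolz region at the image point.
\<close>

lemma Moebius_Stolz:
  assumes a: "cmod a < 1" and c: "cmod c = 1" and \<tau>: "cmod \<tau> = 1"
    and z: "cmod z < 1" "cmod (z - \<tau>) < M * (1 - cmod z)"
  defines "S \<equiv> (\<lambda>z. c * Moebius_function 0 a z)"
  shows "cmod (S z - S \<tau>) < 8 * M / (1 - cmod a)\<^sup>2 * (1 - cmod (S z))"
proof -
  let ?A = "1 - (cmod a)\<^sup>2" and ?k = "1 - cmod a"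
  have A: "?A > 0" and k: "?k > 0" using a by (auto simp: abs_square_less_1)
  have lowz: "?k \<le> cmod (1 - cnj a * z)" and low\<tau>: "?k \<le> cmod (1 - cnj a * \<tau>)"
    using one_minus_cnj_mult_lower[of z a] one_minus_cnj_mult_lower[of \<tau> a] z \<tau> by auto
  have "M * (1 - cmod z) > 0" using z(2) norm_ge_zero[of "z - \<tau>"] by linarith
  then have M: "M > 0" using z(1) by (simp add: zero_less_mult_iff)
  have "S z - S \<tau> = c * (Moebius_function 0 a z - Moebius_function 0 a \<tau>)"
    by (simp add: S_def right_diff_distrib)
  also have "cmod \<dots> = cmod (z - \<tau>) * ?A / (cmod (1 - cnj a * z) * cmod (1 - cnj a * \<tau>))"
    using Moebius_difference[OF a, of z \<tau>] z(1) \<tau> A c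
    by (simp add: norm_mult norm_divide del: of_real_diff)
  also have "\<dots> \<le> cmod (z - \<tau>) * ?A / (?k * ?k)"
    using lowz low\<tau> k A by (intro divide_left_mono mult_mono mult_pos_pos) auto
  also have "\<dots> < (M * (1 - cmod z)) * ?A / (?k * ?k)"
    using z(2) A k by (intro divide_strict_right_mono mult_strict_right_mono mult_pos_pos) auto
  also have "\<dots> = M / ?k\<^sup>2 * (?A * (1 - cmod z))" by (simp add: power2_eq_square)
  \<comment> \<open>The factor \<open>8\<close> comes from \<open>|1 - cnj a * z|\<^sup>2 \<le> 4\<close> and \<open>1 + |S z| \<le> 2\<close>.\<close>
  also have "\<dots> \<le> M / ?k\<^sup>2 * (8 * (1 - cmod (S z)))"
  proof (rule mult_left_mono)
    have "cmod (cnj a * z) \<le> 1 * 1" unfolding norm_mult using a z by (intro mult_mono) auto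
    then have up: "cmod (1 - cnj a * z) \<le> 2"
      using norm_triangle_ineq4[of 1 "cnj a * z"] by simp
    have m: "cmod (S z) = pseudo_dist a z" by (simp add: S_def c norm_mult pseudo_dist_eq_Moebius)
    have lt: "cmod (S z) < 1" unfolding m by (rule pseudo_dist_less_1[OF a z(1)])
    have "(cmod z)\<^sup>2 \<le> cmod z" using z by (simp add: power2_eq_square mult_left_le_one_le)
    then have "?A * (1 - cmod z) \<le> ?A * (1 - (cmod z)\<^sup>2)" using A by (intro mult_left_mono) auto
    also have "\<dots> = (1 - (cmod (S z))\<^sup>2) * (cmod (1 - cnj a * z))\<^sup>2"
      unfolding m one_minus_pseudo_dist_squared[OF a z(1)] using lowz k by auto
    also have "\<dots> \<le> (1 - (cmod (S z))\<^sup>2) * 2\<^sup>2"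
      using up lt by (intro mult_left_mono power_mono) (auto simp: power_le_one)
    also have "1 - (cmod (S z))\<^sup>2 = (1 - cmod (S z)) * (1 + cmod (S z))"
      by (simp add: power2_eq_square algebra_simps)
    also have "\<dots> \<le> (1 - cmod (S z)) * 2" using lt by (intro mult_left_mono) auto
    finally show "?A * (1 - cmod z) \<le> 8 * (1 - cmod (S z))" by simp
  qed (use M in simp)
  also have "M / ?k\<^sup>2 * (8 * x) = 8 * M / ?k\<^sup>2 * x" for x by simp
  finally show ?thesis .
qed

text \<open>
  The derivative of \<open>T \<circ> G \<circ> S\<close> at \<open>z\<close> is \<open>T' (G u) G' u / T' u\<close> with \<open>u = S z\<close>. As \<open>z\<close> tends to the new
  Denjoy-Wolff point non-tangentially, \<open>u\<close> tends to \<open>\<tau>\<close> non-tangentially, and then \<open>G u\<close> tends to \<open>\<tau>\<close>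
  by Julia's inequality. Since \<open>T'\<close> extends continuously to the circle without zeros, both outer factors tend to
  \<open>T' \<tau>\<close> and cancel.
\<close>

lemma hyperbolic_self_map_conjugate:
  assumes G: "hyperbolic_self_map G \<tau> \<alpha>"
    and T: "T holomorphic_on unit_disc" "T ` unit_disc \<subseteq> unit_disc"
    and S: "S holomorphic_on unit_disc" "S ` unit_disc \<subseteq> unit_disc"
    and ST: "\<And>z. z \<in> unit_disc \<Longrightarrow> S (T z) = z" and TS: "\<And>z. z \<in> unit_disc \<Longrightarrow> T (S z) = z"
    and H: "\<And>z. z \<in> unit_disc \<Longrightarrow> H z = T (G (S z))"
  shows "\<exists>\<tau>'. hyperbolic_self_map H \<tau>' \<alpha>"
proof -
  have Gh: "G holomorphic_on unit_disc" and Gm: "G ` unit_disc \<subseteq> unit_disc"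
    and nofix: "\<And>z. z \<in> unit_disc \<Longrightarrow> G z \<noteq> z" and dw: "denjoy_wolff_point G \<tau>"
    and ang: "has_angular_limit (deriv G) (of_real \<alpha>) \<tau>" and \<alpha>: "0 < \<alpha>" "\<alpha> < 1"
    using G by (auto simp: hyperbolic_self_map_def)
  have Tin: "T z \<in> unit_disc" and Sin: "S z \<in> unit_disc" and Gin: "G z \<in> unit_disc"
    if "z \<in> unit_disc" for z using T S Gm that by blast+
  have norm_\<tau>: "cmod \<tau> = 1" using dw by (simp add: denjoy_wolff_point_def)
  obtain c a where c: "cmod c = 1" and a: "cmod a < 1"
    and Teq: "\<And>z. z \<in> unit_disc \<Longrightarrow> T z = c * Moebius_function 0 a z"
    by (rule disc_automorphism_Moebius[OF T S ST TS]) blast+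
  obtain c' a' where c': "cmod c' = 1" and a': "cmod a' < 1"
    and Seq: "\<And>z. z \<in> unit_disc \<Longrightarrow> S z = c' * Moebius_function 0 a' z"
    by (rule disc_automorphism_Moebius[OF S T TS ST]) blast+
  define E where "E z = c * Moebius_function 0 a z" for z
  define E' where "E' z = c' * Moebius_function 0 a' z" for z
  define dE where "dE z = c * (of_real (1 - (cmod a)\<^sup>2) / (1 - cnj a * z)\<^sup>2)" for z
  have E_der: "(E has_field_derivative dE z) (at z)" if "cmod z \<le> 1" for z
    unfolding E_def[abs_def] dE_def by (intro DERIV_cmult Moebius_field_derivative a that)
  have E'_der: "(E' has_field_derivative c' * (of_real (1 - (cmod a')\<^sup>2) / (1 - cnj a' * z)\<^sup>2)) (at z)" if "cmod z \<le> 1" for z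
    unfolding E'_def[abs_def] by (intro DERIV_cmult Moebius_field_derivative a' that)
  have dT: "deriv T z = dE z" and T_der: "(T has_field_derivative dE z) (at z)" if z: "z \<in> unit_disc" for z
  proof -
    show "(T has_field_derivative dE z) (at z)"
      by (rule has_field_derivative_transform_within_open[OF E_der, of z unit_disc])
         (use z Teq in \<open>auto simp: E_def\<close>)
    then show "deriv T z = dE z" by (rule DERIV_imp_deriv)
  qed
  have "1 - (cmod a)\<^sup>2 \<noteq> 0" using a by (metis abs_norm_cancel abs_square_less_1 diff_gt_0_iff_gt less_numeral_extra(3))
  then have dE_nz: "dE z \<noteq> 0" if "cmod z \<le> 1" for z
    using one_minus_cnj_mult_lower[OF that, of a] a c unfolding dE_def
    by (auto simp del: of_real_diff)
  have dE_cont: "isCont dE z" if "cmod z \<le> 1" for z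
    using one_minus_cnj_mult_lower[OF that, of a] a unfolding dE_def[abs_def]
    by (intro continuous_intros) auto
  define \<tau>' where "\<tau>' = E \<tau>"
  have norm_\<tau>': "cmod \<tau>' = 1"
    unfolding \<tau>'_def E_def using norm_Moebius_on_circle[OF a norm_\<tau>] c by (simp add: norm_mult)
  have E_cont: "isCont E \<tau>" and E'_cont: "isCont E' \<tau>'"
    using E_der[of \<tau>] E'_der[of \<tau>'] norm_\<tau> norm_\<tau>' DERIV_isCont by auto
  have orbit_lim: "(\<lambda>n. (G ^^ n) u) \<longlonglongrightarrow> \<tau>" if "u \<in> unit_disc" for u
    using dw that by (simp add: denjoy_wolff_point_def)
  have orbit_in: "(G ^^ n) u \<in> unit_disc" if "u \<in> unit_disc" for u n
    by (rule funpow_in[OF Gm that])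
  have T_lim: "(\<lambda>n. T ((G ^^ n) u)) \<longlonglongrightarrow> \<tau>'" if u: "u \<in> unit_disc" for u
  proof -
    have "(\<lambda>n. E ((G ^^ n) u)) \<longlonglongrightarrow> E \<tau>"
      by (rule isCont_tendsto_compose[OF E_cont orbit_lim[OF u]])
    then show ?thesis using Teq[OF orbit_in[OF u]] by (simp add: E_def \<tau>'_def)
  qed
  \<comment> \<open>\<open>E\<close> and \<open>E'\<close> are inverse to each other only inside the disc; an orbit carries this to the boundary.\<close>
  have E'\<tau>': "E' \<tau>' = \<tau>"
  proof (rule LIMSEQ_unique)
    have 0: "(0::complex) \<in> unit_disc" by simp
    show "(\<lambda>n. E' (T ((G ^^ n) 0))) \<longlonglongrightarrow> E' \<tau>'"
      by (rule isCont_tendsto_compose[OF E'_cont T_lim[OF 0]])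
    have "E' (T ((G ^^ n) 0)) = (G ^^ n) 0" for n
      using Seq[OF Tin[OF orbit_in[OF 0]]] ST[OF orbit_in[OF 0]] by (simp add: E'_def)
    then show "(\<lambda>n. E' (T ((G ^^ n) 0))) \<longlonglongrightarrow> \<tau>" using orbit_lim[OF 0] by simp
  qed
  have H_iter: "(H ^^ n) z = T ((G ^^ n) (S z))" if z: "z \<in> unit_disc" for n z
  proof (induction n)
    case 0 then show ?case using TS[OF z] by simp
  next
    case (Suc n)
    have u: "(G ^^ n) (S z) \<in> unit_disc" by (rule orbit_in[OF Sin[OF z]])
    show ?case using Suc H[OF Tin[OF u]] ST[OF u] by simp
  qed
  have dwH: "denjoy_wolff_point H \<tau>'"
    unfolding denjoy_wolff_point_def using norm_\<tau>' H_iter T_lim[OF Sin] by simp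
  have "T \<circ> G holomorphic_on unit_disc" by (rule holomorphic_on_compose_gen[OF Gh T(1) Gm])
  then have "T \<circ> G \<circ> S holomorphic_on unit_disc"
    by (rule holomorphic_on_compose_gen[OF S(1) _ S(2)])
  then have H_hol: "H holomorphic_on unit_disc"
    by (rule holomorphic_transform) (simp add: H)
  have H_maps: "H ` unit_disc \<subseteq> unit_disc" using H Tin Gin Sin by auto
  have H_nofix: "H z \<noteq> z" if z: "z \<in> unit_disc" for z
  proof
    assume "H z = z"
    then have "S (T (G (S z))) = S z" using H[OF z] by simp
    then show False using ST[OF Gin[OF Sin[OF z]]] nofix[OF Sin[OF z]] by simp
  qed
  have dH: "deriv H z = dE (G (S z)) * deriv G (S z) / dE (S z)" if z: "z \<in> unit_disc" for z
  proof -
    have u: "S z \<in> unit_disc" by (rule Sin[OF z])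
    have S_der: "(S has_field_derivative deriv S z) (at z)"
      using holomorphic_derivI[OF S(1) _ z] by simp
    have "((T \<circ> S) has_field_derivative dE (S z) * deriv S z) (at z)"
      by (rule DERIV_chain[OF T_der[OF u] S_der])
    then have "((\<lambda>z. z) has_field_derivative dE (S z) * deriv S z) (at z)"
      by (rule has_field_derivative_transform_within_open[where S = unit_disc]) (use z TS in auto)
    then have 1: "dE (S z) * deriv S z = 1" using DERIV_unique DERIV_ident by metis
    have "(G has_field_derivative deriv G (S z)) (at (S z))"
      using holomorphic_derivI[OF Gh _ u] by simp
    from DERIV_chain[OF this S_der]
    have GS: "((G \<circ> S) has_field_derivative deriv G (S z) * deriv S z) (at z)" .
    have "(T has_field_derivative dE (G (S z))) (at ((G \<circ> S) z))"
      using T_der[OF Gin[OF u]] by simp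
    from DERIV_chain[OF this GS]
    have "((T \<circ> (G \<circ> S)) has_field_derivative dE (G (S z)) * (deriv G (S z) * deriv S z)) (at z)" .
    then have "(H has_field_derivative dE (G (S z)) * (deriv G (S z) * deriv S z)) (at z)"
      by (rule has_field_derivative_transform_within_open[where S = unit_disc]) (use z H in auto)
    then have "deriv H z = dE (G (S z)) * (deriv G (S z) * deriv S z)" by (rule DERIV_imp_deriv)
    moreover have "deriv S z = 1 / dE (S z)" using 1 dE_nz[of "S z"] u by (simp add: field_simps)
    ultimately show ?thesis by simp
  qed
  have "has_angular_limit (deriv H) (of_real \<alpha>) \<tau>'"
    unfolding has_angular_limit_def
  proof (intro allI impI)
    fix M :: real assume M: "M > 1"
    define M' where "M' = 8 * M / (1 - cmod a')\<^sup>2"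
    let ?St = "{z \<in> unit_disc. cmod (z - \<tau>') < M * (1 - cmod z)}"
    let ?St' = "{z \<in> unit_disc. cmod (z - \<tau>) < M' * (1 - cmod z)}"
    have "(1 - cmod a')\<^sup>2 \<le> 1" "0 < (1 - cmod a')\<^sup>2" using a' by (auto simp: power_le_one)
    then have M': "M' > 1" using M unfolding M'_def by (simp add: pos_less_divide_eq)
    have S_St: "S z \<in> ?St'" if "z \<in> ?St" for z
    proof -
      have z: "z \<in> unit_disc" "cmod z < 1" "cmod (z - \<tau>') < M * (1 - cmod z)" using that by auto
      have "cmod (E' z - E' \<tau>') < M' * (1 - cmod (E' z))"
        unfolding E'_def M'_def by (rule Moebius_Stolz[OF a' c' norm_\<tau>' z(2,3)])
      moreover have "E' z = S z" using Seq[OF z(1)] by (simp add: E'_def)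
      ultimately show ?thesis using E'\<tau>' Sin[OF z(1)] by simp
    qed
    have "(E' \<longlongrightarrow> \<tau>) (at \<tau>' within ?St)"
      using E'_cont E'\<tau>' by (metis continuous_at_imp_continuous_within continuous_within)
    then have S_lim: "(S \<longlongrightarrow> \<tau>) (at \<tau>' within ?St)"
      by (rule Lim_transform_eventually) (auto simp: eventually_at_filter E'_def Seq)
    have fl: "filterlim S (at \<tau> within ?St') (at \<tau>' within ?St)"
      unfolding filterlim_at
    proof
      have "S z \<in> ?St' \<and> S z \<noteq> \<tau>" if "z \<in> ?St" for z
        using S_St[OF that] norm_\<tau> by auto
      then show "\<forall>\<^sub>F z in at \<tau>' within ?St. S z \<in> ?St' \<and> S z \<noteq> \<tau>"
        unfolding eventually_at_filter by (intro always_eventually allI impI)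
    qed (rule S_lim)
    have "((\<lambda>z. deriv G (S z)) \<longlongrightarrow> of_real \<alpha>) (at \<tau>' within ?St)"
      using ang M' fl unfolding has_angular_limit_def by (blast intro: filterlim_compose)
    moreover have "((\<lambda>z. G (S z)) \<longlongrightarrow> \<tau>) (at \<tau>' within ?St)"
      using angular_limit_denjoy_wolff[OF Gh Gm dw] M' fl
      unfolding has_angular_limit_def by (blast intro: filterlim_compose)
    ultimately have "((\<lambda>z. dE (G (S z)) * deriv G (S z) / dE (S z)) \<longlongrightarrow> dE \<tau> * of_real \<alpha> / dE \<tau>) (at \<tau>' within ?St)"
      using dE_cont[of \<tau>] dE_nz[of \<tau>] norm_\<tau> S_lim
      by (intro tendsto_intros isCont_tendsto_compose[of _ dE]) auto
    then have "((\<lambda>z. dE (G (S z)) * deriv G (S z) / dE (S z)) \<longlongrightarrow> of_real \<alpha>) (at \<tau>' within ?St)"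
      using dE_nz[of \<tau>] norm_\<tau> by simp
    then show "(deriv H \<longlongrightarrow> of_real \<alpha>) (at \<tau>' within ?St)"
      by (rule Lim_transform_eventually) (auto simp: eventually_at_filter dH)
  qed
  then show ?thesis
    using H_hol H_maps H_nofix dwH \<alpha> unfolding hyperbolic_self_map_def by blast
qed

lemma hyperbolic_self_map_change_of_conformal_map:
  assumes \<psi>: "conformal_onto_disc \<psi> \<Omega>" and \<phi>: "conformal_onto_disc \<phi> \<Omega>" and g: "g ` \<Omega> \<subseteq> \<Omega>"
    and hyp: "hyperbolic_self_map (conjugate_map \<Omega> \<psi> g) \<tau> \<alpha>"
  shows "\<exists>\<tau>'. hyperbolic_self_map (conjugate_map \<Omega> \<phi> g) \<tau>' \<alpha>"
proof (rule hyperbolic_self_map_conjugate[OF hyp, of "\<phi> \<circ> inv_into \<Omega> \<psi>" "\<psi> \<circ> inv_into \<Omega> \<phi>"])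
  note P = conformal_onto_discD[OF \<psi>] and F = conformal_onto_discD[OF \<phi>]
  show "\<phi> \<circ> inv_into \<Omega> \<psi> holomorphic_on unit_disc"
    by (rule holomorphic_on_compose_gen[OF P(2) F(1)]) (use P(4) in blast)
  show "\<psi> \<circ> inv_into \<Omega> \<phi> holomorphic_on unit_disc"
    by (rule holomorphic_on_compose_gen[OF F(2) P(1)]) (use F(4) in blast)
  show "(\<phi> \<circ> inv_into \<Omega> \<psi>) ` unit_disc \<subseteq> unit_disc" "(\<psi> \<circ> inv_into \<Omega> \<phi>) ` unit_disc \<subseteq> unit_disc"
    using P(3,4) F(3,4) by (auto simp: image_subset_iff)
  show "(\<psi> \<circ> inv_into \<Omega> \<phi>) ((\<phi> \<circ> inv_into \<Omega> \<psi>) z) = z" if "z \<in> unit_disc" for z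
    using P(4)[OF that] P(6)[OF that] F(5) by simp
  show "(\<phi> \<circ> inv_into \<Omega> \<psi>) ((\<psi> \<circ> inv_into \<Omega> \<phi>) z) = z" if "z \<in> unit_disc" for z
    using F(4)[OF that] F(6)[OF that] P(5) by simp
  show "conjugate_map \<Omega> \<phi> g z =
      (\<phi> \<circ> inv_into \<Omega> \<psi>) (conjugate_map \<Omega> \<psi> g ((\<psi> \<circ> inv_into \<Omega> \<phi>) z))" if "z \<in> unit_disc" for z
  proof -
    have "inv_into \<Omega> \<phi> z \<in> \<Omega>" by (rule F(4)[OF that])
    moreover from this have "g (inv_into \<Omega> \<phi> z) \<in> \<Omega>" using g by blast
    ultimately show ?thesis using P(5) by (simp add: conjugate_map_def)
  qed
qed

section \<open>Equivalence of the conditions\<close>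

theorem theorem3p18:
  fixes \<Omega> :: "complex set" and \<psi> g :: "complex \<Rightarrow> complex" and \<tau> :: complex and \<alpha> :: real
  assumes "open \<Omega>" and "\<Omega> \<noteq> {}" and "simply_connected \<Omega>" and "\<Omega> \<noteq> UNIV"
    and "conformal_onto_disc \<psi> \<Omega>"
    and "g holomorphic_on \<Omega>" and "g ` \<Omega> \<subseteq> \<Omega>" and "\<forall>z\<in>\<Omega>. g z \<noteq> z"
    and "hyperbolic_self_map (conjugate_map \<Omega> \<psi> g) \<tau> \<alpha>"
  shows
    "(extremal_hyperbolic_rate \<Omega> g \<alpha> \<longleftrightarrow> (\<forall>z\<in>\<Omega>. \<forall>w\<in>\<Omega>. hyperbolic_rate_at \<Omega> g \<alpha> z w)) \<and>
     (extremal_hyperbolic_rate \<Omega> g \<alpha> \<longleftrightarrow>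
        extremal_hyperbolic_rate unit_disc (conjugate_map \<Omega> \<psi> g) \<alpha>) \<and>
     (\<forall>\<sigma>. herglotz_measure (conjugate_map \<Omega> \<psi> g) \<tau> \<alpha> \<sigma> \<longrightarrow>
        (extremal_hyperbolic_rate unit_disc (conjugate_map \<Omega> \<psi> g) \<alpha> \<longleftrightarrow>
           integrable \<sigma> (\<lambda>\<zeta>. ln (1 / cmod (\<zeta> - \<tau>))))) \<and>
     (\<forall>\<phi>. conformal_onto_disc \<phi> \<Omega> \<longrightarrow>
        (\<exists>\<tau>'. hyperbolic_self_map (conjugate_map \<Omega> \<phi> g) \<tau>' \<alpha>) \<and>
        (extremal_hyperbolic_rate unit_disc (conjugate_map \<Omega> \<phi> g) \<alpha> \<longleftrightarrow>
           extremal_hyperbolic_rate unit_disc (conjugate_map \<Omega> \<psi> g) \<alpha>))"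
proof (intro conjI allI impI)
  note \<Omega> = assms(1,3,2) and \<psi> = assms(5) and g = assms(6,7) and hyp = assms(9)
  note rate = extremal_rate_iff_boundary_rate[OF \<Omega> _ g, of _ \<alpha>]
  have disc: "extremal_hyperbolic_rate unit_disc (conjugate_map \<Omega> \<phi> g) \<alpha> \<longleftrightarrow>
      boundary_rate (conjugate_map \<Omega> \<phi> g) \<alpha> 0" if "conformal_onto_disc \<phi> \<Omega>" for \<phi>
    by (rule extremal_rate_unit_disc[OF conjugate_map_self_map[OF that g]])
  show "extremal_hyperbolic_rate \<Omega> g \<alpha> \<longleftrightarrow> (\<forall>z\<in>\<Omega>. \<forall>w\<in>\<Omega>. hyperbolic_rate_at \<Omega> g \<alpha> z w)"
    unfolding rate(1)[OF \<psi>] rate(2)[OF \<psi>] ..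
  show "extremal_hyperbolic_rate \<Omega> g \<alpha> \<longleftrightarrow>
      extremal_hyperbolic_rate unit_disc (conjugate_map \<Omega> \<psi> g) \<alpha>"
    unfolding rate(1)[OF \<psi>] disc[OF \<psi>] ..
  show "extremal_hyperbolic_rate unit_disc (conjugate_map \<Omega> \<psi> g) \<alpha> \<longleftrightarrow>
      integrable \<sigma> (\<lambda>\<zeta>. ln (1 / cmod (\<zeta> - \<tau>)))"
    if \<sigma>: "herglotz_measure (conjugate_map \<Omega> \<psi> g) \<tau> \<alpha> \<sigma>" for \<sigma>
  proof -
    interpret herglotz_map "conjugate_map \<Omega> \<psi> g" \<tau> \<alpha> \<sigma>
      using hyp \<sigma> by unfold_locales (auto simp: hyperbolic_self_map_def denjoy_wolff_point_def)
    show ?thesis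
      using rate_iff_log_integrable unfolding disc[OF \<psi>] boundary_rate_def orb_def .
  qed
  show "\<exists>\<tau>'. hyperbolic_self_map (conjugate_map \<Omega> \<phi> g) \<tau>' \<alpha>" if "conformal_onto_disc \<phi> \<Omega>" for \<phi>
    by (rule hyperbolic_self_map_change_of_conformal_map[OF \<psi> that g(2) hyp])
  show "extremal_hyperbolic_rate unit_disc (conjugate_map \<Omega> \<phi> g) \<alpha> \<longleftrightarrow>
      extremal_hyperbolic_rate unit_disc (conjugate_map \<Omega> \<psi> g) \<alpha>"
    if \<phi>: "conformal_onto_disc \<phi> \<Omega>" for \<phi>
    unfolding disc[OF \<phi>] disc[OF \<psi>] using rate(1)[OF \<psi>] rate(1)[OF \<phi>] by simp
qed

end
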